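(* For $0<|q|<1$, \begin{align*} \overline{r}_0(0)&=\frac{J_{6}^{12}}{6J_{1,6}^8J_{2}^4J_{3,6}}+\frac{2J_{6}^3J_{3,6}}{3J^2_{1,6}J_{2}}-\frac{J_{1,6}^4J_2^2J_{3,6}^3}{3J_{6}^6}+\frac{2}{J_{3,6}}\sum_{n=-\infty}^\infty\frac{(-1)^nq^{3n^2+3n}}{(1+q^{3n})^2},\\ \overline{r}_1(0)&=\frac{J_{6}^{12}}{6J_{1,6}^8J_{2}^4J_{3,6}}+\frac{J_{1,6}^4J_2^2J_{3,6}^3}{3J_{6}^6}-\frac{2}{J_{3,6}}\sum_{n=-\infty}^\infty\frac{(-1)^nq^{3n^2+3n}}{(1+q^{3n})^2},\\ \overline{r}_2(0)&=\frac{J_{6}^{12}}{6J_{1,6}^8J_{2}^4J_{3,6}}-\frac{J_{6}^3J_{3,6}}{3J^2_{1,6}J_{2}}-\frac{J_{1,6}^4J_2^2J_{3,6}^3}{3J_{6}^6}+\frac{2}{J_{3,6}}\sum_{n=-\infty}^\infty\frac{(-1)^nq^{3n^2+3n}}{(1+q^{3n})^2},\\ \overline{r}_3(0)&=\frac{J_{6}^{12}}{6J_{1,6}^8J_{2}^4J_{3,6}}+\frac{J_{1,6}^4J_2^2J_{3,6}^3}{3J_{6}^6}-\frac{2}{J_{3,6}}\sum_{n=-\infty}^\infty\frac{(-1)^nq^{3n^2+3n}}{(1+q^{3n})^2}. \end{align*}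
   Context: An overpartition of a non-negative integer $n$ is a partition of $n$ in which the first occurrence of each distinct part may be overlined; the empty overpartition of $0$ is counted and has rank $0$. The rank of an overpartition is its largest part minus its number of parts. $\overline N(s,6,n)$ is the number of overpartitions of $n$ with rank congruent to $s$ modulo $6$, and $\overline r_s(d)=\sum_{n\ge0}\overline N(s,6,3n+d)q^n$. Notation: $(a;q)_\infty=\prod_{n\ge0}(1-aq^n)$, $j(z;q)=(z;q)_\infty(q/z;q)_\infty(q;q)_\infty$, $J_{a,m}=j(q^a;q^m)$, $J_m=(q^m;q^m)_\infty$. *)

theory Defs
  imports "HOL-Analysis.Analysis" "HOL-Library.Multiset" "HOL-Number_Theory.Cong"
begin

text \<open>
  An overpartition of \<open>n\<close> is encoded as a pair \<open>(P, S)\<close>: \<open>P\<close> is the multiset of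
  its parts, and \<open>S\<close> is the set of those part sizes whose first occurrence is overlined.
\<close>

definition overpartitions :: "nat \<Rightarrow> (nat multiset \<times> nat set) set" where
  "overpartitions n = {(P, S). 0 \<notin># P \<and> sum_mset P = n \<and> S \<subseteq> set_mset P}"

lemma finite_overpartitions: "finite (overpartitions n)"
proof -
  define A where "A = (\<Union>k\<le>n. multisets_of_size {..n} k)"
  have "finite A"
    unfolding A_def by (intro finite_UN_I finite_atMost finite_multisets_of_size)
  then have fin: "finite (A \<times> Pow {..n})"
    by simp
  have size_le: "size P \<le> sum_mset P" if "0 \<notin># P" for P :: "nat multiset"
    using that by (induction P) auto
  have part_le: "x \<le> sum_mset P" if "x \<in># P" for x and P :: "nat multiset"
    using that by (metis le_add1 insert_DiffM sum_mset.add_mset)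
  have "(P, S) \<in> A \<times> Pow {..n}" if "(P, S) \<in> overpartitions n" for P S
  proof -
    from that have P: "0 \<notin># P" "sum_mset P = n" "S \<subseteq> set_mset P"
      by (simp_all add: overpartitions_def)
    have sub: "set_mset P \<subseteq> {..n}"
      using part_le P(2) by (metis atMost_iff subsetI)
    have "size P \<le> n"
      using size_le[OF P(1)] P(2) by simp
    with sub have "P \<in> A"
      by (simp add: A_def multisets_of_size_def)
    moreover have "S \<subseteq> {..n}"
      using P(3) sub by (rule subset_trans)
    ultimately show ?thesis
      by simp
  qed
  then have "overpartitions n \<subseteq> A \<times> Pow {..n}"
    by (intro subrelI)
  then show ?thesis
    using fin by (rule finite_subset)
qed

definition overpartition_rank :: "nat multiset \<times> nat set \<Rightarrow> int" where
  "overpartition_rank \<pi> =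
     (if fst \<pi> = {#} then 0 else int (Max (set_mset (fst \<pi>))) - int (size (fst \<pi>)))"

definition Nbar :: "int \<Rightarrow> int \<Rightarrow> nat \<Rightarrow> nat" where
  "Nbar s m n = card {\<pi> \<in> overpartitions n. [overpartition_rank \<pi> = s] (mod m)}"

definition rbar :: "int \<Rightarrow> nat \<Rightarrow> complex \<Rightarrow> complex" where
  "rbar s d q = (\<Sum>n. of_nat (Nbar s 6 (3 * n + d)) * q ^ n)"

definition qpoch_inf :: "complex \<Rightarrow> complex \<Rightarrow> complex" where
  "qpoch_inf a q = (\<Prod>n. 1 - a * q ^ n)"

definition theta_j :: "complex \<Rightarrow> complex \<Rightarrow> complex" where
  "theta_j z q = qpoch_inf z q * qpoch_inf (q / z) q * qpoch_inf q q"

text \<open>\<open>JJ a m q\<close> is $J_{a,m}$ and \<open>J m q\<close> is $J_m$.\<close>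

definition JJ :: "nat \<Rightarrow> nat \<Rightarrow> complex \<Rightarrow> complex" where
  "JJ a m q = theta_j (q ^ a) (q ^ m)"

definition J :: "nat \<Rightarrow> complex \<Rightarrow> complex" where
  "J m q = qpoch_inf (q ^ m) (q ^ m)"

end

(*
  Write R(z; q) for the rank generating function.  Comparing q-difference equations under z -> q z
  shows that (1 + z) R(z; q) / (1 - z) = N(z; q), the Appell-type function
  1 + 2 z F(z) / theta(q) with F(z) = sum of (-1)^n q^(n^2 + n) / (1 - z q^n) over all integers n:
  the difference of the two sides, times the square of a theta function and 1 / z, is analytic in an
  annulus and changes sign under z -> q z, so it is constant by the maximum principle, hence zero.
  Setting z = 1 gives Gauss's product for theta(q).

  Average N(z; c) over the three cube roots c of q.  This average T(z) and N(z^3; q^3) satisfy the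
  same equation under z -> q z, so after multiplication by j(z^3; q) / j(z^3; q^3) their difference
  changes sign, and so do the theta quotients j(-z; q) / j(z; q) and
  j(-z^3; q^3) / j(z^3; q^3).  Matching residues at the cube roots of unity makes the combination
  analytic, hence zero.  Evaluated at the sixth roots of unity, the resulting identity gives the four
  stated formulas; only at z = -1 does the Appell sum N(z^3; q^3) survive.
*)
theory Submission
  imports Defs "HOL-Complex_Analysis.Complex_Analysis"
begin

section \<open>Analytic functions on annuli and infinite products\<close>

text \<open>Why averaging helps: three steps \<open>z\<close> to \<open>c * z\<close> in nome
  \<open>c\<close> make one step \<open>z\<close> to \<open>q * z\<close>, and the extra terms carry
  \<open>c ^ 5\<close> and \<open>c ^ 8\<close>, which the average over the cube roots of
  \<open>q\<close> annihilates. What remains is exactly one step of the same equation in nome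
  \<open>q ^ 3\<close> at \<open>z ^ 3\<close>. The theta quotient supplies zeros at
  \<open>z ^ 3 = q\<close> and \<open>z ^ 3 = q ^ 2\<close>, where only the average can have poles.
  The multiplier -1 turns "constant" into "zero".

  The evaluations are not plain substitutions. At \<open>z = 1\<close> the average is a mean of
  reciprocals of theta values and is computed from their 3-dissection. At a primitive cube root of
  unity the Appell term has a pole, and oddness under \<open>z\<close> to \<open>1 / z\<close> takes
  its place. At \<open>z = -1\<close> both sides of the identity vanish, so a factor
  \<open>1 + z\<close> is divided out before the limit; this is the origin of the factor 3 in front
  of the surviving sum.\<close>

lemma connected_annulus:
  assumes "0 < r1"
  shows "connected {z::complex. r1 < norm z \<and> norm z < r2}"
proof -
  have "{z::complex. r1 < norm z \<and> norm z < r2} = exp ` (Re -` {ln r1<..<ln r2})"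
    if "r1 < r2"
  proof (intro equalityI subsetI)
    fix z :: complex assume z: "z \<in> {z. r1 < norm z \<and> norm z < r2}"
    then have nz: "z \<noteq> 0" using assms by auto
    then have "z = exp (Ln z)" by simp
    moreover have "Re (Ln z) = ln (norm z)" using nz by simp
    moreover have "ln r1 < ln (norm z)" "ln (norm z) < ln r2"
      using z assms nz that by (auto intro!: ln_less_cancel_iff[THEN iffD2])
    ultimately show "z \<in> exp ` (Re -` {ln r1<..<ln r2})" by (intro image_eqI[of _ _ "Ln z"]) auto
  next
    fix z :: complex assume "z \<in> exp ` (Re -` {ln r1<..<ln r2})"
    then obtain x where x: "z = exp x" "ln r1 < Re x" "Re x < ln r2" by auto
    have "exp (ln r1) < exp (Re x)" "exp (Re x) < exp (ln r2)" using x by auto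
    then show "z \<in> {z. r1 < norm z \<and> norm z < r2}" using assms that x by simp
  qed
  moreover have "convex (Re -` {ln r1<..<ln r2})"
    by (intro convex_linear_vimage) (auto simp: bounded_linear_Re bounded_linear.linear)
  ultimately have "connected {z::complex. r1 < norm z \<and> norm z < r2}" if "r1 < r2"
    using that by (simp add: connected_continuous_image convex_connected continuous_on_exp)
  moreover have "{z::complex. r1 < norm z \<and> norm z < r2} = {}" if "\<not> r1 < r2"
    using that by auto
  ultimately show ?thesis by (metis connected_empty)
qed

lemma open_annulus: "open {z::complex. r1 < norm z \<and> norm z < r2}"
  by (intro open_Collect_conj open_Collect_less continuous_intros)

text \<open>Passing from \<open>z\<close> to \<open>q * z\<close> preserves
  \<open>norm (K z)\<close>, so a maximum over a closed annulus of ratio \<open>norm q\<close> can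
  be moved off the inner circle and then dominates a whole neighbourhood; the maximum modulus
  principle applies. The multiplier is assumed exactly where both \<open>z\<close> and
  \<open>q * z\<close> lie in the domain.\<close>

lemma annulus_multiplier_constant:
  fixes K :: "complex \<Rightarrow> complex"
  assumes hol: "K holomorphic_on {z. norm q < norm z \<and> norm z < r}"
    and q: "0 < norm q" "norm q < 1" and r: "1 < r" and c: "norm c = 1"
    and mult: "\<And>z. 1 < norm z \<Longrightarrow> norm z < r \<Longrightarrow> K (q * z) = c * K z"
  shows "K constant_on {z. norm q < norm z \<and> norm z < r}"
proof -
  define S where "S = {z::complex. norm q < norm z \<and> norm z < r}"
  \<comment> \<open>Above 1, so that the multiplier acts on the circle of radius
    \<open>\<rho>\<close>; below \<open>1 / norm q\<close>, so that points a little outside that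
    circle fall back into \<open>C\<close> after one factor \<open>q\<close>.\<close>
  define \<rho> where "\<rho> = (1 + min r (1 / norm q)) / 2"
  have "1 < 1 / norm q" using q by (auto simp: field_simps)
  then have \<rho>: "1 < \<rho>" "\<rho> < r" "\<rho> < 1 / norm q" using r by (auto simp: \<rho>_def min_def field_simps)
  have \<rho>q: "\<rho> * norm q < 1" using \<rho>(3) q by (simp add: field_simps)
  have \<rho>q': "norm q < \<rho> * norm q" using \<rho>(1) q by simp
  have \<rho>pos: "0 < \<rho>" using \<rho> by simp
  define C where "C = {z::complex. \<rho> * norm q \<le> norm z \<and> norm z \<le> \<rho>}"
  have CS: "C \<subseteq> S" using \<rho> \<rho>q' by (auto simp: C_def S_def)
  have "C = cball 0 \<rho> - ball 0 (\<rho> * norm q)" by (auto simp: C_def)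
  then have "compact C" by (simp add: compact_diff)
  moreover have "of_real \<rho> \<in> C" using \<rho>pos q by (simp add: C_def)
  moreover have "continuous_on C (\<lambda>z. norm (K z))"
    using hol CS unfolding S_def
    by (intro continuous_on_norm holomorphic_on_imp_continuous_on) (rule holomorphic_on_subset)
  ultimately obtain z0 where z0: "z0 \<in> C" "\<And>z. z \<in> C \<Longrightarrow> norm (K z) \<le> norm (K z0)"
    using continuous_attains_sup[of C "\<lambda>z. norm (K z)"] by blast
  \<comment> \<open>A maximum on the inner circle is carried to the outer one, which lies inside the
    open annulus \<open>U\<close>.\<close>
  have "\<exists>z1. \<rho> * norm q < norm z1 \<and> norm z1 \<le> \<rho> \<and> norm (K z1) = norm (K z0)"
  proof (cases "norm z0 = \<rho> * norm q")
    case True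
    have n: "norm (z0 / q) = \<rho>" using True q by (simp add: norm_divide)
    have "K (q * (z0 / q)) = c * K (z0 / q)" by (rule mult) (use n \<rho> in auto)
    then have "norm (K (z0 / q)) = norm (K z0)" using q c by (simp add: norm_mult)
    then show ?thesis using n \<rho> q by (intro exI[of _ "z0/q"]) auto
  next
    case False
    then show ?thesis using z0(1) by (intro exI[of _ z0]) (auto simp: C_def)
  qed
  then obtain z1 where z1: "\<rho> * norm q < norm z1" "norm z1 \<le> \<rho>" "norm (K z1) = norm (K z0)" by blast
  define U where "U = {z::complex. \<rho> * norm q < norm z \<and> norm z < min r (1 / norm q)}"
  have "K constant_on S"
  proof (rule maximum_modulus_principle)
    show "K holomorphic_on S" using hol by (simp add: S_def)
    show "open S" unfolding S_def by (rule open_annulus)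
    show "connected S" unfolding S_def by (rule connected_annulus) (use q in auto)
    show "open U" unfolding U_def by (rule open_annulus)
    show "U \<subseteq> S" using \<rho>q' by (auto simp: U_def S_def)
    show "z1 \<in> U" using z1 \<rho> by (auto simp: U_def)
    fix z assume z: "z \<in> U"
    show "norm (K z) \<le> norm (K z1)"
    proof (cases "norm z \<le> \<rho>")
      case True
      then show ?thesis using z z0(2)[of z] z1(3) by (auto simp: U_def C_def)
    next
      case False
      have "K (q * z) = c * K z" by (rule mult) (use False z \<rho> in \<open>auto simp: U_def\<close>)
      then have e: "norm (K (q * z)) = norm (K z)" using c by (simp add: norm_mult)
      have "norm q * norm z < 1" using z q by (auto simp: U_def field_simps)
      then have "q * z \<in> C" using False q \<rho>(1) by (auto simp: C_def norm_mult mult.commute)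
      then show ?thesis using z0(2)[of "q * z"] e z1(3) by simp
    qed
  qed
  then show ?thesis by (simp add: S_def)
qed

text \<open>A majorant chosen disc by disc makes the finite partial sums converge uniformly on that
  disc, and uniform limits of analytic functions are analytic.\<close>

lemma holomorphic_on_infsum:
  fixes f :: "'i \<Rightarrow> complex \<Rightarrow> complex"
  assumes "open S"
    and hol: "\<And>i. i \<in> I \<Longrightarrow> f i holomorphic_on S"
    and bnd: "\<And>z. z \<in> S \<Longrightarrow> \<exists>d>0. cball z d \<subseteq> S \<and>
                (\<exists>M. M summable_on I \<and> (\<forall>i\<in>I. \<forall>w\<in>cball z d. norm (f i w) \<le> M i))"
  shows "(\<lambda>z. \<Sum>\<^sub>\<infinity>i\<in>I. f i z) holomorphic_on S"
proof -
  have "(\<lambda>z. \<Sum>\<^sub>\<infinity>i\<in>I. f i z) field_differentiable (at z)" if z: "z \<in> S" for z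
  proof -
    obtain d M where d: "d > 0" "cball z d \<subseteq> S" "M summable_on I"
      "\<And>i w. i \<in> I \<Longrightarrow> w \<in> cball z d \<Longrightarrow> norm (f i w) \<le> M i" using bnd[OF z] by blast
    have u: "uniform_limit (cball z d) (\<lambda>X y. \<Sum>i\<in>X. f i y) (\<lambda>y. \<Sum>\<^sub>\<infinity>i\<in>I. f i y)
               (finite_subsets_at_top I)"
      by (rule Weierstrass_m_test_general[OF d(4,3)])
    have h: "(\<lambda>y. \<Sum>i\<in>X. f i y) holomorphic_on S" if "X \<subseteq> I" for X
      by (intro holomorphic_on_sum hol) (use that in auto)
    have ev: "\<forall>\<^sub>F X in finite_subsets_at_top I. continuous_on (cball z d) (\<lambda>y. \<Sum>i\<in>X. f i y) \<and>
            (\<lambda>y. \<Sum>i\<in>X. f i y) holomorphic_on ball z d"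
      by (rule eventually_finite_subsets_at_top_weakI)
        (use h d(2) in \<open>blast intro: holomorphic_on_imp_continuous_on holomorphic_on_subset[OF h] ball_subset_cball[THEN subsetD]\<close>)
    have "(\<lambda>z. \<Sum>\<^sub>\<infinity>i\<in>I. f i z) holomorphic_on ball z d"
      by (rule holomorphic_uniform_limit[OF ev u]) auto
    then show ?thesis using d(1) by (simp add: holomorphic_on_open field_differentiable_def)
  qed
  then show ?thesis by (simp add: holomorphic_on_def field_differentiable_at_within)
qed

section \<open>Infinite q-products\<close>

lemma convergent_prod_qpoch:
  assumes "norm (q::complex) < 1"
  shows "convergent_prod (\<lambda>n. 1 - a * q ^ n)"
proof (rule abs_convergent_prod_imp_convergent_prod)
  have "summable (\<lambda>n. norm (a * q ^ n))"
    using assms by (simp add: norm_mult norm_power summable_geometric summable_mult)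
  then show "abs_convergent_prod (\<lambda>n. 1 - a * q ^ n)"
    by (intro summable_imp_abs_convergent_prod) simp
qed

lemma qpoch_inf_tendsto:
  assumes "norm q < 1"
  shows "(\<lambda>n. \<Prod>i<n. 1 - a * q ^ i) \<longlonglongrightarrow> qpoch_inf a q"
proof -
  have "(\<lambda>n. \<Prod>i\<le>n. 1 - a * q ^ i) \<longlonglongrightarrow> qpoch_inf a q"
    unfolding qpoch_inf_def by (rule convergent_prod_LIMSEQ[OF convergent_prod_qpoch[OF assms]])
  then show ?thesis
    by (subst filterlim_sequentially_Suc[symmetric]) (simp add: lessThan_Suc_atMost)
qed

lemma qpoch_inf_shift:
  assumes "norm q < 1"
  shows "qpoch_inf a q = (1 - a) * qpoch_inf (a * q) q"
proof -
  have "(\<lambda>n. (1 - a) * (\<Prod>i<n. 1 - a * q * q ^ i)) \<longlonglongrightarrow> (1 - a) * qpoch_inf (a * q) q"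
    by (intro tendsto_intros qpoch_inf_tendsto assms)
  also have "(\<lambda>n. (1 - a) * (\<Prod>i<n. 1 - a * q * q ^ i)) = (\<lambda>n. \<Prod>i<Suc n. 1 - a * q ^ i)"
    by (subst prod.lessThan_Suc_shift) (simp add: mult_ac)
  finally show ?thesis
    using qpoch_inf_tendsto[OF assms, of a, THEN LIMSEQ_Suc] LIMSEQ_unique by blast
qed

lemma qpoch_inf_eq_0_iff:
  assumes "norm q < 1"
  shows "qpoch_inf a q = 0 \<longleftrightarrow> (\<exists>n. a * q ^ n = 1)"
  using has_prod_eq_0_iff[OF convergent_prod_has_prod[OF convergent_prod_qpoch[OF assms, of a]]]
  unfolding qpoch_inf_def by (auto simp: image_iff) 

lemma qpoch_inf_nonzero:
  assumes "norm q < 1" "norm a < 1"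
  shows "qpoch_inf a q \<noteq> 0"
proof
  assume "qpoch_inf a q = 0"
  then obtain n where "a * q ^ n = 1" using qpoch_inf_eq_0_iff assms by blast
  then have "norm a * norm q ^ n = 1" by (metis norm_mult norm_one norm_power)
  moreover have "norm a * norm q ^ n \<le> norm a * 1"
    by (intro mult_left_mono power_le_one) (use assms in auto)
  ultimately show False using assms by simp
qed

lemma holomorphic_on_qpoch_inf:
  assumes "norm q < 1"
  shows "(\<lambda>z. qpoch_inf z q) holomorphic_on UNIV"
proof (rule holomorphic_uniform_sequence[where f = "\<lambda>n z. \<Prod>i<n. 1 - z * q ^ i"])
  fix z :: complex
  have "uniformly_convergent_on (cball z 1) (\<lambda>N x. \<Prod>n<N. 1 - x * q ^ n)"
  proof (rule uniformly_convergent_on_prod')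
    show "uniformly_convergent_on (cball z 1) (\<lambda>N x. \<Sum>n<N. norm (1 - x * q ^ n - 1))"
    proof (rule Weierstrass_m_test')
      fix n x assume "x \<in> cball z 1"
      then have "norm x \<le> norm z + 1"
        using norm_triangle_ineq2[of x z] by (simp add: dist_norm norm_minus_commute)
      then show "norm (norm (1 - x * q ^ n - 1)) \<le> (norm z + 1) * norm q ^ n"
        by (simp add: norm_mult norm_power mult_right_mono)
    qed (use assms in \<open>simp add: summable_mult summable_geometric\<close>)
  qed (auto intro!: continuous_intros)
  then obtain l where l: "uniform_limit (cball z 1) (\<lambda>N x. \<Prod>n<N. 1 - x * q ^ n) l sequentially"
    by (auto simp: uniformly_convergent_on_def)
  have "l x = qpoch_inf x q" if "x \<in> cball z 1" for x
    using tendsto_uniform_limitI[OF l that] qpoch_inf_tendsto[OF assms, of x] LIMSEQ_unique by blast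
  then have "uniform_limit (cball z 1) (\<lambda>N x. \<Prod>n<N. 1 - x * q ^ n) (\<lambda>x. qpoch_inf x q) sequentially"
    using l by (subst (asm) uniform_limit_cong') auto
  then show "\<exists>d>0. cball z d \<subseteq> UNIV \<and>
      uniform_limit (cball z d) (\<lambda>n z. \<Prod>i<n. 1 - z * q ^ i) (\<lambda>z. qpoch_inf z q) sequentially"
    by (intro exI[of _ 1]) auto
qed (auto intro!: holomorphic_intros)

lemma holomorphic_on_qpoch_inf_compose [holomorphic_intros]:
  assumes "norm q < 1" "f holomorphic_on A"
  shows "(\<lambda>z. qpoch_inf (f z) q) holomorphic_on A"
  using holomorphic_on_compose_gen[OF assms(2) holomorphic_on_qpoch_inf[OF assms(1)]]
  by (simp add: o_def)

lemma qpoch_inf_minus_mult: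
  assumes "norm q < 1"
  shows "qpoch_inf a q * qpoch_inf (- a) q = qpoch_inf (a^2) (q^2)"
proof -
  have "qpoch_inf a q * qpoch_inf (- a) q = (\<Prod>n. (1 - a * q ^ n) * (1 - (-a) * q ^ n))"
    unfolding qpoch_inf_def by (intro prodinf_mult convergent_prod_qpoch assms)
  also have "(\<lambda>n. (1 - a * q ^ n) * (1 - (-a) * q ^ n)) = (\<lambda>n. 1 - a^2 * (q^2) ^ n)"
  proof
    fix n
    have "(q^2)^n = (q^n)^2" by (simp add: power_mult [symmetric] mult.commute)
    then show "(1 - a * q ^ n) * (1 - (-a) * q ^ n) = 1 - a^2 * (q^2) ^ n"
      by (simp only:) (simp add: power2_eq_square algebra_simps)
  qed
  finally show ?thesis by (simp add: qpoch_inf_def)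
qed

lemma cube_root_unity_factor:
  fixes w :: complex
  assumes "1 + w + w^2 = 0"
  shows "(1 - a) * (1 - w * a) * (1 - w^2 * a) = 1 - a^3"
  using assms by algebra

lemma qpoch_inf_cube:
  assumes "norm q < 1" and w: "1 + w + w^2 = 0"
  shows "qpoch_inf a q * qpoch_inf (w * a) q * qpoch_inf (w^2 * a) q = qpoch_inf (a^3) (q^3)"
proof -
  have "qpoch_inf a q * qpoch_inf (w * a) q * qpoch_inf (w^2 * a) q =
     (\<Prod>n. (1 - a * q ^ n) * (1 - (w * a) * q ^ n)) * (\<Prod>n. 1 - (w^2 * a) * q ^ n)"
    unfolding qpoch_inf_def by (subst prodinf_mult) (auto intro!: convergent_prod_qpoch assms)
  also have "\<dots> = (\<Prod>n. (1 - a * q ^ n) * (1 - (w * a) * q ^ n) * (1 - (w^2 * a) * q ^ n))"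
    by (intro prodinf_mult convergent_prod_mult convergent_prod_qpoch assms)
  also have "(\<lambda>n. (1 - a * q ^ n) * (1 - (w * a) * q ^ n) * (1 - (w^2 * a) * q ^ n))
     = (\<lambda>n. 1 - a^3 * (q^3) ^ n)"
  proof
    fix n
    have "(q^3)^n = (q^n)^3" by (simp add: power_mult [symmetric] mult.commute)
    then show "(1 - a * q ^ n) * (1 - (w * a) * q ^ n) * (1 - (w^2 * a) * q ^ n) = 1 - a^3 * (q^3) ^ n"
      using cube_root_unity_factor[OF w, of "a * q^n"] by (simp add: power_mult_distrib mult_ac)
  qed
  finally show ?thesis by (simp add: qpoch_inf_def)
qed

text \<open>Factors are sorted by exponent modulo \<open>k\<close>: with
  \<open>m = j * k + i\<close>, a partial product of \<open>n * k\<close> factors is a product of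
  \<open>k\<close> partial products in nome \<open>q ^ k\<close>, and a subsequence of partial
  products keeps the limit.\<close>

lemma qpoch_inf_split:
  assumes "norm q < 1" "k > 0"
  shows "qpoch_inf a q = (\<Prod>i<k. qpoch_inf (a * q ^ i) (q ^ k))"
proof -
  have qk: "norm (q ^ k) < 1" using assms by (simp add: norm_power power_less_one_iff)
  have "(\<lambda>n. \<Prod>i<k. \<Prod>j<n. 1 - a * q ^ i * (q ^ k) ^ j) \<longlonglongrightarrow> (\<Prod>i<k. qpoch_inf (a * q ^ i) (q ^ k))"
    by (intro tendsto_prod qpoch_inf_tendsto qk)
  moreover have "(\<Prod>i<k. \<Prod>j<n. 1 - a * q ^ i * (q ^ k) ^ j) = (\<Prod>m<n * k. 1 - a * q ^ m)" for n
  proof -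
    have "(\<Prod>m<n * k. 1 - a * q ^ m) = (\<Prod>j<n. \<Prod>m\<in>{j*k..<j*k+k}. 1 - a * q ^ m)"
      by (rule prod.nat_group [symmetric])
    also have "\<dots> = (\<Prod>j<n. \<Prod>i<k. 1 - a * q ^ i * (q ^ k) ^ j)"
    proof (rule prod.cong[OF refl])
      fix j
      have "(\<Prod>m\<in>{j*k..<j*k+k}. 1 - a * q ^ m) = (\<Prod>m\<in>{0+j*k..<k+j*k}. 1 - a * q ^ m)"
        by (simp add: add.commute)
      also have "\<dots> = (\<Prod>i<k. 1 - a * q ^ i * (q ^ k) ^ j)"
        by (subst prod.shift_bounds_nat_ivl)
           (simp add: atLeast0LessThan power_add mult_ac flip: power_mult)
      finally show "(\<Prod>m\<in>{j*k..<j*k+k}. 1 - a * q ^ m) = (\<Prod>i<k. 1 - a * q ^ i * (q ^ k) ^ j)" .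
    qed
    finally show ?thesis by (subst prod.swap) simp
  qed
  moreover have "(\<lambda>n. \<Prod>m<n * k. 1 - a * q ^ m) \<longlonglongrightarrow> qpoch_inf a q"
    using LIMSEQ_subseq_LIMSEQ[OF qpoch_inf_tendsto[OF assms(1)], of "\<lambda>n. n * k"] assms(2)
    by (simp add: strict_mono_def o_def)
  ultimately show ?thesis using LIMSEQ_unique by force
qed

section \<open>Theta functions and Lambert sums\<close>

text \<open>This is \<open>theta_j\<close> without its factor \<open>1 - z\<close>. It has no zero
  for \<open>norm q < norm z < 1 / norm q\<close>, so its value at 1 governs the residue of
  \<open>1 / theta_j\<close> there.\<close>

definition theta_cof :: "complex \<Rightarrow> complex \<Rightarrow> complex" where
  "theta_cof z q = qpoch_inf (z * q) q * qpoch_inf (q / z) q * qpoch_inf q q"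

lemma theta_j_conv_cof:
  assumes "norm q < 1"
  shows "theta_j z q = (1 - z) * theta_cof z q"
  by (simp add: theta_j_def theta_cof_def qpoch_inf_shift[OF assms, of z])

lemma theta_j_mult:
  assumes "norm q < 1" "q \<noteq> 0" "z \<noteq> 0"
  shows "theta_j (q * z) q = - theta_j z q / z"
proof -
  have "qpoch_inf (1 / z) q = (1 - 1 / z) * qpoch_inf (q / z) q"
    using qpoch_inf_shift[OF assms(1), of "1 / z"] by simp
  moreover have "(1 - 1 / z) = - (1 - z) / z" using assms by (simp add: field_simps)
  moreover have "q / (q * z) = 1 / z" using assms by simp
  ultimately show ?thesis
    using assms(3) qpoch_inf_shift[OF assms(1), of z]
    by (simp only: theta_j_def mult.commute[of q z]) (simp add: field_simps)
qed

lemma theta_cof_inverse: "z \<noteq> 0 \<Longrightarrow> theta_cof (1 / z) q = theta_cof z q"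
  by (simp add: theta_cof_def mult_ac)

lemma theta_cof_1: "theta_cof 1 q = qpoch_inf q q ^ 3"
  by (simp add: theta_cof_def power3_eq_cube)

lemma theta_cof_nonzero:
  assumes "norm q < 1" "norm q < norm z" "norm z * norm q < 1"
  shows "theta_cof z q \<noteq> 0"
proof -
  have "norm (q / z) < 1" using assms by (auto simp: norm_divide divide_simps)
  then show ?thesis using assms unfolding theta_cof_def
    by (simp add: qpoch_inf_nonzero norm_mult)
qed

lemma holomorphic_on_theta_cof [holomorphic_intros]:
  assumes "norm q < 1" "f holomorphic_on A" "\<And>z. z \<in> A \<Longrightarrow> f z \<noteq> 0"
  shows "(\<lambda>z. theta_cof (f z) q) holomorphic_on A"
  unfolding theta_cof_def using assms by (intro holomorphic_intros) auto

lemma holomorphic_on_theta_j [holomorphic_intros]: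
  assumes "norm q < 1" "f holomorphic_on A" "\<And>z. z \<in> A \<Longrightarrow> f z \<noteq> 0"
  shows "(\<lambda>z. theta_j (f z) q) holomorphic_on A"
  unfolding theta_j_def using assms by (intro holomorphic_intros) auto

section \<open>Bilateral sums with quadratic exponents\<close>

lemma summable_on_int_abs_power:
  fixes x :: real
  assumes "0 < x" "x < 1"
  shows "(\<lambda>n::int. x ^ nat \<bar>n\<bar>) summable_on UNIV"
proof -
  have g: "(\<lambda>n::nat. x ^ n) summable_on UNIV"
    using assms by (intro norm_summable_imp_summable_on) (simp add: summable_geometric)
  have "(\<lambda>n::int. x ^ nat \<bar>n\<bar>) summable_on (int ` UNIV)"
    using g by (subst summable_on_reindex) (auto simp: o_def inj_on_def)
  moreover have "(\<lambda>n::int. x ^ nat \<bar>n\<bar>) summable_on ((\<lambda>n. - int n) ` UNIV)"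
    using g by (subst summable_on_reindex) (auto simp: o_def inj_on_def)
  moreover have "(UNIV :: int set) = int ` UNIV \<union> (\<lambda>n. - int n) ` UNIV"
    by (auto simp: image_iff) (metis int_cases2)
  ultimately show ?thesis by (metis summable_on_union)
qed

lemma summable_on_int_quadratic:
  fixes x :: real and b :: int
  assumes "0 < x" "x < 1"
  shows "(\<lambda>n::int. x powi (n^2 + b * n)) summable_on UNIV"
proof -
  \<comment> \<open>Large enough to give a linear lower bound for the exponent: when
    \<open>\<bar>n\<bar>\<close> exceeds \<open>\<bar>b\<bar>\<close> the square dominates,
    otherwise \<open>K\<close> does. The comparison series is then a two-sided geometric
    one.\<close>
  define K where "K = (\<bar>b\<bar> + 1)^2"
  have ge: "n^2 + b * n \<ge> \<bar>n\<bar> - K" for n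
  proof -
    have "b * n \<ge> - (\<bar>b\<bar> * \<bar>n\<bar>)"
      using abs_ge_minus_self[of "b * n"] by (simp add: abs_mult)
    moreover have "n^2 = \<bar>n\<bar>^2" by simp
    moreover have "\<bar>n\<bar>^2 + K \<ge> (\<bar>b\<bar> + 1) * \<bar>n\<bar>"
    proof (cases "\<bar>n\<bar> \<ge> \<bar>b\<bar> + 1")
      case True
      then have "\<bar>n\<bar> * \<bar>n\<bar> \<ge> (\<bar>b\<bar> + 1) * \<bar>n\<bar>" by (intro mult_right_mono) auto
      moreover have "0 \<le> K" by (simp add: K_def)
      ultimately show ?thesis by (simp add: power2_eq_square del: abs_mult_self_eq abs_mult_self)
    next
      case False
      then have "(\<bar>b\<bar> + 1) * (\<bar>b\<bar> + 1) \<ge> (\<bar>b\<bar> + 1) * \<bar>n\<bar>" by (intro mult_left_mono) auto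
      then show ?thesis unfolding K_def power2_eq_square using zero_le_square[of "\<bar>n\<bar>"] by linarith
    qed
    ultimately show ?thesis by (simp add: algebra_simps)
  qed
  have "(\<lambda>n::int. x powi (-K) * x ^ nat \<bar>n\<bar>) summable_on UNIV"
    by (intro summable_on_cmult_right summable_on_int_abs_power assms)
  then show ?thesis
  proof (rule summable_on_comparison_test)
    fix n :: int
    have "x powi (n^2 + b * n) \<le> x powi (\<bar>n\<bar> - K)"
      by (rule power_int_decreasing) (use ge[of n] assms in auto)
    also have "\<dots> = x powi (-K) * x ^ nat \<bar>n\<bar>"
    proof -
      have "x powi (\<bar>n\<bar> - K) = x powi \<bar>n\<bar> * x powi (-K)"
        using assms by (simp add: power_int_diff power_int_minus divide_inverse)
      moreover have "x powi \<bar>n\<bar> = x ^ nat \<bar>n\<bar>" by (simp add: power_int_def)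
      ultimately show ?thesis by simp
    qed
    finally show "x powi (n^2 + b * n) \<le> x powi (-K) * x ^ nat \<bar>n\<bar>" .
  qed (use assms in auto)
qed

lemma summable_on_int_quadratic_weighted:
  fixes q :: complex and b :: int
  assumes q: "0 < norm q" "norm q < 1" and c: "\<And>n. n \<in> A \<Longrightarrow> norm (c n) \<le> C"
  shows "(\<lambda>n::int. c n * q powi (n^2 + b * n)) summable_on A"
proof -
  have "(\<lambda>n::int. C * norm q powi (n^2 + b * n)) summable_on A"
    by (intro summable_on_cmult_right summable_on_subset[OF summable_on_int_quadratic] q) auto
  then have "(\<lambda>n. norm (c n * q powi (n^2 + b * n))) summable_on A"
    by (rule Infinite_Sum.abs_summable_on_comparison_test')
       (auto simp: norm_mult norm_power_int intro!: mult_right_mono c)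
  then show ?thesis by (rule abs_summable_summable)
qed

lemma norm_minus_one_powi [simp]: "norm ((-1::complex) powi n) = 1"
  by (simp add: norm_power_int)

text \<open>The theta series j(q; q^2). Its product and its nonvanishing are consequences of the
  rank relation further below.\<close>

definition alt_theta :: "complex \<Rightarrow> complex" where
  "alt_theta q = (\<Sum>\<^sub>\<infinity>n::int. (-1) powi n * q powi n^2)"

text \<open>The sum F of the overview, over a variable index set: dropping the index responsible for
  a pole leaves a function analytic there. With \<open>A = - {0}\<close> the only pole in the
  annulus around the unit circle, at 1, is gone.\<close>

definition lambert_sum :: "int set \<Rightarrow> complex \<Rightarrow> complex \<Rightarrow> complex" where
  "lambert_sum A q z = (\<Sum>\<^sub>\<infinity>n\<in>A. (-1) powi n * q powi (n^2 + n) / (1 - z * q powi n))"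

abbreviation lambert_domain :: "int set \<Rightarrow> complex \<Rightarrow> complex set" where
  "lambert_domain A q \<equiv> {z. z \<noteq> 0 \<and> (\<forall>n\<in>A. z * q powi n \<noteq> 1)}"

lemma finite_powi_between:
  fixes x :: real
  assumes "0 < x" "x < 1" "0 < a"
  shows "finite {n::int. a < x powi n \<and> x powi n < b}"
proof -
  obtain M1 where M1: "x ^ M1 < a" using real_arch_pow_inv[OF assms(3,2)] by blast
  obtain M2 where M2: "x ^ M2 < 1 / max 1 b"
    using real_arch_pow_inv[of "1 / max 1 b" x] assms by fastforce
  have "{n::int. a < x powi n \<and> x powi n < b} \<subseteq> {- int M2 .. int M1}"
  proof safe
    fix n :: int assume n: "a < x powi n" "x powi n < b"
    show "n \<in> {- int M2 .. int M1}"
    proof (rule ccontr)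
      assume "n \<notin> {- int M2 .. int M1}"
      then consider "n < - int M2" | "n > int M1" by force
      then show False
      proof cases
        case 1
        then have "x powi n \<ge> x powi (- int M2)" using assms by (intro power_int_decreasing) auto
        moreover have "max 1 b < 1 / x ^ M2"
          using M2 assms by (simp add: pos_less_divide_eq[of "max 1 b"] pos_less_divide_eq[of "x ^ M2"]
              mult.commute del: max_less_iff_conj less_divide_eq_1_pos max_mult_distrib_right)
        then have "x powi (- int M2) > max 1 b"
          by (simp only: power_int_minus power_int_of_nat inverse_eq_divide)
        ultimately show False using n by auto
      next
        case 2
        then have "x powi n \<le> x powi (int M1)" using assms by (intro power_int_decreasing) auto
        then show False using n M1 by auto
      qed
    qed
  qed
  then show ?thesis by (rule finite_subset) auto
qed

text \<open>For \<open>w\<close> near \<open>z\<close>, all but finitely many \<open>n\<close> have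
  \<open>w * q powi n\<close> either at most 1/2 or at least 2 in norm, which keeps the denominator
  above 1/2; continuity handles the finite rest \<open>I\<close>. This uniform bound yields
  summability, openness of the domain and analyticity.\<close>

lemma lambert_denominators:
  fixes q z :: complex
  assumes q: "0 < norm q" "norm q < 1" and z: "z \<noteq> 0" "\<And>n::int. n \<in> A \<Longrightarrow> z * q powi n \<noteq> 1"
  shows "\<exists>d>0. \<exists>c>0. \<forall>w\<in>cball z d. w \<noteq> 0 \<and> (\<forall>n\<in>A. c \<le> norm (1 - w * q powi n))"
proof -
  define \<rho> where "\<rho> = norm z"
  have \<rho>: "\<rho> > 0" using z by (simp add: \<rho>_def)
  \<comment> \<open>On the disc the norm of \<open>w\<close> stays between \<open>\<rho> / 2\<close>
    and \<open>3 * \<rho> / 2\<close>; these two thresholds therefore give norms at most 1/2 and at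
    least 2 outside \<open>I\<close>.\<close>
  define I where "I = A \<inter> {n::int. 1 / (3 * \<rho>) < norm q powi n \<and> norm q powi n < 4 / \<rho>}"
  have fin: "finite I" unfolding I_def using finite_powi_between[OF q] \<rho> by auto
  have "\<exists>d>0. \<exists>c>0. \<forall>w\<in>cball z d. c \<le> norm (1 - w * q powi n)" if "n \<in> A" for n
  proof -
    define c where "c = norm (1 - z * q powi n) / 2"
    have "c > 0" using z(2)[OF that] by (simp add: c_def)
    have "isCont (\<lambda>w. norm (1 - w * q powi n)) z" by (intro continuous_intros)
    then obtain d where d: "d > 0"
       "\<And>w. dist w z < d \<Longrightarrow> dist (norm (1 - w * q powi n)) (norm (1 - z * q powi n)) < c"
      using \<open>c > 0\<close> unfolding continuous_at_eps_delta by blast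
    have "c \<le> norm (1 - w * q powi n)" if "w \<in> cball z (d/2)" for w
    proof -
      have "dist w z < d" using that d(1) by (auto simp: dist_commute)
      from d(2)[OF this] show ?thesis by (simp add: dist_real_def c_def abs_if split: if_splits)
    qed
    then show ?thesis using d(1) \<open>c > 0\<close> by (intro exI[of _ "d/2"]) auto
  qed
  then obtain D C where DC: "\<And>n. n \<in> A \<Longrightarrow> D n > 0 \<and> C n > 0 \<and>
      (\<forall>w\<in>cball z (D n). C n \<le> norm (1 - w * q powi n))" by metis
  have IA: "n \<in> A" if "n \<in> I" for n using that by (simp add: I_def)
  define d where "d = Min (insert (\<rho>/2) (D ` I))"
  define c where "c = Min (insert (1/2) (C ` I))"
  have "d \<le> \<rho>/2" "c \<le> 1/2" unfolding d_def c_def unfolding d_def c_def using fin by (meson Min_le finite_imageI finite_insert insertI1)+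
  then have d: "d > 0" "d \<le> \<rho>/2" "\<And>n. n \<in> I \<Longrightarrow> d \<le> D n"
    using fin \<rho> DC IA \<open>d \<le> \<rho>/2\<close> \<open>c \<le> 1/2\<close> by (auto intro!: Min_le simp: Min_gr_iff d_def c_def simp del: Min_insert)
  have c: "c > 0" "c \<le> 1/2" "\<And>n. n \<in> I \<Longrightarrow> c \<le> C n"
    using fin DC IA \<open>d \<le> \<rho>/2\<close> \<open>c \<le> 1/2\<close> by (auto intro!: Min_le simp: Min_gr_iff d_def c_def simp del: Min_insert)
  have "w \<noteq> 0 \<and> (\<forall>n\<in>A. c \<le> norm (1 - w * q powi n))" if w: "w \<in> cball z d" for w
  proof -
    have nw: "\<rho> / 2 \<le> norm w" "norm w \<le> 3 * \<rho> / 2"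
      using w d(2) norm_triangle_ineq2[of z w] norm_triangle_ineq2[of w z]
      by (auto simp: dist_norm \<rho>_def norm_minus_commute)
    moreover have "c \<le> norm (1 - w * q powi n)" if n: "n \<in> A" for n
    proof (cases "n \<in> I")
      case True
      then have "w \<in> cball z (D n)" using w d(3) by force
      then show ?thesis using c(3)[OF True] DC[OF n] by force
    next
      case False
      then consider "norm q powi n \<le> 1 / (3 * \<rho>)" | "4 / \<rho> \<le> norm q powi n"
        using n by (auto simp: I_def)
      then show ?thesis
      proof cases
        case 1
        then have "norm w * norm q powi n \<le> (3 * \<rho> / 2) * (1 / (3 * \<rho>))"
          using nw \<rho> by (intro mult_mono) auto
        then have "norm (w * q powi n) \<le> 1/2" using \<rho> by (simp add: norm_mult norm_power_int)
        then show ?thesis using c(2) norm_triangle_ineq2[of 1 "w * q powi n"] by simp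
      next
        case 2
        then have "norm w * norm q powi n \<ge> (\<rho> / 2) * (4 / \<rho>)"
          using nw \<rho> by (intro mult_mono) auto
        then have "norm (w * q powi n) \<ge> 2" using \<rho> by (simp add: norm_mult norm_power_int)
        then show ?thesis using c(2) norm_triangle_ineq2[of "w * q powi n" 1]
          by (simp add: norm_minus_commute)
      qed
    qed
    ultimately show ?thesis using \<rho> by auto
  qed
  then show ?thesis using d(1) c(1) by blast
qed

lemma lambert_sum_summable:
  fixes q z :: complex and b :: int
  assumes q: "0 < norm q" "norm q < 1" and z: "z \<noteq> 0" "\<And>n::int. n \<in> A \<Longrightarrow> z * q powi n \<noteq> 1"
  shows "(\<lambda>n. (-1) powi n * q powi (n^2 + b * n) / (1 - z * q powi n)) summable_on A"
proof -
  obtain c where c: "c > 0" "\<And>n. n \<in> A \<Longrightarrow> c \<le> norm (1 - z * q powi n)"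
    using lambert_denominators[OF assms] by (metis centre_in_cball less_imp_le)
  have "(\<lambda>n. ((-1) powi n / (1 - z * q powi n)) * q powi (n^2 + b * n)) summable_on A"
    by (rule summable_on_int_quadratic_weighted[OF q, where C = "1 / c"])
       (use c in \<open>auto simp: norm_divide intro!: divide_left_mono mult_pos_pos intro: less_le_trans\<close>)
  then show ?thesis by simp
qed

lemma open_lambert_domain:
  assumes q: "0 < norm q" "norm q < 1"
  shows "open (lambert_domain A q)"
  unfolding open_contains_cball
proof (intro ballI)
  fix z assume "z \<in> (lambert_domain A q)"
  then obtain d c where "d > 0" "c > 0"
    "\<forall>w\<in>cball z d. w \<noteq> 0 \<and> (\<forall>n\<in>A. c \<le> norm (1 - w * q powi n))"
    using lambert_denominators[OF q, of z A] by blast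
  then show "\<exists>e>0. cball z e \<subseteq> (lambert_domain A q)"
    by (intro exI[of _ d]) fastforce
qed

lemma holomorphic_on_lambert_sum:
  assumes q: "0 < norm q" "norm q < 1"
  shows "lambert_sum A q holomorphic_on (lambert_domain A q)"
  unfolding lambert_sum_def
proof (rule holomorphic_on_infsum[OF open_lambert_domain[OF q]])
  fix z assume "z \<in> (lambert_domain A q)"
  then obtain d c where dc: "d > 0" "c > 0"
    "\<forall>w\<in>cball z d. w \<noteq> 0 \<and> (\<forall>n\<in>A. c \<le> norm (1 - w * q powi n))"
    using lambert_denominators[OF q, of z A] by blast
  have "(\<lambda>n::int. 1 / c * norm q powi (n^2 + n)) summable_on A"
    using summable_on_int_quadratic[OF q, of 1]
    by (intro summable_on_cmult_right) (auto intro: summable_on_subset)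
  moreover have "norm ((-1) powi n * q powi (n^2 + n) / (1 - w * q powi n)) \<le> 1 / c * norm q powi (n^2 + n)"
    if "n \<in> A" "w \<in> cball z d" for n w
    using dc that by (auto simp: norm_mult norm_divide norm_power_int intro!: divide_left_mono mult_pos_pos
        intro: less_le_trans)
  ultimately show "\<exists>d>0. cball z d \<subseteq> (lambert_domain A q) \<and>
       (\<exists>M. M summable_on A \<and> (\<forall>i\<in>A. \<forall>w\<in>cball z d.
          norm ((-1) powi i * q powi (i^2 + i) / (1 - w * q powi i)) \<le> M i))"
    using dc by (intro exI[of _ d] conjI exI[of _ "\<lambda>n. 1 / c * norm q powi (n^2 + n)"]) fastforce+
qed (intro holomorphic_intros, auto)

text \<open>The reflection \<open>n\<close> to \<open>1 - n\<close> fixes the exponent and flips the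
  sign.\<close>

lemma infsum_alt_quadratic_odd:
  "(\<Sum>\<^sub>\<infinity>n::int. (-1) powi n * q powi (n^2 - n)) = (0::complex)"
proof -
  define f where "f = (\<lambda>n::int. (-1) powi n * q powi (n^2 - n))"
  have "infsum f UNIV = infsum (\<lambda>n. - f n) UNIV"
  proof (rule infsum_reindex_bij_witness[of _ "\<lambda>n. 1 - n" "\<lambda>n. 1 - n"])
    fix a :: int
    have "(1 - a)^2 - (1 - a) = a^2 - a" by (simp add: power2_eq_square algebra_simps)
    moreover have "(-1::complex) powi (1 - a) = - ((-1) powi a)"
      by (simp add: power_int_minus_left)
    ultimately show "- f (1 - a) = f a" unfolding f_def by (simp only:) simp
  qed auto
  then show ?thesis by (simp add: infsum_uminus f_def)
qed

text \<open>An index shift turns the left side into terms -t / (1 - z x) with x = q^n and t = (-1)^n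
  q^(n^2 - n). Expanding 1 / (1 - z x) = 1 + z x + z^2 x^2 / (1 - z x) gives a sum that vanishes by
  reflection, the theta series, and the original sum.\<close>

lemma lambert_sum_mult:
  assumes q: "0 < norm q" "norm q < 1" and z: "z \<noteq> 0" "\<And>n::int. z * q powi n \<noteq> 1"
  shows "lambert_sum UNIV q (q * z) = - z * alt_theta q - z^2 * lambert_sum UNIV q z"
proof -
  have q0: "q \<noteq> 0" using q by auto
  define d where "d = (\<lambda>n::int. 1 - z * q powi n)"
  have d0: "d n \<noteq> 0" for n using z(2)[of n] by (simp add: d_def)
  have sm: "(\<lambda>n::int. (-1) powi n * q powi (n^2 + b * n)) summable_on UNIV" for b
    by (rule summable_on_int_quadratic_weighted[OF q, where C = 1]) auto
  have s1: "(\<lambda>n::int. (-1) powi n * q powi (n^2 - n)) summable_on UNIV" using sm[of "-1"] by simp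
  have s2: "(\<lambda>n::int. (-1) powi n * q powi n^2) summable_on UNIV" using sm[of 0] by simp
  have s3: "(\<lambda>n::int. (-1) powi n * q powi (n^2 + n) / d n) summable_on UNIV"
    using lambert_sum_summable[OF q z(1), of UNIV 1] z(2) by (simp add: d_def)
  have "lambert_sum UNIV q (q * z) = (\<Sum>\<^sub>\<infinity>n. - ((-1) powi n * q powi (n^2 - n) / d n))"
    unfolding lambert_sum_def
  proof (rule infsum_reindex_bij_witness[of _ "\<lambda>n. n - 1" "\<lambda>n. n + 1"])
    fix n :: int
    have e1: "q * z * q powi n = z * q powi (n + 1)" using q0 by (simp add: power_int_add)
    have e2: "(-1::complex) powi (n + 1) = - ((-1) powi n)" by (simp add: power_int_add)
    have e3: "(n + 1)^2 - (n + 1) = n^2 + n" by (simp add: power2_eq_square algebra_simps)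
    show "- ((-1) powi (n + 1) * q powi ((n + 1)^2 - (n + 1)) / d (n + 1)) =
       (-1) powi n * q powi (n^2 + n) / (1 - q * z * q powi n)" unfolding d_def e1 e2 e3 by simp
  qed auto
  also have "\<dots> = (\<Sum>\<^sub>\<infinity>n. ((-1) powi n * q powi (n^2 - n) + z * ((-1) powi n * q powi n^2)) * (-1)
                      + (- (z^2)) * ((-1) powi n * q powi (n^2 + n) / d n))"
  proof (rule infsum_cong)
    fix n :: int
    define x where "x = q powi n"
    have "q powi (n^2) = q powi (n^2 - n) * x" "q powi (n^2 + n) = q powi (n^2 - n) * x^2"
      using q0 by (auto simp: x_def power_int_diff power_int_add power2_eq_square)
    moreover have dn: "d n = 1 - z * x" by (simp add: d_def x_def)
    moreover have "1 - z * x \<noteq> 0" using d0[of n] dn by simp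
    ultimately show "- ((-1) powi n * q powi (n^2 - n) / d n) =
       ((-1) powi n * q powi (n^2 - n) + z * ((-1) powi n * q powi n^2)) * (-1)
         + (- (z^2)) * ((-1) powi n * q powi (n^2 + n) / d n)"
      by (simp only:) (simp add: divide_simps, simp add: algebra_simps power2_eq_square)
  qed
  also have "\<dots> = (\<Sum>\<^sub>\<infinity>n. ((-1) powi n * q powi (n^2 - n) + z * ((-1) powi n * q powi n^2)) * (-1)) +
       (\<Sum>\<^sub>\<infinity>n. (- (z^2)) * ((-1) powi n * q powi (n^2 + n) / d n))"
    by (intro infsum_add summable_on_cmult_left summable_on_add summable_on_cmult_right s1 s2 s3)
  also have "\<dots> = ((\<Sum>\<^sub>\<infinity>n. (-1) powi n * q powi (n^2 - n)) + (\<Sum>\<^sub>\<infinity>n. z * ((-1) powi n * q powi n^2))) * (-1) +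
       (- (z^2)) * (\<Sum>\<^sub>\<infinity>n. (-1) powi n * q powi (n^2 + n) / d n)"
    by (simp only: infsum_cmult_right' infsum_cmult_left' infsum_add[OF s1 summable_on_cmult_right[OF s2]])
  also have "\<dots> = - z * alt_theta q - z^2 * lambert_sum UNIV q z"
    by (simp only: infsum_alt_quadratic_odd infsum_cmult_right' alt_theta_def lambert_sum_def d_def) simp
  finally show ?thesis .
qed

text \<open>Reversing the index turns the sum at \<open>1 / z\<close> into one with the denominators
  of the sum at \<open>z\<close> but exponent \<open>n^2\<close>; the two then differ by 1 / (1 - z
  x) = 1 + z x / (1 - z x).\<close>

lemma lambert_sum_inverse:
  assumes q: "0 < norm q" "norm q < 1" and z: "z \<noteq> 0" "\<And>n::int. z * q powi n \<noteq> 1"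
  shows "z * lambert_sum UNIV q z + lambert_sum UNIV q (1 / z) / z = - alt_theta q"
proof -
  have q0: "q \<noteq> 0" using q by auto
  define d where "d = (\<lambda>n::int. 1 - z * q powi n)"
  have d0: "d n \<noteq> 0" for n using z(2)[of n] by (simp add: d_def)
  have s2: "(\<lambda>n::int. (-1) powi n * q powi n^2) summable_on UNIV"
    using summable_on_int_quadratic_weighted[OF q, of UNIV "\<lambda>n. (-1) powi n" 1 0] by simp
  have s3: "(\<lambda>n::int. (-1) powi n * q powi (n^2 + n) / d n) summable_on UNIV"
    using lambert_sum_summable[OF q z(1), of UNIV 1] z(2) by (simp add: d_def)
  have "lambert_sum UNIV q (1 / z) = (\<Sum>\<^sub>\<infinity>n. - z * ((-1) powi n * q powi n^2 / d n))"
    unfolding lambert_sum_def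
  proof (rule infsum_reindex_bij_witness[of _ "\<lambda>n. - n" "\<lambda>n. - n"])
    fix n :: int
    define x where "x = q powi n"
    have x0: "x \<noteq> 0" using q0 by (simp add: x_def)
    have "(-1::complex) powi (-n) = (-1) powi n" by (simp add: power_int_minus_one_minus)
    moreover have dn: "d (-n) = (x - z) / x" using x0 by (simp add: d_def x_def power_int_minus field_simps)
    moreover have "q powi (n^2 + n) = q powi n^2 * x" using q0 by (simp add: x_def power_int_add)
    moreover have "x \<noteq> z" using d0[of "-n"] x0 dn by auto
    ultimately show "- z * ((-1) powi (- n) * q powi (- n)^2 / d (- n)) =
       (-1) powi n * q powi (n^2 + n) / (1 - 1 / z * q powi n)"
      unfolding x_def[symmetric] dn using x0 z(1) by (simp add: divide_simps) (simp add: algebra_simps)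
  qed auto
  also have "\<dots> = (\<Sum>\<^sub>\<infinity>n. - z * ((-1) powi n * q powi n^2 + z * ((-1) powi n * q powi (n^2 + n) / d n)))"
  proof (rule infsum_cong)
    fix n :: int
    have "q powi (n^2 + n) = q powi n^2 * q powi n" using q0 by (simp add: power_int_add)
    then show "- z * ((-1) powi n * q powi n^2 / d n) =
        - z * ((-1) powi n * q powi n^2 + z * ((-1) powi n * q powi (n^2 + n) / d n))"
      using d0[of n] by (simp add: divide_simps) (simp add: d_def algebra_simps)
  qed
  also have "\<dots> = - z * ((\<Sum>\<^sub>\<infinity>n. (-1) powi n * q powi n^2) + (\<Sum>\<^sub>\<infinity>n. z * ((-1) powi n * q powi (n^2 + n) / d n)))"
    by (subst infsum_cmult_right', subst infsum_add, rule s2, intro summable_on_cmult_right s3, rule refl)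
  also have "(\<Sum>\<^sub>\<infinity>n. z * ((-1) powi n * q powi (n^2 + n) / d n)) = z * lambert_sum UNIV q z"
    by (subst infsum_cmult_right') (simp add: lambert_sum_def d_def)
  finally show ?thesis using z(1) by (simp add: alt_theta_def field_simps eq_neg_iff_add_eq_0)
qed

lemma powi_inj:
  fixes q :: complex
  assumes "0 < norm q" "norm q < 1" "q powi m = q powi n"
  shows "m = n"
proof (rule ccontr)
  assume "m \<noteq> n"
  moreover have False if "m < n" "norm q powi m = norm q powi n" for m n
    using power_int_strict_decreasing[OF that(1), of "norm q"] assms that(2) by simp
  moreover have "norm q powi m = norm q powi n" using assms(3) by (metis norm_power_int)
  ultimately show False by (metis linorder_neqE)
qed

text \<open>Distinct powers of \<open>q\<close> are different, so at most one summand is singular at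
  \<open>p\<close>; the sum over the other indices is continuous there.\<close>

lemma lambert_sum_simple_poles:
  assumes q: "0 < norm q" "norm q < 1" and p: "p \<noteq> 0"
  shows "\<exists>l. ((\<lambda>z. (z - p) * lambert_sum UNIV q z) \<longlongrightarrow> l) (at p)"
proof -
  have q0: "q \<noteq> 0" using q by auto
  define A where "A = {n::int. p * q powi n \<noteq> 1}"
  define D where "D = (lambert_domain A q)"
  have "p \<in> D" using p by (simp add: D_def A_def)
  moreover have "open D" unfolding D_def by (rule open_lambert_domain[OF q])
  moreover have "continuous_on D (lambert_sum A q)"
    unfolding D_def by (intro holomorphic_on_imp_continuous_on holomorphic_on_lambert_sum q)
  ultimately have "isCont (lambert_sum A q) p" by (simp add: continuous_on_eq_continuous_at)
  then have lA: "((\<lambda>z. (z - p) * lambert_sum A q z) \<longlongrightarrow> (p - p) * lambert_sum A q p) (at p)"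
    by (intro tendsto_intros) (simp add: isContD)
  show ?thesis
  proof (cases "A = UNIV")
    case True
    then show ?thesis using lA by auto
  next
    case False
    then obtain n0 where n0: "p * q powi n0 = 1" by (auto simp: A_def)
    have A: "A = - {n0}"
    proof -
      have "p * q powi n = 1 \<longleftrightarrow> n = n0" for n
        using n0 p powi_inj[OF q, of n n0] by (metis mult_left_cancel)
      then show ?thesis by (auto simp: A_def)
    qed
    have uA: "insert n0 (- {n0}) = UNIV" by auto
    have ev: "eventually (\<lambda>z. z \<in> D - {p}) (at p)"
      using \<open>p \<in> D\<close> \<open>open D\<close> by (intro eventually_at_in_open)
    define t where "t = (-1) powi n0 * q powi (n0^2 + n0)"
    have "(z - p) * lambert_sum UNIV q z = (z - p) * lambert_sum A q z - t / q powi n0" if "z \<in> D - {p}" for z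
    proof -
      have zA: "z \<noteq> 0" "\<And>n. n \<in> A \<Longrightarrow> z * q powi n \<noteq> 1" using that by (auto simp: D_def)
      have e1: "lambert_sum UNIV q z = t / (1 - z * q powi n0) + lambert_sum A q z"
      proof -
        have "infsum (\<lambda>n. (-1) powi n * q powi (n^2 + n) / (1 - z * q powi n)) (insert n0 A) =
          t / (1 - z * q powi n0) + infsum (\<lambda>n. (-1) powi n * q powi (n^2 + n) / (1 - z * q powi n)) A"
          unfolding t_def
        proof (rule infsum_insert)
          show "(\<lambda>n. (-1) powi n * q powi (n^2 + n) / (1 - z * q powi n)) summable_on A"
            using lambert_sum_summable[OF q zA(1), of A 1] zA(2) by simp
          show "n0 \<notin> A" by (simp add: A)
        qed
        then show ?thesis unfolding lambert_sum_def using uA A by simp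
      qed
      have e2: "1 - z * q powi n0 = (p - z) * q powi n0" using n0 by (simp add: algebra_simps)
      have c: "q powi n0 \<noteq> 0" "p - z \<noteq> 0" using q0 that by auto
      have alg: "- u * (t / (u * x) + y) = - u * y - t / x" if "x \<noteq> 0" "u \<noteq> 0" for u x y
        using that by (simp add: field_simps)
      show ?thesis unfolding e1 e2 using alg[OF c] by simp
    qed
    then have "eventually (\<lambda>z. (z - p) * lambert_sum A q z - t / q powi n0 = (z - p) * lambert_sum UNIV q z) (at p)"
      by (intro eventually_mono[OF ev]) (rule sym)
    from Lim_transform_eventually[OF _ this] have "((\<lambda>z. (z - p) * lambert_sum UNIV q z) \<longlongrightarrow> L) (at p)"
       if "((\<lambda>z. (z - p) * lambert_sum A q z - t / q powi n0) \<longlongrightarrow> L) (at p)" for L using that by blast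
    moreover have "((\<lambda>z. (z - p) * lambert_sum A q z - t / q powi n0) \<longlongrightarrow> (p - p) * lambert_sum A q p - t / q powi n0) (at p)"
      by (intro tendsto_diff lA tendsto_const)
    ultimately show ?thesis by blast
  qed
qed

lemma annulus_not_power:
  fixes q z :: complex and n :: int
  assumes q: "0 < norm q" "norm q < 1" and z: "norm q < norm z" "norm z * norm q < 1" and n: "n \<noteq> 0"
  shows "z * q powi n \<noteq> 1"
proof
  assume "z * q powi n = 1"
  then have e: "norm z * norm q powi n = 1" by (metis norm_mult norm_one norm_power_int)
  have z0: "norm z > 0" using z(1) q(1) by linarith
  consider "n \<ge> 1" | "n \<le> -1" using n by linarith
  then show False
  proof cases
    case 1
    then have "norm q powi n \<le> norm q powi 1" using q by (intro power_int_decreasing) auto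
    then have "norm z * norm q powi n \<le> norm z * norm q" using z0 by simp
    then show False using e z by simp
  next
    case 2
    then have "norm q powi n \<ge> norm q powi (-1)" using q by (intro power_int_decreasing) auto
    then have "norm z * norm q powi n \<ge> norm z * inverse (norm q)" using z0 by simp
    moreover have "norm z * inverse (norm q) > 1" using z q by (simp add: field_simps)
    ultimately show False using e by simp
  qed
qed

lemma lambert_sum_annulus:
  assumes q: "0 < norm q" "norm q < 1" and z: "norm q < norm z" "norm z * norm q < 1"
  shows "lambert_sum UNIV q z = 1 / (1 - z) + lambert_sum (- {0}) q z"
proof -
  have "z \<noteq> 0" using z(1) q(1) by auto
  then have "(\<lambda>n. (-1) powi n * q powi (n^2 + 1 * n) / (1 - z * q powi n)) summable_on (- {0})"
    using annulus_not_power[OF assms] by (intro lambert_sum_summable[OF q]) auto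
  then have "infsum (\<lambda>n. (-1) powi n * q powi (n^2 + n) / (1 - z * q powi n)) (insert 0 (- {0})) = 
     1 / (1 - z) + infsum (\<lambda>n. (-1) powi n * q powi (n^2 + n) / (1 - z * q powi n)) (- {0})"
    by (subst infsum_insert) auto
  moreover have "insert (0::int) (- {0}) = UNIV" by auto
  ultimately show ?thesis by (simp only: lambert_sum_def)
qed

section \<open>The rank generating function as an Appell sum\<close>

text \<open>Here \<open>w\<close> marks the number of parts and \<open>Suc m\<close> is the largest
  part: each smaller size contributes one numerator and one denominator factor, repetitions of the
  largest part contribute the last denominator factor.\<close>

definition rank_coeff :: "complex \<Rightarrow> complex \<Rightarrow> nat \<Rightarrow> complex" where
  "rank_coeff q w m = (\<Prod>i<m. 1 + w * q ^ Suc i) / (\<Prod>i<Suc m. 1 - w * q ^ Suc i)"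

text \<open>The number of parts (through \<open>w\<close>) and the largest part (through
  \<open>x\<close>) are marked separately, so that each variable has its own q-difference
  equation.\<close>

definition rank_aux :: "complex \<Rightarrow> complex \<Rightarrow> complex \<Rightarrow> complex" where
  "rank_aux q w x = (\<Sum>m. rank_coeff q w m * x ^ m)"

text \<open>The 1 is the empty overpartition, and 2 counts the choice of overlining the largest
  part. Since \<open>z\<close> marks parts and \<open>1 / z\<close> the largest part, this is the
  generating function in the inverse of the rank variable.\<close>

definition rank_series :: "complex \<Rightarrow> complex \<Rightarrow> complex" where
  "rank_series q z = 1 + 2 * q * rank_aux q z (q / z)"

text \<open>The point is that the bound does not depend on \<open>m\<close> and \<open>n\<close>:
  each factor is compared with an exponential, using 1 / (1 - y) \<le> 1 + y / (1 - \<beta>), and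
  the exponents form a geometric series. It serves both the rank series and the absolute summability
  over overpartitions.\<close>

lemma overlined_factors_bound:
  fixes x \<beta> :: real
  assumes x: "0 \<le> x" "x < 1" and \<beta>: "0 \<le> \<beta>" "\<beta> < 1"
  shows "(\<Prod>i<m. 1 + \<beta> * x ^ i) / (\<Prod>i<n. 1 - \<beta> * x ^ i) \<le> exp (\<beta> / (1 - x) * (1 + 1 / (1 - \<beta>)))"
    and "0 < (\<Prod>i<n. 1 - \<beta> * x ^ i)"
proof -
  have y: "0 \<le> \<beta> * x ^ i" "\<beta> * x ^ i \<le> \<beta>" for i
    using assms by (auto intro!: mult_left_le power_le_one)
  show pos: "0 < (\<Prod>i<n. 1 - \<beta> * x ^ i)"
    by (intro prod_pos ballI) (use y \<beta> in \<open>auto intro: le_less_trans\<close>)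
  have s: "(\<Sum>i<k. \<beta> * x ^ i) \<le> \<beta> / (1 - x)" for k
  proof -
    have "(\<Sum>i<k. x ^ i) \<le> 1 / (1 - x)"
      using sum_le_suminf[of "\<lambda>i. x ^ i" "{..<k}"] x by (simp add: suminf_geometric summable_geometric)
    from mult_left_mono[OF this \<beta>(1)] show ?thesis by (simp add: sum_distrib_left)
  qed
  have "(\<Prod>i<m. 1 + \<beta> * x ^ i) \<le> exp (\<Sum>i<m. \<beta> * x ^ i)"
    by (rule prod_le_exp_sum) (use y in auto)
  also have "\<dots> \<le> exp (\<beta> / (1 - x))" using s by simp
  finally have a: "(\<Prod>i<m. 1 + \<beta> * x ^ i) \<le> exp (\<beta> / (1 - x))" .
  have e: "1 / (1 - y) \<le> 1 + y / (1 - \<beta>)" if "0 \<le> y" "y \<le> \<beta>" for y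
  proof -
    have "1 / (1 - y) = 1 + y / (1 - y)" using that \<beta> by (simp add: field_simps)
    also have "y / (1 - y) \<le> y / (1 - \<beta>)" using that \<beta> by (intro divide_left_mono) auto
    finally show ?thesis by simp
  qed
  have "1 / (\<Prod>i<n. 1 - \<beta> * x ^ i) = (\<Prod>i<n. 1 / (1 - \<beta> * x ^ i))"
    by (simp add: prod_dividef)
  also have "\<dots> \<le> (\<Prod>i<n. 1 + \<beta> * x ^ i / (1 - \<beta>))"
    by (intro prod_mono conjI e y) (use y(2) \<beta>(2) in \<open>force intro: order_trans less_imp_le\<close>)
  also have "\<dots> \<le> exp (\<Sum>i<n. \<beta> * x ^ i / (1 - \<beta>))"
    by (rule prod_le_exp_sum) (use y \<beta> in auto)
  also have "\<dots> \<le> exp (\<beta> / (1 - x) / (1 - \<beta>))"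
    unfolding sum_divide_distrib[symmetric] exp_le_cancel_iff
    by (intro divide_right_mono s) (use \<beta> in auto)
  finally have b: "1 / (\<Prod>i<n. 1 - \<beta> * x ^ i) \<le> exp (\<beta> / (1 - x) / (1 - \<beta>))" .
  have "(\<Prod>i<m. 1 + \<beta> * x ^ i) * (1 / (\<Prod>i<n. 1 - \<beta> * x ^ i)) \<le>
      exp (\<beta> / (1 - x)) * exp (\<beta> / (1 - x) / (1 - \<beta>))"
    using pos by (intro mult_mono a b) auto
  then show "(\<Prod>i<m. 1 + \<beta> * x ^ i) / (\<Prod>i<n. 1 - \<beta> * x ^ i) \<le> exp (\<beta> / (1 - x) * (1 + 1 / (1 - \<beta>)))"
    by (simp add: exp_add [symmetric] algebra_simps)
qed

lemma norm_rank_coeff_le: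
  assumes q: "norm q < 1" and B: "B * norm q < 1" "norm w \<le> B"
  shows "norm (rank_coeff q w m) \<le>
     exp (B * norm q / (1 - norm q) * (1 + 1 / (1 - B * norm q)))"
proof -
  define x where "x = norm q"
  have x: "0 \<le> x" "x < 1" using q by (auto simp: x_def)
  have B0: "0 \<le> B" using B(2) norm_ge_zero order_trans by blast
  have \<beta>: "0 \<le> B * x" "B * x < 1" using B0 x B by (auto simp: x_def)
  have wx: "norm (w * q ^ Suc i) \<le> B * x * x ^ i" for i
    using mult_right_mono[OF B(2), of "x * x ^ i"] x
    by (simp add: norm_mult norm_power x_def mult_ac)
  have le1: "B * x * x ^ i \<le> B * x" for i using \<beta> x by (intro mult_left_le power_le_one) auto
  have "norm (\<Prod>i<m. 1 + w * q ^ Suc i) \<le> (\<Prod>i<m. 1 + B * x * x ^ i)"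
    unfolding prod_norm [symmetric]
    by (intro prod_mono conjI norm_ge_zero norm_triangle_le) (use wx in auto)
  moreover have "(\<Prod>i<Suc m. 1 - B * x * x ^ i) \<le> norm (\<Prod>i<Suc m. 1 - w * q ^ Suc i)"
    unfolding prod_norm [symmetric]
  proof (intro prod_mono conjI)
    fix i
    show "0 \<le> 1 - B * x * x ^ i" using le1[of i] \<beta> by linarith
    show "1 - B * x * x ^ i \<le> norm (1 - w * q ^ Suc i)"
      using norm_triangle_ineq2[of 1 "w * q ^ Suc i"] wx[of i] by simp
  qed
  ultimately have "norm (rank_coeff q w m) \<le> (\<Prod>i<m. 1 + B * x * x ^ i) / (\<Prod>i<Suc m. 1 - B * x * x ^ i)"
    unfolding rank_coeff_def norm_divide
    by (intro frac_le overlined_factors_bound(2) x \<beta>) (auto intro!: prod_nonneg simp: x \<beta>)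
  also have "\<dots> \<le> exp (B * x / (1 - x) * (1 + 1 / (1 - B * x)))"
    by (rule overlined_factors_bound(1)) (use x \<beta> in auto)
  finally show ?thesis by (simp add: x_def)
qed

lemma rank_aux_summable:
  assumes "norm q < 1" "norm w * norm q < 1" "norm x < 1"
  shows "summable (\<lambda>m. norm (rank_coeff q w m * x ^ m))"
proof (rule summable_comparison_test_ev)
  define C where "C = exp (norm w * norm q / (1 - norm q) * (1 + 1 / (1 - norm w * norm q)))"
  show "summable (\<lambda>m. C * norm x ^ m)" using assms by (simp add: summable_mult summable_geometric)
  show "\<forall>\<^sub>F m in sequentially. norm (norm (rank_coeff q w m * x ^ m)) \<le> C * norm x ^ m"
    using norm_rank_coeff_le[OF assms(1,2) order_refl]
    by (intro always_eventually) (auto simp: norm_mult norm_power C_def intro!: mult_right_mono)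
qed

lemma rank_aux_sums:
  assumes "norm q < 1" "norm w * norm q < 1" "norm x < 1"
  shows "(\<lambda>m. rank_coeff q w m * x ^ m) sums rank_aux q w x"
  using summable_norm_cancel[OF rank_aux_summable[OF assms]]
  by (simp add: rank_aux_def summable_sums)

lemma rank_denominator_nonzero:
  assumes "norm q < 1" "norm w * norm q < 1"
  shows "1 - w * q ^ Suc i \<noteq> (0::complex)"
proof
  assume "1 - w * q ^ Suc i = 0"
  then have "norm (w * q ^ Suc i) = 1" by (metis eq_iff_diff_eq_0 norm_one)
  moreover have "norm (w * q ^ Suc i) \<le> norm w * norm q"
    using assms by (auto simp: norm_mult norm_power mult.assoc[symmetric] intro!: mult_left_le power_le_one)
  ultimately show False using assms by simp
qed

text \<open>The ratio of consecutive coefficients is (1 + w q^(m+1)) / (1 - w q^(m+2)). Clear its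
  denominator, multiply by x^(m+1) and sum; the powers of \<open>q\<close> are absorbed by
  evaluating at \<open>x * q\<close>.\<close>

lemma rank_aux_recurrence_x:
  assumes q: "norm q < 1" "norm w * norm q < 1" and x: "norm x < 1"
  shows "(1 - x) * rank_aux q w x = 1 + w * q * (1 + x) * rank_aux q w (x * q)"
proof -
  define u where "u = rank_coeff q w"
  have nz: "1 - w * q ^ Suc i \<noteq> 0" for i using rank_denominator_nonzero[OF q] .
  have xq: "norm (x * q) < 1"
    using mult_strict_mono'[OF x q(1)] by (simp add: norm_mult)
  have u0: "u 0 * (1 - w * q) = 1" using nz[of 0] by (simp add: u_def rank_coeff_def)
  have rec: "u (Suc m) * (1 - w * q ^ Suc (Suc m)) = u m * (1 + w * q ^ Suc m)" for m
    using nz[of "Suc m"] unfolding u_def rank_coeff_def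
    by (subst (2) prod.lessThan_Suc, subst prod.lessThan_Suc) (simp del: power_Suc prod.lessThan_Suc)
  have A: "(\<lambda>m. u m * x ^ m) sums rank_aux q w x" unfolding u_def by (rule rank_aux_sums[OF q x])
  have B: "(\<lambda>m. u m * (x * q) ^ m) sums rank_aux q w (x * q)" unfolding u_def by (rule rank_aux_sums[OF q xq])
  have A': "(\<lambda>m. u (Suc m) * x ^ Suc m) sums (rank_aux q w x - u 0)"
    using A by (subst sums_Suc_iff) simp
  have B': "(\<lambda>m. u (Suc m) * (x * q) ^ Suc m) sums (rank_aux q w (x * q) - u 0)"
    using B by (subst sums_Suc_iff) simp
  have S1: "(\<lambda>m. u (Suc m) * x ^ Suc m - w * q * (u (Suc m) * (x * q) ^ Suc m)) sums
     (rank_aux q w x - u 0 - w * q * (rank_aux q w (x * q) - u 0))"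
    by (intro sums_diff A' sums_mult B')
  have S2: "(\<lambda>m. x * (u m * x ^ m) + w * q * x * (u m * (x * q) ^ m)) sums
     (x * rank_aux q w x + w * q * x * rank_aux q w (x * q))"
    by (intro sums_add sums_mult A B)
  have eq: "u (Suc m) * x ^ Suc m - w * q * (u (Suc m) * (x * q) ^ Suc m) =
      x * (u m * x ^ m) + w * q * x * (u m * (x * q) ^ m)" for m
  proof -
    have "u (Suc m) * x ^ Suc m - w * q * (u (Suc m) * (x * q) ^ Suc m) =
        x ^ Suc m * (u (Suc m) * (1 - w * q ^ Suc (Suc m)))"
      by (simp add: power_mult_distrib algebra_simps)
    also have "\<dots> = x * (u m * x ^ m) + w * q * x * (u m * (x * q) ^ m)"
      unfolding rec by (simp add: power_mult_distrib algebra_simps)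
    finally show ?thesis .
  qed
  have "rank_aux q w x - u 0 - w * q * (rank_aux q w (x * q) - u 0) =
      x * rank_aux q w x + w * q * x * rank_aux q w (x * q)"
    using S1[unfolded eq] S2 by (rule sums_unique2)
  then have "rank_aux q w x - x * rank_aux q w x =
     u 0 * (1 - w * q) + w * q * rank_aux q w (x * q) + w * q * x * rank_aux q w (x * q)"
    by (simp add: algebra_simps)
  then show ?thesis unfolding u0 by (simp add: algebra_simps)
qed

text \<open>Replacing \<open>w\<close> by \<open>w * q\<close> drops the first factor of both
  products, which amounts to a shift of the index by one.\<close>

lemma rank_aux_recurrence_w:
  assumes q: "norm q < 1" "norm w * norm q < 1" and x: "norm x < 1"
  shows "(1 - w * q) * rank_aux q w x = 1 + (1 + w * q) * x * rank_aux q (w * q) x"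
proof -
  have nz: "1 - w * q ^ Suc i \<noteq> 0" for i using rank_denominator_nonzero[OF q] .
  have wq: "norm (w * q) * norm q < 1"
    using mult_strict_mono'[OF q(2,1)] by (simp add: norm_mult)
  have u0: "(1 - w * q) * rank_coeff q w 0 = 1" using nz[of 0] by (simp add: rank_coeff_def)
  have rec: "(1 - w * q) * rank_coeff q w (Suc m) = (1 + w * q) * rank_coeff q (w * q) m" for m
  proof -
    have "w * q ^ Suc (Suc i) = w * q * q ^ Suc i" for i by simp
    then have "(\<Prod>i<Suc m. 1 + w * q ^ Suc i) = (1 + w * q) * (\<Prod>i<m. 1 + w * q * q ^ Suc i)"
      "(\<Prod>i<Suc (Suc m). 1 - w * q ^ Suc i) = (1 - w * q) * (\<Prod>i<Suc m. 1 - w * q * q ^ Suc i)"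
      unfolding prod.lessThan_Suc_shift by (simp_all only: power_Suc0_right o_def)
    then show ?thesis using nz[of 0] unfolding rank_coeff_def by (simp del: power_Suc prod.lessThan_Suc)
  qed
  have "(\<lambda>m. rank_coeff q w (Suc m) * x ^ Suc m) sums (rank_aux q w x - rank_coeff q w 0)"
    using rank_aux_sums[OF q x] by (subst sums_Suc_iff) simp
  then have S1: "(\<lambda>m. (1 - w * q) * (rank_coeff q w (Suc m) * x ^ Suc m)) sums
     ((1 - w * q) * (rank_aux q w x - rank_coeff q w 0))" by (rule sums_mult)
  have S2: "(\<lambda>m. (1 + w * q) * x * (rank_coeff q (w * q) m * x ^ m)) sums
      ((1 + w * q) * x * rank_aux q (w * q) x)"
    by (intro sums_mult rank_aux_sums q x wq)
  have eq: "(1 - w * q) * (rank_coeff q w (Suc m) * x ^ Suc m) =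
      (1 + w * q) * x * (rank_coeff q (w * q) m * x ^ m)" for m
  proof -
    have "(1 - w * q) * (rank_coeff q w (Suc m) * x ^ Suc m) =
       ((1 - w * q) * rank_coeff q w (Suc m)) * (x * x ^ m)" by simp
    then show ?thesis unfolding rec[of m] by simp
  qed
  have "(1 - w * q) * (rank_aux q w x - rank_coeff q w 0) = (1 + w * q) * x * rank_aux q (w * q) x"
    using S1[unfolded eq] S2 by (rule sums_unique2)
  then have "(1 - w * q) * rank_aux q w x = (1 - w * q) * rank_coeff q w 0 + (1 + w * q) * x * rank_aux q (w * q) x"
    by (simp only: right_diff_distrib diff_eq_eq add.commute)
  then show ?thesis by (simp only: u0)
qed

text \<open>The pair (\<open>w\<close>, \<open>x\<close>) is (\<open>z\<close>,
  \<open>q / z\<close>) for the series at \<open>z\<close> and (\<open>z * q\<close>,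
  \<open>1 / z\<close>) for the one at \<open>q * z\<close>. The recurrence in \<open>w\<close>
  applied to the first and the recurrence in \<open>x\<close> applied to the second both lead to
  (\<open>z * q\<close>, \<open>q / z\<close>), the value \<open>e\<close>, which is eliminated. The
  bound \<open>1 < norm z\<close> makes \<open>1 / z\<close> an admissible \<open>x\<close>.\<close>

lemma rank_series_mult:
  assumes q: "0 < norm q" and z: "1 < norm z" "norm z * norm q < 1"
  shows "(1 + q * z) / (1 - q * z) * rank_series q (q * z) =
         1 - q * z^2 - q * z^2 * ((1 + z) / (1 - z) * rank_series q z)"
proof -
  have q1: "norm q < 1" using z(2) mult_strict_right_mono[OF z(1) q] by simp
  have z0: "z \<noteq> 0" "q \<noteq> 0" "z \<noteq> 1" using z q by auto
  have qz: "norm (q / z) < 1" "norm (1 / z) < 1" "norm (z * q) * norm q < 1"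
    using z q1 q mult_strict_mono'[OF z(2) q1] by (auto simp: norm_divide norm_mult divide_simps)
  have qz1: "1 - q * z \<noteq> 0"
  proof
    assume "1 - q * z = 0"
    then have "norm (q * z) = 1" by (metis eq_iff_diff_eq_0 norm_one)
    then show False using z(2) by (simp add: norm_mult mult.commute)
  qed
  define e where "e = rank_aux q (z * q) (q / z)"
  define a where "a = rank_aux q z (q / z)"
  define b where "b = rank_aux q (z * q) (1 / z)"
  have 1: "(1 - q * z) * a = 1 + (1 + q * z) * (q / z) * e"
    using rank_aux_recurrence_w[OF q1 z(2) qz(1)] by (simp add: a_def e_def mult.commute)
  have 2: "(1 - 1 / z) * b = 1 + z * q * q * (1 + 1 / z) * e"
    using rank_aux_recurrence_x[OF q1 qz(3,2)] by (simp add: b_def e_def mult.commute)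
  have a: "a = (1 + (1 + q * z) * (q / z) * e) / (1 - q * z)" using 1 qz1 by (simp add: field_simps)
  have b: "b = (1 + q * q * (z + 1) * e) * z / (z - 1)" using 2 z0 by (simp add: field_simps)
  have ra: "rank_series q z = 1 + 2 * q * a" by (simp add: rank_series_def a_def)
  have rb: "rank_series q (q * z) = 1 + 2 * q * b"
    using z0 by (simp add: rank_series_def b_def mult.commute)
  have z1: "1 - z \<noteq> 0" "z - 1 \<noteq> 0" using z0 by auto
  have A: "(1 - z) * z * ((1 - q * z) * rank_series q z) = (1 - z) * (z * (1 - q * z) + 2 * q * (z + (1 + q * z) * q * e))"
    unfolding ra a using qz1 z0 by (simp add: field_simps)
  have B: "(z - 1) * rank_series q (q * z) = (z - 1) + 2 * q * ((1 + q * q * (z + 1) * e) * z)"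
    unfolding rb b using z1 by (simp add: field_simps)
  have "(1 + q * z) * ((z - 1) * rank_series q (q * z)) = (z - 1) * (1 - q * z) * (1 - q * z^2)
      + q * z * (1 + z) * (z * ((1 - q * z) * rank_series q z))"
  proof -
    have zz: "z * ((1 - q * z) * rank_series q z) = z * (1 - q * z) + 2 * q * (z + (1 + q * z) * q * e)"
      using A z1 by (metis mult.assoc mult_left_cancel)
    show ?thesis unfolding B zz by (simp add: algebra_simps power2_eq_square)
  qed
  then show ?thesis using qz1 z1 by (simp add: divide_simps) (simp add: algebra_simps power2_eq_square)
qed

lemma holomorphic_on_rank_series:
  assumes q: "0 < norm q" "norm q < 1"
  shows "rank_series q holomorphic_on {z. norm q < norm z \<and> norm z < 1 / norm q}"
proof -
  let ?S = "{z::complex. norm q < norm z \<and> norm z < 1 / norm q}"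
  have "(\<lambda>z. \<Sum>\<^sub>\<infinity>m\<in>UNIV. rank_coeff q z m * (q / z) ^ m) holomorphic_on ?S"
  proof (rule holomorphic_on_infsum[OF open_annulus])
    fix m
    have "1 - z * q ^ Suc i \<noteq> 0" if "z \<in> ?S" for z i
      using rank_denominator_nonzero[OF q(2), of z i] that q by (simp add: field_simps)
    then show "(\<lambda>z. rank_coeff q z m * (q / z) ^ m) holomorphic_on ?S"
      unfolding rank_coeff_def using q by (intro holomorphic_intros) (auto simp del: power_Suc)
  next
    fix z assume z: "z \<in> ?S"
    then obtain d where d: "d > 0" "cball z d \<subseteq> ?S"
      using open_annulus[of "norm q" "1 / norm q"] unfolding open_contains_cball by blast
    have "norm ` cball z d \<subseteq> {norm q<..<1 / norm q}" using d by auto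
    moreover have cp: "compact (norm ` cball z d)" by (intro compact_continuous_image continuous_intros) auto
    moreover have ne: "norm ` cball z d \<noteq> {}" using d by auto
    moreover obtain r1 r2 where "r1 \<in> norm ` cball z d" "r2 \<in> norm ` cball z d"
      and r': "\<And>w. w \<in> cball z d \<Longrightarrow> r1 \<le> norm w \<and> norm w \<le> r2"
      using compact_attains_sup[OF cp ne] compact_attains_inf[OF cp ne] by (metis image_eqI)
    ultimately have r: "norm q < r1" "r2 < 1 / norm q"
      "\<And>w. w \<in> cball z d \<Longrightarrow> r1 \<le> norm w \<and> norm w \<le> r2"
      by (force simp: subset_iff)+
    define C where "C = exp (r2 * norm q / (1 - norm q) * (1 + 1 / (1 - r2 * norm q)))"
    have r2: "r2 * norm q < 1" using r q by (simp add: field_simps)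
    have r1: "0 < r1" using r q by linarith
    have "norm (rank_coeff q w m * (q / w) ^ m) \<le> C * (norm q / r1) ^ m" if "w \<in> cball z d" for w m
    proof -
      have w: "r1 \<le> norm w" "norm w \<le> r2" using r(3)[OF that] by auto
      have "norm (q / w) \<le> norm q / r1" using w r1 q by (simp add: norm_divide frac_le)
      then have "norm (q / w) ^ m \<le> (norm q / r1) ^ m" by (intro power_mono) auto
      moreover have "norm (rank_coeff q w m) \<le> C"
        unfolding C_def by (rule norm_rank_coeff_le[OF q(2) r2 w(2)])
      ultimately show ?thesis unfolding norm_mult norm_power C_def by (intro mult_mono) auto
    qed
    moreover have "(\<lambda>m. C * (norm q / r1) ^ m) summable_on UNIV"
    proof (intro norm_summable_imp_summable_on)
      have "norm q / r1 < 1" "0 \<le> norm q / r1" "0 \<le> C" using r(1) r1 q(1) unfolding C_def by (simp_all only: pos_divide_less_eq mult_1 exp_ge_zero zero_le_divide_iff norm_ge_zero less_imp_le) simp_all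
      then have "summable (\<lambda>m. C * (norm q / r1) ^ m)" "\<And>m. norm (C * (norm q / r1) ^ m) = C * (norm q / r1) ^ m"
        by (auto intro!: summable_mult summable_geometric abs_of_nonneg mult_nonneg_nonneg)
      then show "summable (\<lambda>m. norm (C * (norm q / r1) ^ m))" by simp
    qed
    ultimately show "\<exists>d>0. cball z d \<subseteq> ?S \<and> (\<exists>M. M summable_on UNIV \<and>
       (\<forall>m\<in>UNIV. \<forall>w\<in>cball z d. norm (rank_coeff q w m * (q / w) ^ m) \<le> M m))"
      using d by blast
  qed
  then have "(\<lambda>z. 1 + 2 * q * (\<Sum>\<^sub>\<infinity>m\<in>UNIV. rank_coeff q z m * (q / z) ^ m)) holomorphic_on ?S"
    by (intro holomorphic_intros)
  moreover have "rank_series q z = 1 + 2 * q * (\<Sum>\<^sub>\<infinity>m\<in>UNIV. rank_coeff q z m * (q / z) ^ m)" if "z \<in> ?S" for z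
  proof -
    have "norm z * norm q < 1" "norm (q / z) < 1" using that q by (auto simp: field_simps norm_divide divide_simps)
    then have "((\<lambda>m. rank_coeff q z m * (q / z) ^ m) has_sum rank_aux q z (q / z)) UNIV"
      using q by (intro norm_summable_imp_has_sum rank_aux_summable rank_aux_sums) auto
    then show ?thesis by (simp add: rank_series_def infsumI)
  qed
  ultimately show ?thesis using holomorphic_transform by fastforce
qed

text \<open>The factor \<open>alt_theta q\<close> is multiplied through because its nonvanishing is
  not yet available: it will follow from this relation at \<open>z = 1\<close>, which is also why
  the denominators \<open>1 - z\<close> are cleared.\<close>

lemma rank_series_lambert:
  assumes q: "0 < norm q" "norm q < 1" and z: "norm q < norm z" "norm z < 1 / norm q"
  shows "(1 + z) * rank_series q z * alt_theta q =
    (1 - z) * alt_theta q + 2 * z * (1 + (1 - z) * lambert_sum (- {0}) q z)"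
proof -
  let ?S = "{z::complex. norm q < norm z \<and> norm z < 1 / norm q}"
  define \<phi> where "\<phi> = alt_theta q"
  define D where "D = (\<lambda>z. (1 + z) * rank_series q z * \<phi> - (1 - z) * \<phi>
      - 2 * z * (1 + (1 - z) * lambert_sum (- {0}) q z))"
  \<comment> \<open>The squared theta function has a double zero at 1, and clearing the simple pole
    of the difference uses up one of them; the leftover factor \<open>1 - z\<close> forces
    \<open>K 1 = 0\<close>.\<close>
  define K where "K = (\<lambda>z. D z * (1 - z) * theta_cof z q ^ 2 / z)"
  have q0: "q \<noteq> 0" using q by auto
  have nz: "z \<noteq> 0" if "z \<in> ?S" for z using that q by auto
  have zq: "norm z * norm q < 1" if "z \<in> ?S" for z using that q by (auto simp: field_simps)
  have one: "1 < 1 / norm q" using q by (simp add: field_simps)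
  have "z \<in> (lambert_domain (- {0}) q)" if "z \<in> ?S" for z
    using annulus_not_power[OF q _ zq[OF that]] nz[OF that] that by simp
  then have "lambert_sum (- {0}) q holomorphic_on ?S"
    by (intro holomorphic_on_subset[OF holomorphic_on_lambert_sum[OF q]] subsetI)
  then have Dh: "D holomorphic_on ?S" unfolding D_def
    by (intro holomorphic_intros holomorphic_on_rank_series q)
  then have Kh: "K holomorphic_on ?S" unfolding K_def
    by (intro holomorphic_intros q nz)
  have DD: "D z = (1 - z) * (((1 + z) / (1 - z) * rank_series q z) * \<phi> - \<phi> - 2 * z * lambert_sum UNIV q z)"
    if "z \<in> ?S" "z \<noteq> 1" for z
  proof -
    have "1 - z \<noteq> 0" using that by simp
    then have "(1 - z) * (1 / (1 - z) + l) = 1 + (1 - z) * l"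
      "(1 - z) * ((1 + z) / (1 - z) * r) = (1 + z) * r" for l r
      by (simp_all add: distrib_left)
    moreover have "(1 - z) * (a * \<phi> - \<phi> - 2 * z * b) = ((1 - z) * a) * \<phi> - (1 - z) * \<phi> - 2 * z * ((1 - z) * b)" for a b
      by (simp add: algebra_simps)
    moreover have "norm q < norm z" using that by simp
    ultimately show ?thesis unfolding D_def by (simp only: lambert_sum_annulus[OF q _ zq[OF that(1)]])
  qed
  have alg: "(1 - z) * a * (1 - z) * c^2 / y = a * ((1 - z) * c)^2 / y" for a c y z :: complex
    by (simp add: power2_eq_square)
  \<comment> \<open>The multipliers are \<open>- q * z^2\<close> for the difference,
    \<open>1 / z^2\<close> for the squared theta function and \<open>1 / q\<close> for the factor
    \<open>1 / z\<close>; their product is -1.\<close>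
  have mult: "K (q * z) = - 1 * K z" if z: "1 < norm z" "norm z < 1 / norm q" for z
  proof -
    have zS: "z \<in> ?S" using z q by auto
    have qzS: "q * z \<in> ?S" using z q zq[OF zS] one by (auto simp: norm_mult mult.commute)
    have z1: "z \<noteq> 1" "z \<noteq> 0" using z by auto
    have qz1: "q * z \<noteq> 1" using zq[OF zS] by (metis mult.commute norm_mult norm_one less_irrefl)
    have pw: "z * q powi n \<noteq> 1" for n
      using annulus_not_power[OF q _ zq[OF zS], of n] zS z1 by (cases "n = 0") auto
    define N where "N = (1 + z) / (1 - z) * rank_series q z"
    define F where "F = lambert_sum UNIV q z"
    define \<theta> where "\<theta> = theta_j z q"
    have Kz: "K z = (N * \<phi> - \<phi> - 2 * z * F) * \<theta>^2 / z"
      unfolding K_def DD[OF zS z1(1)] \<theta>_def theta_j_conv_cof[OF q(2)] N_def F_def by (rule alg)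
    have "K (q * z) = ((1 + q * z) / (1 - q * z) * rank_series q (q * z) * \<phi> - \<phi> - 2 * (q * z) * lambert_sum UNIV q (q * z))
         * theta_j (q * z) q ^ 2 / (q * z)"
      unfolding K_def DD[OF qzS qz1] theta_j_conv_cof[OF q(2)] by (rule alg)
    also have "(1 + q * z) / (1 - q * z) * rank_series q (q * z) = 1 - q * z^2 - q * z^2 * N"
      unfolding N_def by (rule rank_series_mult[OF q(1) z(1) zq[OF zS]])
    also have "lambert_sum UNIV q (q * z) = - z * \<phi> - z^2 * F"
      unfolding F_def \<phi>_def by (rule lambert_sum_mult[OF q z1(2) pw])
    also have "theta_j (q * z) q = - \<theta> / z" unfolding \<theta>_def by (rule theta_j_mult[OF q(2) q0 z1(2)])
    also have "((1 - q * z^2 - q * z^2 * N) * \<phi> - \<phi> - 2 * (q * z) * (- z * \<phi> - z^2 * F)) =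
       - q * z^2 * (N * \<phi> - \<phi> - 2 * z * F)" by (simp add: algebra_simps power2_eq_square)
    also have "- q * z^2 * (N * \<phi> - \<phi> - 2 * z * F) * (- \<theta> / z)^2 / (q * z) = - 1 * K z"
      unfolding Kz using z1 q0 by (simp add: power2_eq_square)
    finally show ?thesis .
  qed
  have "K constant_on ?S"
    by (rule annulus_multiplier_constant[OF Kh q one _ mult]) auto
  then obtain k where k: "\<And>z. z \<in> ?S \<Longrightarrow> K z = k" by (auto simp: constant_on_def)
  have "K 1 = 0" by (simp add: K_def)
  moreover have "1 \<in> ?S" using q one by simp
  ultimately have "k = 0" using k by metis
  have D0: "D z = 0" if "z \<in> ?S" "z \<noteq> 1" for z
    using k[OF that(1)] \<open>k = 0\<close> that theta_cof_nonzero[OF q(2) _ zq[OF that(1)]] nz[OF that(1)]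
    by (simp add: K_def)
  have "D 1 = 0"
  proof -
    have "isCont D 1" using holomorphic_on_imp_continuous_on[OF Dh] \<open>1 \<in> ?S\<close> open_annulus
      by (metis continuous_on_eq_continuous_at)
    then have "(D \<longlongrightarrow> D 1) (at 1)" by (simp add: isCont_def)
    moreover have "eventually (\<lambda>z. D z = 0) (at 1)"
      using eventually_at_in_open[OF open_annulus \<open>1 \<in> ?S\<close>] by eventually_elim (use D0 in auto)
    then have "(D \<longlongrightarrow> 0) (at 1)" by (rule tendsto_eventually)
    ultimately show ?thesis using tendsto_unique[OF trivial_limit_at] by blast
  qed
  then have "D z = 0" using D0 z by (cases "z = 1") auto
  then have "(1 + z) * rank_series q z * \<phi> = (1 - z) * \<phi> + 2 * z * (1 + (1 - z) * lambert_sum (- {0}) q z)"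
    unfolding D_def by (simp only: diff_diff_eq right_minus_eq)
  then show ?thesis by (simp only: \<phi>_def)
qed

lemma alt_theta_times_rank_series_1:
  assumes q: "0 < norm q" "norm q < 1"
  shows "rank_series q 1 * alt_theta q = 1"
  using rank_series_lambert[OF q, of 1] q by (simp add: field_simps)

text \<open>The products \<open>P n\<close> generate the overpartitions with parts at most
  \<open>n\<close>, so the term for a given largest part is a difference of consecutive ones, and
  the series telescopes.\<close>

lemma rank_series_1:
  assumes q: "norm q < 1"
  shows "rank_series q 1 = qpoch_inf (- q) q / qpoch_inf q q"
proof -
  define P where "P = (\<lambda>n. (\<Prod>i<n. 1 + q ^ Suc i) / (\<Prod>i<n. 1 - q ^ Suc i))"
  have nz: "1 - q ^ Suc i \<noteq> 0" for i using rank_denominator_nonzero[OF q, of 1 i] q by simp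
  have "P \<longlonglongrightarrow> qpoch_inf (- q) q / qpoch_inf q q"
    unfolding P_def using qpoch_inf_tendsto[OF q, of "-q"] qpoch_inf_tendsto[OF q, of q]
    by (intro tendsto_divide qpoch_inf_nonzero q) simp_all
  then have "(\<lambda>n. P (Suc n) - P n) sums (qpoch_inf (- q) q / qpoch_inf q q - P 0)" by (rule telescope_sums)
  moreover have "P (Suc n) - P n = 2 * q * (rank_coeff q 1 n * (q / 1) ^ n)" for n
  proof -
    have "P (Suc n) = P n * (1 + q ^ Suc n) / (1 - q ^ Suc n)" by (simp add: P_def)
    moreover have "rank_coeff q 1 n = P n / (1 - q ^ Suc n)" by (simp add: P_def rank_coeff_def)
    moreover have "a * (1 + x) / (1 - x) - a = 2 * (a / (1 - x)) * x" if "1 - x \<noteq> 0" for a x :: complex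
      using that by (simp add: divide_simps) (simp add: algebra_simps)
    ultimately show ?thesis using nz[of n] by (simp only: not_False_eq_True) (simp add: mult_ac)
  qed
  ultimately have "(\<lambda>n. 2 * q * (rank_coeff q 1 n * (q / 1) ^ n)) sums (qpoch_inf (- q) q / qpoch_inf q q - 1)"
    by (simp add: P_def)
  moreover have "(\<lambda>n. 2 * q * (rank_coeff q 1 n * (q / 1) ^ n)) sums (2 * q * rank_aux q 1 (q / 1))"
    by (intro sums_mult rank_aux_sums) (use q in auto)
  ultimately show ?thesis using sums_unique2 unfolding rank_series_def by fastforce
qed

text \<open>Compares two evaluations at \<open>z = 1\<close>: the Appell relation says that the rank
  series is the reciprocal of the theta series, telescoping says that it is a product.\<close>

lemma alt_theta_product:
  assumes q: "0 < norm q" "norm q < 1"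
  shows "alt_theta q = qpoch_inf q q / qpoch_inf (- q) q" "alt_theta q \<noteq> 0"
    "rank_series q 1 = 1 / alt_theta q"
proof -
  have "qpoch_inf (- q) q \<noteq> 0" "qpoch_inf q q \<noteq> 0" using q by (simp_all add: qpoch_inf_nonzero)
  then show "alt_theta q = qpoch_inf q q / qpoch_inf (- q) q" "alt_theta q \<noteq> 0"
    using alt_theta_times_rank_series_1[OF q] unfolding rank_series_1[OF q(2)] by (auto simp: field_simps)
  then show "rank_series q 1 = 1 / alt_theta q"
    using alt_theta_times_rank_series_1[OF q] by (metis nonzero_eq_divide_eq)
qed

text \<open>The function N of the overview. It agrees with (1 + z) R / (1 - z) on the annulus where
  the rank series is known to converge, but lives on the whole plane minus 0 and its poles; repeated
  steps \<open>z\<close> to \<open>c * z\<close> leave that annulus.\<close>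

definition appell :: "complex \<Rightarrow> complex \<Rightarrow> complex" where
  "appell q z = 1 + 2 * z * lambert_sum UNIV q z / alt_theta q"

lemma rank_series_appell:
  assumes q: "0 < norm q" "norm q < 1" and z: "norm q < norm z" "norm z < 1 / norm q" "z \<noteq> 1"
  shows "(1 + z) * rank_series q z = (1 - z) * appell q z"
proof -
  have "norm z * norm q < 1" using z q by (simp add: field_simps)
  from lambert_sum_annulus[OF q z(1) this]
  have "(1 - z) * lambert_sum UNIV q z = 1 + (1 - z) * lambert_sum (- {0}) q z" using z(3) by (simp add: field_simps)
  then have "(1 + z) * rank_series q z * alt_theta q = (1 - z) * alt_theta q + 2 * z * ((1 - z) * lambert_sum UNIV q z)"
    using rank_series_lambert[OF q z(1,2)] by simp
  also have "\<dots> = (1 - z) * (appell q z * alt_theta q)"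
    using alt_theta_product(2)[OF q] by (simp add: appell_def distrib_right distrib_left)
  finally have "(1 + z) * rank_series q z * alt_theta q = ((1 - z) * appell q z) * alt_theta q" by simp
  then show ?thesis using alt_theta_product(2)[OF q] by simp
qed

lemma appell_mult:
  assumes q: "0 < norm q" "norm q < 1" and z: "z \<noteq> 0" "\<And>n::int. z * q powi n \<noteq> 1"
  shows "appell q (q * z) = 1 - q * z^2 - q * z^2 * appell q z"
  unfolding appell_def lambert_sum_mult[OF q z] using alt_theta_product(2)[OF q]
  by (simp add: field_simps power2_eq_square)

lemma appell_inverse:
  assumes q: "0 < norm q" "norm q < 1" and z: "z \<noteq> 0" "\<And>n::int. z * q powi n \<noteq> 1"
  shows "appell q (1 / z) = - appell q z"
proof -
  have "lambert_sum UNIV q (1 / z) / z = - alt_theta q - z * lambert_sum UNIV q z"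
    using lambert_sum_inverse[OF q z] by (simp add: algebra_simps)
  then have "2 * (1 / z) * lambert_sum UNIV q (1 / z) = 2 * (- alt_theta q - z * lambert_sum UNIV q z)"
    by (metis mult.assoc mult_1 times_divide_eq_left)
  then show ?thesis unfolding appell_def using alt_theta_product(2)[OF q]
    by (simp only:) (simp add: field_simps)
qed

text \<open>At -1 the relation to \<open>appell\<close> reads 0 = 0. The remedy is to exhibit the
  hidden factor \<open>1 + z\<close> of \<open>appell\<close>, cancel it nearby and let
  \<open>z\<close> tend to -1; the remaining factor \<open>(1 - z)^2\<close> gives the 4.\<close>

lemma rank_series_minus_1:
  assumes q: "0 < norm q" "norm q < 1"
  shows "rank_series q (- 1) = 4 / alt_theta q *
     (\<Sum>\<^sub>\<infinity>n::int. (-1) powi n * q powi (n^2 + n) / (1 + q powi n)^2)"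
proof -
  let ?S = "{z::complex. norm q < norm z \<and> norm z < 1 / norm q}"
  have q0: "q \<noteq> 0" using q by auto
  have \<phi>0: "alt_theta q \<noteq> 0" by (rule alt_theta_product(2)[OF q])
  define D where "D = (lambert_domain UNIV q)"
  define G where "G = (\<lambda>z. \<Sum>\<^sub>\<infinity>n::int. (-1) powi n * q powi n^2 / ((1 - z * q powi n) * (1 - z * q powi (-n))))"
  have oD: "open D" unfolding D_def by (rule open_lambert_domain[OF q])
  have m1: "-1 \<in> ?S" using q by (simp add: field_simps)
  have m1D: "-1 \<in> D"
  proof -
    have "-1 * q powi n \<noteq> 1" for n
    proof (cases "n = 0")
      case False
      moreover have "norm q < norm (-1::complex)" "norm (-1::complex) * norm q < 1" using q by simp_all
      ultimately show ?thesis by (intro annulus_not_power[OF q])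
    qed simp
    then show ?thesis by (simp add: D_def)
  qed
  have "G holomorphic_on D" unfolding G_def
  proof (rule holomorphic_on_infsum[OF oD])
    fix z assume "z \<in> D"
    then obtain d c where dc: "d > 0" "c > 0"
      "\<forall>w\<in>cball z d. w \<noteq> 0 \<and> (\<forall>n\<in>UNIV. c \<le> norm (1 - w * q powi n))"
      using lambert_denominators[OF q, of z UNIV] by (auto simp: D_def)
    have "w \<in> D" if "w \<in> cball z d" for w
    proof -
      have "1 - w * q powi n \<noteq> 0" for n using bspec[OF dc(3) that] dc(2) by (metis UNIV_I norm_zero not_less)
      then show ?thesis using bspec[OF dc(3) that] by (simp add: D_def)
    qed
    then have "cball z d \<subseteq> D" by blast
    moreover have "(\<lambda>n::int. 1 / (c * c) * norm q powi (n^2 + 0 * n)) summable_on UNIV"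
      by (intro summable_on_cmult_right summable_on_int_quadratic q)
    moreover have "norm ((-1) powi n * q powi n^2 / ((1 - w * q powi n) * (1 - w * q powi (-n)))) \<le>
        1 / (c * c) * norm q powi (n^2 + 0 * n)" if "w \<in> cball z d" for w n
    proof -
      have "c * c \<le> norm (1 - w * q powi n) * norm (1 - w * q powi (-n))"
        using dc that by (intro mult_mono) auto
      then have "norm q powi n^2 / (norm (1 - w * q powi n) * norm (1 - w * q powi (-n))) \<le> norm q powi n^2 / (c * c)"
        using dc(2) by (intro frac_le) (auto simp: zero_le_power_int)
      then show ?thesis by (simp add: norm_mult norm_divide norm_power_int)
    qed
    ultimately show "\<exists>d>0. cball z d \<subseteq> D \<and> (\<exists>M. M summable_on UNIV \<and> (\<forall>n\<in>UNIV. \<forall>w\<in>cball z d.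
        norm ((-1) powi n * q powi n^2 / ((1 - w * q powi n) * (1 - w * q powi (-n)))) \<le> M n))"
      using dc by blast
  qed (use q0 in \<open>intro holomorphic_intros, auto simp: D_def\<close>)
  then have G1: "G \<midarrow>-1\<rightarrow> G (-1)"
    using holomorphic_on_imp_continuous_on m1D oD by (metis continuous_on_eq_continuous_at isCont_def)
  have R1: "rank_series q \<midarrow>-1\<rightarrow> rank_series q (-1)"
    using holomorphic_on_imp_continuous_on[OF holomorphic_on_rank_series[OF q]] m1 open_annulus
    by (metis continuous_on_eq_continuous_at isCont_def)
  have key: "rank_series q z * alt_theta q = (1 - z)^2 * G z" if z: "z \<in> ?S" "z \<in> D" "z \<noteq> -1" for z
  proof -
    have z0: "z \<noteq> 0" and pw: "\<And>n. z * q powi n \<noteq> 1" using z by (auto simp: D_def)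
    have z1: "z \<noteq> 1" using pw[of 0] by auto
    have pw': "1 / z * q powi n \<noteq> 1" for n
      using pw[of "-n"] z0 q0 by (auto simp: power_int_minus field_simps)
    have s1: "(\<lambda>n. (-1) powi n * q powi (n^2 + n) / (1 - z * q powi n)) summable_on UNIV"
      using lambert_sum_summable[OF q z0, of UNIV 1] pw by simp
    have s2: "(\<lambda>n. (-1) powi n * q powi (n^2 + n) / (1 - 1 / z * q powi n)) summable_on UNIV"
      using lambert_sum_summable[OF q, of "1 / z" UNIV 1] pw' z0 by simp
    \<comment> \<open>Half of the doubled sum is replaced by its inverted form; the summands then
      combine in pairs into terms divisible by \<open>1 - z^2\<close>.\<close>
    have "a + 2 * z * l = z * l + (- 1 / z) * m" if e: "z * l + m / z = - a" for a l m
    proof -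
      have "a = - (z * l + m / z)" using e by simp
      then show ?thesis by (simp add: algebra_simps)
    qed
    from this[OF lambert_sum_inverse[OF q z0 pw]] have "alt_theta q + 2 * z * lambert_sum UNIV q z = z * lambert_sum UNIV q z + (- 1 / z) * lambert_sum UNIV q (1 / z)" .
    also have "\<dots> = (\<Sum>\<^sub>\<infinity>n. z * ((-1) powi n * q powi (n^2 + n) / (1 - z * q powi n)) +
        (- 1 / z) * ((-1) powi n * q powi (n^2 + n) / (1 - 1 / z * q powi n)))"
      unfolding lambert_sum_def
      by (subst infsum_add) (auto simp only: infsum_cmult_right' intro!: summable_on_cmult_right s1 s2)
    also have "\<dots> = (\<Sum>\<^sub>\<infinity>n. (1 - z^2) * ((-1) powi n * q powi n^2 / ((1 - z * q powi n) * (1 - z * q powi (-n)))))"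
    proof (rule infsum_cong)
      fix n :: int
      define x where "x = q powi n"
      define t where "t = (-1) powi n * q powi n^2"
      have x0: "x \<noteq> 0" using q0 by (simp add: x_def)
      have a: "1 - z * x \<noteq> 0" using pw[of n] by (simp add: x_def)
      have b: "x - z \<noteq> 0"
      proof
        assume "x - z = 0"
        then have "z * q powi (- n) = 1" using z0 by (simp add: x_def power_int_minus)
        then show False using pw by blast
      qed
      have e: "(-1) powi n * q powi (n^2 + n) = t * x" "1 - z * q powi (-n) = (x - z) / x"
        "1 - 1 / z * x = - (x - z) / z"
        using q0 x0 z0 by (simp_all add: t_def x_def power_int_add power_int_minus field_simps)
      show "z * ((-1) powi n * q powi (n^2 + n) / (1 - z * q powi n)) +
        (- 1 / z) * ((-1) powi n * q powi (n^2 + n) / (1 - 1 / z * q powi n)) =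
        (1 - z^2) * ((-1) powi n * q powi n^2 / ((1 - z * q powi n) * (1 - z * q powi (-n))))"
        unfolding e(1,2) x_def[symmetric] t_def[symmetric] e(3) using a b x0 z0
        by (simp add: divide_simps) (simp add: algebra_simps power2_eq_square)
    qed
    also have "\<dots> = (1 - z^2) * G z" by (simp only: infsum_cmult_right' G_def)
    finally have e: "alt_theta q + 2 * z * lambert_sum UNIV q z = (1 - z^2) * G z" .
    have "(1 + z) * rank_series q z * alt_theta q = (1 - z) * (alt_theta q + 2 * z * lambert_sum UNIV q z)"
      using rank_series_appell[OF q, of z] z z1 \<phi>0 by (simp add: appell_def field_simps)
    also have "\<dots> = (1 + z) * ((1 - z)^2 * G z)" unfolding e by (simp add: power2_eq_square algebra_simps)
    finally have "(1 + z) * (rank_series q z * alt_theta q) = (1 + z) * ((1 - z)^2 * G z)" by simp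
    moreover have "1 + z \<noteq> 0" using z(3) by (metis add_eq_0_iff)
    ultimately show ?thesis by simp
  qed
  have "eventually (\<lambda>z. z \<in> (?S \<inter> D) - {-1}) (at (-1))"
    using m1 m1D oD open_annulus by (intro eventually_at_in_open open_Int) auto
  then have "eventually (\<lambda>z. (1 - z)^2 * G z = rank_series q z * alt_theta q) (at (-1))"
    by eventually_elim (use key in auto)
  moreover have "((\<lambda>z. (1 - z)^2 * G z) \<longlongrightarrow> (1 - (-1))^2 * G (-1)) (at (-1))"
    by (intro tendsto_intros G1)
  ultimately have "((\<lambda>z. rank_series q z * alt_theta q) \<longlongrightarrow> (1 - (-1))^2 * G (-1)) (at (-1))"
    by (rule Lim_transform_eventually[rotated])
  moreover have "((\<lambda>z. rank_series q z * alt_theta q) \<longlongrightarrow> rank_series q (-1) * alt_theta q) (at (-1))"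
    by (intro tendsto_intros R1)
  ultimately have "rank_series q (-1) * alt_theta q = 4 * G (-1)"
    using tendsto_unique[OF trivial_limit_at] by fastforce
  moreover have "G (-1) = (\<Sum>\<^sub>\<infinity>n::int. (-1) powi n * q powi (n^2 + n) / (1 + q powi n)^2)"
    unfolding G_def
  proof (rule infsum_cong)
    fix n :: int
    define x where "x = q powi n"
    have x0: "x \<noteq> 0" using q0 by (simp add: x_def)
    have "1 - (-1) * q powi (-n) = (1 + x) / x" "q powi (n^2 + n) = q powi n^2 * x"
      using q0 x0 by (simp_all add: x_def power_int_add power_int_minus field_simps)
    then show "(-1) powi n * q powi n^2 / ((1 - (-1) * q powi n) * (1 - (-1) * q powi (-n))) =
       (-1) powi n * q powi (n^2 + n) / (1 + q powi n)^2"
      by (simp add: x_def[symmetric] power2_eq_square)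
  qed
  ultimately show ?thesis using \<phi>0 by (simp add: field_simps)
qed

section \<open>Averaging over cube roots of the nome\<close>

text \<open>Riemann's removable singularity theorem, one point at a time; the limit condition at the
  other points survives because each extension only changes values away from them.\<close>

lemma holomorphic_extend_finite:
  assumes "finite P" "P \<subseteq> B" "open B" "f holomorphic_on (B - P)"
    and "\<And>p. p \<in> P \<Longrightarrow> ((\<lambda>z. (z - p) * f z) \<longlongrightarrow> 0) (at p)"
  shows "\<exists>g. g holomorphic_on B \<and> (\<forall>z\<in>B - P. g z = f z)"
  using assms
proof (induction P arbitrary: f rule: finite_induct)
  case empty
  then show ?case by auto
next
  case (insert p P)
  have o: "open (B - P)" using insert by (simp add: finite_imp_closed open_Diff)
  have "f holomorphic_on ((B - P) - {p})"
    using insert.prems(3) by (simp add: Diff_insert[symmetric])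
  moreover have "p \<in> interior (B - P)" using insert o by (simp add: interior_open)
  ultimately have "\<exists>f1. f1 holomorphic_on (B - P) \<and> (\<forall>z\<in>(B - P) - {p}. f1 z = f z)"
    using holomorphic_on_extend_lim insert.prems(4) by blast
  then obtain f1 where f1: "f1 holomorphic_on (B - P)" "\<forall>z\<in>(B - P) - {p}. f1 z = f z" by blast
  have "((\<lambda>z. (z - p') * f1 z) \<longlongrightarrow> 0) (at p')" if p': "p' \<in> P" for p'
  proof -
    have "open (B - (insert p P - {p'}))" using insert by (simp add: finite_imp_closed open_Diff)
    moreover have "p' \<in> B - (insert p P - {p'})" using p' insert.prems(1) by auto
    ultimately have "eventually (\<lambda>z. z \<in> (B - (insert p P - {p'})) - {p'}) (at p')"
      by (rule eventually_at_in_open)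
    then have "eventually (\<lambda>z. (z - p') * f z = (z - p') * f1 z) (at p')"
      by eventually_elim (use f1(2) in auto)
    then show ?thesis using insert.prems(4)[of p'] p' by (simp add: Lim_transform_eventually)
  qed
  then obtain g where g: "g holomorphic_on B" "\<forall>z\<in>B - P. g z = f1 z"
    using insert.IH[OF _ insert.prems(2) f1(1)] insert.prems(1) by blast
  then show ?case using f1(2) by (intro exI[of _ g]) auto
qed

text \<open>The quotient j(y; q) / j(y; q^3) with the common zeros at powers of \<open>q^3\<close>
  cancelled. It is thus defined at \<open>y = 1\<close>, and it keeps the zeros at \<open>q\<close>
  and \<open>q^2\<close>.\<close>

definition theta_quot :: "complex \<Rightarrow> complex \<Rightarrow> complex" where
  "theta_quot q y = qpoch_inf (y * q) (q^3) * qpoch_inf (y * q^2) (q^3) *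
     qpoch_inf (q / y) (q^3) * qpoch_inf (q^2 / y) (q^3) * qpoch_inf q q / qpoch_inf (q^3) (q^3)"

lemma norm_power3_less_1: "norm (q::complex) < 1 \<Longrightarrow> norm (q^3) < 1"
  by (simp add: norm_power power_less_one_iff)

lemma qpoch_inf_split3:
  assumes "norm q < 1"
  shows "qpoch_inf a q = qpoch_inf a (q^3) * qpoch_inf (a * q) (q^3) * qpoch_inf (a * q^2) (q^3)"
  using qpoch_inf_split[OF assms, of 3 a] by (simp add: eval_nat_numeral lessThan_Suc)

lemma theta_cof_quot:
  assumes "norm q < 1" "y \<noteq> 0"
  shows "theta_cof y q = theta_cof y (q^3) * theta_quot q y"
proof -
  have "qpoch_inf (q^3) (q^3) \<noteq> 0" using assms by (intro qpoch_inf_nonzero norm_power3_less_1)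
  moreover have e: "y * q * q^2 = y * q^3" "q / y * q^2 = q^3 / y" "y * q * q = y * q^2" "q / y * q = q^2 / y"
    by (simp_all add: power2_eq_square power3_eq_cube)
  ultimately show ?thesis
    unfolding theta_cof_def theta_quot_def qpoch_inf_split3[OF assms(1), of "y * q"]
      qpoch_inf_split3[OF assms(1), of "q / y"] e
    by simp
qed

lemma theta_quot_zero:
  assumes "norm q < 1" "q \<noteq> 0" "y = q \<or> y = q^2"
  shows "theta_quot q y = 0"
proof -
  have "qpoch_inf 1 (q^3) = 0" using assms by (subst qpoch_inf_eq_0_iff) (auto intro!: norm_power3_less_1 exI[of _ 0])
  then show ?thesis using assms by (auto simp: theta_quot_def)
qed

lemma holomorphic_on_theta_quot [holomorphic_intros]:
  assumes "norm q < 1" "f holomorphic_on A" "\<And>z. z \<in> A \<Longrightarrow> f z \<noteq> 0"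
  shows "(\<lambda>z. theta_quot q (f z)) holomorphic_on A"
proof -
  have "qpoch_inf (q^3) (q^3) \<noteq> 0" using assms by (intro qpoch_inf_nonzero norm_power3_less_1)
  then show ?thesis unfolding theta_quot_def using assms norm_power3_less_1
    by (intro holomorphic_intros) auto
qed

text \<open>Three steps in nome \<open>q\<close> contribute -1 / (q^3 y^3), one step in nome
  \<open>q^3\<close> contributes -1 / y. The bounds on \<open>y\<close> keep the denominator theta
  function away from its zeros.\<close>

lemma theta_quot_mult:
  assumes q: "norm q < 1" "q \<noteq> 0" and y: "1 < norm y" "norm y * norm (q^3) < 1"
  shows "theta_quot q (q^3 * y) = theta_quot q y / (q^3 * y^2)"
proof -
  note q3 = norm_power3_less_1[OF q(1)]
  have y0: "y \<noteq> 0" "y \<noteq> 1" using y by auto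
  have th: "theta_j x q = theta_j x (q^3) * theta_quot q x" if "x \<noteq> 0" for x
    using theta_cof_quot[OF q(1) that] by (simp add: theta_j_conv_cof[OF q(1)] theta_j_conv_cof[OF q3])
  have nz: "theta_j y (q^3) \<noteq> 0"
    using theta_cof_nonzero[OF q3, of y] y y0 q3 by (simp add: theta_j_conv_cof[OF q3])
  have "theta_j (q * (q * (q * y))) q = - theta_j y q / (q^3 * y^3)"
    using q y0 by (simp add: theta_j_mult[OF q] field_simps power3_eq_cube)
  moreover have "q * (q * (q * y)) = q^3 * y" by (simp add: power3_eq_cube)
  ultimately have "theta_j (q^3 * y) (q^3) * theta_quot q (q^3 * y) = - (theta_j y (q^3) * theta_quot q y) / (q^3 * y^3)"
    using th[of y] th[of "q^3 * y"] y0 q by simp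
  moreover have "theta_j (q^3 * y) (q^3) = - theta_j y (q^3) / y"
    using q3 q y0 by (intro theta_j_mult) auto
  moreover have "G' = G / (Q * y^2)" if "(- A / y) * G' = - (A * G) / (Q * y^3)" "A \<noteq> 0" "Q \<noteq> 0" for A G G' Q
  proof -
    have "A * (G' * (Q * y^2)) = A * G"
      using that y0 by (simp add: field_simps power2_eq_square power3_eq_cube)
    then show ?thesis using that y0 by (simp add: field_simps)
  qed
  moreover have "q^3 \<noteq> 0" using q by simp
  ultimately show ?thesis using nz by metis
qed

text \<open>The comparison function: its multiplier is -1, and in the annulus
  \<open>norm q < norm z < 1 / norm q\<close> its only singularity is the pole at 1.\<close>

definition theta_ratio :: "complex \<Rightarrow> complex \<Rightarrow> complex" where
  "theta_ratio q z = theta_j (- z) q / theta_j z q"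

lemma theta_ratio_mult:
  assumes "norm q < 1" "q \<noteq> 0" "z \<noteq> 0"
  shows "theta_ratio q (q * z) = - theta_ratio q z"
  using theta_j_mult[OF assms] theta_j_mult[OF assms(1,2), of "-z"] assms(3)
  by (simp add: theta_ratio_def)

lemma theta_ratio_conv_cof:
  assumes "norm q < 1"
  shows "theta_ratio q z = (1 + z) * theta_cof (- z) q / ((1 - z) * theta_cof z q)"
  by (simp add: theta_ratio_def theta_j_conv_cof[OF assms])

lemma theta_ratio_inverse:
  assumes "norm q < 1" "z \<noteq> 0"
  shows "theta_ratio q (1 / z) = - theta_ratio q z"
proof (cases "z = 1")
  case True
  then show ?thesis using assms by (simp add: theta_ratio_def theta_j_conv_cof[OF assms(1)])
next
  case False
  have "theta_cof (- (1 / z)) q = theta_cof (- z) q"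
    using theta_cof_inverse[of "- z" q] assms(2) by simp
  moreover have "(1 + 1 / z) * a / ((1 - 1 / z) * b) = - ((1 + z) * a / ((1 - z) * b))" for a b
  proof -
    have "1 - 1 / z = - ((1 - z) / z)" "1 + 1 / z = (1 + z) / z" using assms(2) by (auto simp: field_simps)
    then show ?thesis using assms(2) by simp
  qed
  ultimately show ?thesis unfolding theta_ratio_conv_cof[OF assms(1)]
    by (simp only: theta_cof_inverse[OF assms(2)])
qed

lemma holomorphic_on_theta_ratio:
  assumes "0 < norm q" "norm q < 1"
  shows "theta_ratio q holomorphic_on {z. norm q < norm z \<and> norm z * norm q < 1} - {1}"
proof -
  have "theta_j z q \<noteq> 0" if "norm q < norm z" "norm z * norm q < 1" "z \<noteq> 1" for z
    using theta_cof_nonzero[OF assms(2) that(1,2)] that(3) by (simp add: theta_j_conv_cof[OF assms(2)])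
  then show ?thesis unfolding theta_ratio_def using assms
    by (intro holomorphic_intros) auto
qed

lemma isCont_theta_cof:
  assumes "norm q < 1" "z \<noteq> 0"
  shows "isCont (\<lambda>z. theta_cof z q) z"
proof -
  have "(\<lambda>z. theta_cof z q) holomorphic_on - {0}" by (intro holomorphic_intros assms) auto
  then show ?thesis using assms(2)
    by (metis Compl_iff continuous_on_eq_continuous_at holomorphic_on_imp_continuous_on open_delete open_UNIV Compl_eq_Diff_UNIV singletonD)
qed

lemma holomorphic_on_appell [holomorphic_intros]:
  assumes "0 < norm r" "norm r < 1" "f holomorphic_on A"
    "\<And>z. z \<in> A \<Longrightarrow> f z \<noteq> 0" "\<And>z n. z \<in> A \<Longrightarrow> f z * r powi n \<noteq> 1"
  shows "(\<lambda>z. appell r (f z)) holomorphic_on A"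
proof -
  let ?D = "(lambert_domain UNIV r)"
  have "appell r holomorphic_on ?D"
    unfolding appell_def [abs_def]
    by (intro holomorphic_intros holomorphic_on_lambert_sum assms) (simp add: alt_theta_product assms)
  moreover have "f ` A \<subseteq> ?D" by (intro image_subsetI CollectI conjI ballI assms)
  ultimately show ?thesis
    using holomorphic_on_compose_gen[OF assms(3)] by (force simp: o_def)
qed

text \<open>The derivative of 1 - z^3 at \<open>p\<close> is -3 p^2, and 1 / p^2 = p for a cube root
  of unity. This is the factor that residues acquire when a function is pulled back along
  \<open>z ^ 3\<close>.\<close>

lemma tendsto_cube_quot:
  assumes "p ^ 3 = (1::complex)"
  shows "((\<lambda>z. (z - p) / (1 - z ^ 3)) \<longlongrightarrow> - p / 3) (at p)"
    and "eventually (\<lambda>z. z ^ 3 \<noteq> 1) (at p)"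
proof -
  have p0: "p \<noteq> 0" using assms by auto
  have f: "1 - z ^ 3 = - ((z - p) * (z^2 + z * p + p^2))" for z :: complex using assms by algebra
  have "((\<lambda>z. z^2 + z * p + p^2) \<longlongrightarrow> p^2 + p * p + p^2) (at p)" by (intro tendsto_intros)
  moreover have p2: "p^2 + p * p + p^2 = 3 * p^2" by (simp add: power2_eq_square)
  ultimately have l: "((\<lambda>z. z^2 + z * p + p^2) \<longlongrightarrow> 3 * p^2) (at p)" by simp
  then have ev: "eventually (\<lambda>z. z^2 + z * p + p^2 \<noteq> 0) (at p)"
    by (rule tendsto_imp_eventually_ne) (use p0 in simp)
  moreover have ne: "eventually (\<lambda>z. z \<noteq> p) (at p)" by (simp add: eventually_at_filter)
  ultimately show "eventually (\<lambda>z. z ^ 3 \<noteq> 1) (at p)"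
    by eventually_elim (use f in \<open>auto simp: eq_iff_diff_eq_0[of 1] dest: sym\<close>)
  have "((\<lambda>z. - 1 / (z^2 + z * p + p^2)) \<longlongrightarrow> - 1 / (3 * p^2)) (at p)"
    by (intro tendsto_intros l) (use p0 in simp)
  moreover have "- 1 / (3 * p^2) = - p / 3" using assms p0 by (simp add: field_simps power2_eq_square power3_eq_cube)
  moreover have "eventually (\<lambda>z. - 1 / (z^2 + z * p + p^2) = (z - p) / (1 - z ^ 3)) (at p)"
    using ev ne by eventually_elim (auto simp: f divide_simps)
  ultimately show "((\<lambda>z. (z - p) / (1 - z ^ 3)) \<longlongrightarrow> - p / 3) (at p)"
    by (simp only: Lim_transform_eventually)
qed

lemma isCont_of_holomorphic: "f holomorphic_on S \<Longrightarrow> open S \<Longrightarrow> x \<in> S \<Longrightarrow> isCont f x"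
  using continuous_on_eq_continuous_at holomorphic_on_imp_continuous_on by blast

lemma isCont_rank_series:
  assumes "0 < norm r" "norm r < 1" "norm z = 1"
  shows "isCont (rank_series r) z"
  using assms by (intro isCont_of_holomorphic[OF holomorphic_on_rank_series open_annulus]) auto

lemma appell_residue_1:
  assumes r: "0 < norm r" "norm r < 1"
  shows "((\<lambda>z. (1 - z) * appell r z) \<longlongrightarrow> 2 * rank_series r 1) (at 1)"
proof -
  have "((\<lambda>z. (1 + z) * rank_series r z) \<longlongrightarrow> (1 + 1) * rank_series r 1) (at 1)"
    using isCont_rank_series[OF r, of 1] by (intro tendsto_intros) (simp add: isContD)
  moreover have "eventually (\<lambda>z. z \<in> {z::complex. norm r < norm z \<and> norm z < 1 / norm r} - {1}) (at 1)"
    using r by (intro eventually_at_in_open open_annulus) simp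
  then have "eventually (\<lambda>z. (1 + z) * rank_series r z = (1 - z) * appell r z) (at 1)"
    by eventually_elim (use rank_series_appell[OF r] in auto)
  ultimately show ?thesis by (simp add: Lim_transform_eventually)
qed

lemma tendsto_compose_cube:
  assumes "(f \<longlongrightarrow> l) (at 1)" "p ^ 3 = (1::complex)"
  shows "((\<lambda>z. f (z ^ 3)) \<longlongrightarrow> l) (at p)"
proof (rule tendsto_compose_eventually[OF assms(1)])
  show "((\<lambda>z. z ^ 3) \<longlongrightarrow> 1) (at p)" using tendsto_power[OF tendsto_ident_at[of p UNIV], of 3] assms(2) by simp
qed (rule tendsto_cube_quot(2)[OF assms(2)])

lemma theta_ratio_residue_1:
  assumes r: "0 < norm r" "norm r < 1"
  shows "((\<lambda>z. (1 - z) * theta_ratio r z) \<longlongrightarrow> theta_j (- 1) r / theta_cof 1 r) (at 1)"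
proof -
  have nz: "theta_cof 1 r \<noteq> 0" using r by (intro theta_cof_nonzero) auto
  have "((\<lambda>z. (1 + z) * theta_cof (- z) r / theta_cof z r) \<longlongrightarrow> (1 + 1) * theta_cof (- 1) r / theta_cof 1 r) (at 1)"
  proof (intro tendsto_intros nz)
    show "((\<lambda>z. theta_cof z r) \<longlongrightarrow> theta_cof 1 r) (at 1)"
      using isCont_theta_cof[OF r(2), of 1] by (simp add: isCont_def)
    show "((\<lambda>z. theta_cof (- z) r) \<longlongrightarrow> theta_cof (- 1) r) (at 1)"
    proof -
      have "(\<lambda>z. theta_cof (- z) r) holomorphic_on - {0}" by (intro holomorphic_intros r) auto
      then have "isCont (\<lambda>z. theta_cof (- z) r) 1" by (rule isCont_of_holomorphic) auto
      then show ?thesis by (simp add: isCont_def)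
    qed
  qed
  moreover have "(1 + 1) * theta_cof (- 1) r = theta_j (- 1) r" by (simp add: theta_j_conv_cof[OF r(2)])
  moreover have "eventually (\<lambda>z. (1 + z) * theta_cof (- z) r / theta_cof z r = (1 - z) * theta_ratio r z) (at 1)"
    unfolding eventually_at_filter by (intro always_eventually) (auto simp: theta_ratio_conv_cof[OF r(2)])
  ultimately show ?thesis by (simp add: Lim_transform_eventually)
qed

lemma theta_j_minus_1_nonzero:
  assumes "0 < norm r" "norm r < 1"
  shows "theta_j (- 1) r \<noteq> 0"
  using theta_cof_nonzero[of r "-1"] assms by (simp add: theta_j_conv_cof)

text \<open>\<open>c\<close> is a cube root of the nome \<open>q\<close>, so averaging over \<open>w ^ j * c\<close> extracts
  the coefficients of \<open>c ^ (3 * n) = q ^ n\<close>.\<close>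
locale cubic_section =
  fixes q c w :: complex
  assumes q_pos: "0 < norm q" and q_less_1: "norm q < 1"
    and c_cubed: "c ^ 3 = q" and w_root: "1 + w + w^2 = 0"
begin

section \<open>The three nomes and the location of the poles\<close>

lemma q_nonzero: "q \<noteq> 0" using q_pos by auto

lemma w_cubed: "w ^ 3 = 1" using w_root by algebra

lemma w_neq_1: "w \<noteq> 1" using w_root by auto

lemma norm_w: "norm w = 1"
  using power_eq_1_iff[OF w_cubed] by simp

lemma w_nonzero: "w \<noteq> 0" using norm_w by auto

lemma norm_w_c: "norm (w ^ j * c) = norm c" by (simp add: norm_mult norm_power norm_w)

lemma norm_c_cubed: "norm c ^ 3 = norm q" using c_cubed by (metis norm_power)

lemma c_pos: "0 < norm c" using q_pos c_cubed by auto

lemma c_less_1: "norm c < 1"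
proof (rule ccontr)
  assume "\<not> norm c < 1"
  then have "norm c ^ 3 \<ge> 1" by simp
  then show False using norm_c_cubed q_less_1 by simp
qed

lemma w_c_nome: "0 < norm (w ^ j * c)" "norm (w ^ j * c) < 1" using c_pos c_less_1 norm_w_c by auto

lemma w_c_cubed: "(w ^ j * c) ^ 3 = q"
proof -
  have "(w ^ j * c) ^ 3 = (w ^ 3) ^ j * c ^ 3" by (simp add: power_mult_distrib power_mult [symmetric] mult.commute)
  then show ?thesis by (simp add: w_cubed c_cubed)
qed

lemma w_c_powi_cubed: "((w ^ j * c) powi n) ^ 3 = q powi n"
proof -
  have "((w ^ j * c) powi n) ^ 3 = ((w ^ j * c) ^ 3) powi n"
    using power_int_mult[of "w ^ j * c" n 3] power_int_mult[of "w ^ j * c" 3 n]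
    by (simp add: mult.commute[of n])
  then show ?thesis by (simp add: w_c_cubed)
qed

lemma q3: "0 < norm (q ^ 3)" "norm (q ^ 3) < 1"
  using q_pos q_nonzero norm_power3_less_1[OF q_less_1] by auto

definition appell_section :: "complex \<Rightarrow> complex" where
  "appell_section z = (\<Sum>j<3. appell (w ^ j * c) z) / 3"

definition rank_section :: "complex \<Rightarrow> complex" where
  "rank_section z = (\<Sum>j<3. rank_series (w ^ j * c) z) / 3"

text \<open>A fundamental annulus for \<open>z\<close> to \<open>q * z\<close> extended by the
  overlap \<open>1 < norm z < 1 / norm c\<close>. The outer radius is that of the next possible
  poles, \<open>z ^ 3 = 1 / q\<close>, so the overlap is free of poles.\<close>

definition region :: "complex set" where "region = {z. norm q < norm z \<and> norm z < 1 / norm c}"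

text \<open>Every pole of the functions involved has \<open>z ^ 3\<close> equal to a power of
  \<open>q\<close>; inside \<open>region\<close> only the exponents 0, 1 and 2 occur.\<close>

definition poles :: "complex set" where "poles = {z. z ^ 3 = 1 \<or> z ^ 3 = q \<or> z ^ 3 = q ^ 2}"

lemma finite_poles: "finite poles"
proof -
  have "finite {z::complex. z ^ 3 = a}" for a
  proof -
    have "{z. poly (monom 1 3 - [:a:]) z = 0} = {z. z ^ 3 = a}" by (simp add: poly_monom)
    moreover have "monom 1 3 - [:a:] \<noteq> 0"
    proof
      assume "monom 1 3 - [:a:] = 0"
      then have "coeff (monom 1 3 - [:a:]) 3 = 0" by simp
      then show False by (simp add: numeral_3_eq_3)
    qed
    ultimately show ?thesis using poly_roots_finite by metis
  qed
  moreover have "poles = {z. z ^ 3 = 1} \<union> {z. z ^ 3 = q} \<union> {z. z ^ 3 = q ^ 2}" by (auto simp: poles_def)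
  ultimately show ?thesis by simp
qed

lemma open_region: "open region" unfolding region_def by (rule open_annulus)

lemma region_nonzero: "z \<in> region \<Longrightarrow> z \<noteq> 0" using q_pos by (auto simp: region_def)

lemma region_cubed: "z \<in> region \<Longrightarrow> norm q ^ 3 < norm z ^ 3 \<and> norm z ^ 3 * norm q < 1"
proof -
  assume z: "z \<in> region"
  have "norm z * norm c < 1" using z c_pos by (simp add: region_def field_simps)
  then have "(norm z * norm c) ^ 3 < 1" by (simp add: power_less_one_iff)
  moreover have "norm q ^ 3 < norm z ^ 3" using z by (intro power_strict_mono) (auto simp: region_def)
  ultimately show ?thesis by (simp add: power_mult_distrib norm_c_cubed)
qed

lemma region_q: assumes "z \<in> region" shows "norm q < norm z" "norm z * norm q < 1"
proof -
  show "norm q < norm z" using assms by (simp add: region_def)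
  have "norm z * norm c < 1" using assms c_pos by (simp add: region_def field_simps)
  moreover have "norm q \<le> norm c"
    using c_pos c_less_1 norm_c_cubed by (metis less_imp_le power_decreasing power_one_right one_le_numeral)
  ultimately show "norm z * norm q < 1" by (meson dual_order.strict_trans2 mult_left_mono norm_ge_zero)
qed

lemma region_cube_power:
  assumes z: "z \<in> region" and e: "z ^ 3 * q powi n = 1"
  shows "z \<in> poles"
proof -
  have m: "z ^ 3 = q powi (- n)" using e q_nonzero by (simp add: power_int_minus field_simps)
  then have nm: "norm z ^ 3 = norm q powi (- n)" by (metis norm_power norm_power_int)
  have "- n < 3"
  proof (rule ccontr)
    assume "\<not> - n < 3"
    then have "norm q powi (- n) \<le> norm q powi 3" using q_pos q_less_1 by (intro power_int_decreasing) auto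
    then show False using region_cubed[OF z] nm by simp
  qed
  moreover have "- n > - 1"
  proof (rule ccontr)
    assume "\<not> - n > - 1"
    then have "norm q powi (- n) \<ge> norm q powi (- 1)" using q_pos q_less_1 by (intro power_int_decreasing) auto
    then have "norm z ^ 3 * norm q \<ge> norm q powi (- 1) * norm q" unfolding nm by (intro mult_right_mono) auto
    then show False using region_cubed[OF z] q_pos by (simp add: power_int_minus)
  qed
  ultimately have "- n = 0 \<or> - n = 1 \<or> - n = 2" by linarith
  then show ?thesis using m by (auto simp: poles_def)
qed

lemma region_not_pole:
  assumes "z \<in> region - poles"
  shows "z * (w ^ j * c) powi n \<noteq> 1" "z ^ 3 * (q ^ 3) powi n \<noteq> 1"
proof -
  show "z * (w ^ j * c) powi n \<noteq> 1"
  proof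
    assume "z * (w ^ j * c) powi n = 1"
    then have "z ^ 3 * q powi n = 1" by (metis w_c_powi_cubed power_mult_distrib power_one)
    then show False using region_cube_power assms by blast
  qed
  have "(q ^ 3) powi n = q powi (3 * n)" by (simp add: power_int_mult)
  then show "z ^ 3 * (q ^ 3) powi n \<noteq> 1" using region_cube_power assms by auto
qed

text \<open>For \<open>x ^ 3 = q\<close>, three uses of the equation in nome \<open>x\<close>
  produce inhomogeneous terms 1, x^5, x^8 and x^9. The exponents 5 and 8 are not divisible by 3, so
  these terms average out, while x^9 = q^3 is the same for all three nomes.\<close>

lemma appell_section_mult:
  assumes z: "z \<noteq> 0" "\<And>j n. z * (w ^ j * c) powi n \<noteq> 1"
  shows "appell_section (q * z) = 1 - q^3 * z^6 - q^3 * z^6 * appell_section z"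
proof -
  have one: "appell x (q * z) = 1 - 2 * x^5 * z^2 + 2 * x^8 * z^4 - q^3 * z^6 - q^3 * z^6 * appell x z"
    if x: "x = w ^ j * c" for x j
  proof -
    have nx: "0 < norm x" "norm x < 1" using w_c_nome x by auto
    have x0: "x \<noteq> 0" using nx by auto
    have zx: "z * x powi n \<noteq> 1" for n using z(2) x by auto
    have "x * z * x powi n = z * x powi (n + 1)" for n using x0 by (simp add: power_int_add)
    then have zx1: "x * z * x powi n \<noteq> 1" for n using zx by metis
    have "x * (x * z) * x powi n = z * x powi (n + 2)" for n using x0 by (simp add: power_int_add power2_eq_square)
    then have zx2: "x * (x * z) * x powi n \<noteq> 1" for n using zx by metis
    have "q * z = x * (x * (x * z))" using w_c_cubed[of j] x by (simp add: power3_eq_cube mult.assoc)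
    moreover have "q^3 = x^9"
    proof -
      have "x^3 = q" using w_c_cubed x by simp
      then have "q^3 = (x^3)^3" by simp
      then show ?thesis by (simp flip: power_mult)
    qed
    moreover have "appell x (x * (x * (x * z))) = 1 - x * (x * (x * z))^2 - x * (x * (x * z))^2 * appell x (x * (x * z))"
      by (rule appell_mult[OF nx _ zx2]) (use x0 z(1) in simp)
    moreover have "appell x (x * (x * z)) = 1 - x * (x * z)^2 - x * (x * z)^2 * appell x (x * z)"
      by (rule appell_mult[OF nx _ zx1]) (use x0 z(1) in simp)
    moreover note appell_mult[OF nx z(1) zx]
    moreover have "1 - x * (x * (x * z))^2 - x * (x * (x * z))^2 *
        (1 - x * (x * z)^2 - x * (x * z)^2 * (1 - x * z^2 - x * z^2 * a)) =
        1 - 2 * x^5 * z^2 + 2 * x^8 * z^4 - x^9 * z^6 - x^9 * z^6 * a" for a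
      by (simp add: algebra_simps power2_eq_square eval_nat_numeral)
    ultimately show ?thesis by (simp only:)
  qed
  have s: "(\<Sum>j<3. (w ^ j * c) ^ 5) = 0" "(\<Sum>j<3. (w ^ j * c) ^ 8) = 0"
  proof -
    have "(\<Sum>j<3. (w ^ j * c) ^ k) = (1 + w ^ k + (w ^ k)^2) * c ^ k" for k
      by (simp add: eval_nat_numeral lessThan_Suc power_mult_distrib algebra_simps)
    moreover have "w^5 = w^2" "w^8 = w^2" using w_cubed by algebra+
    moreover have "1 + w^2 + (w^2)^2 = 0" using w_root by algebra
    ultimately show "(\<Sum>j<3. (w ^ j * c) ^ 5) = 0" "(\<Sum>j<3. (w ^ j * c) ^ 8) = 0" by simp_all
  qed
  have "(\<Sum>j<3. appell (w ^ j * c) (q * z)) = (\<Sum>j<3. (1 - q^3 * z^6) - 2 * z^2 * (w ^ j * c) ^ 5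
      + 2 * z^4 * (w ^ j * c) ^ 8 - q^3 * z^6 * appell (w ^ j * c) z)"
    by (intro sum.cong refl) (simp add: one[OF refl])
  also have "\<dots> = 3 * (1 - q^3 * z^6) - 2 * z^2 * (\<Sum>j<3. (w ^ j * c) ^ 5) + 2 * z^4 * (\<Sum>j<3. (w ^ j * c) ^ 8)
      - q^3 * z^6 * (\<Sum>j<3. appell (w ^ j * c) z)"
    by (simp only: sum.distrib sum_subtractf sum_distrib_left [symmetric]) simp
  finally show ?thesis unfolding s appell_section_def by (simp add: field_simps)
qed

text \<open>Same inhomogeneous part and same multiplier as for the average, so that the difference
  of the two satisfies a homogeneous equation.\<close>

lemma appell_cube_mult:
  assumes z: "z \<noteq> 0" "\<And>n. z ^ 3 * (q ^ 3) powi n \<noteq> 1"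
  shows "appell (q^3) ((q * z)^3) = 1 - q^3 * z^6 - q^3 * z^6 * appell (q^3) (z^3)"
  using appell_mult[OF q3, of "z^3"] assms by (simp add: power_mult_distrib flip: power_mult)

text \<open>Chosen to cancel the pole of the average at 1 against the pole of
  \<open>theta_ratio q\<close>.\<close>

definition coeff1 :: complex where
  "coeff1 = 2 * rank_section 1 * theta_quot q 1 * theta_cof 1 q / theta_j (- 1) q"

text \<open>Chosen to cancel the poles of the Appell term in nome \<open>q^3\<close>. Both that term
  and \<open>theta_ratio (q^3)\<close> depend on \<open>z ^ 3\<close> only, so one constant settles
  all three cube roots of unity.\<close>

definition coeff2 :: complex where
  "coeff2 = - 2 * theta_quot q 1 * rank_series (q^3) 1 * theta_cof 1 (q^3) / theta_j (- 1) (q^3)"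

definition defect :: "complex \<Rightarrow> complex" where
  "defect z = (appell_section z - appell (q^3) (z^3)) * theta_quot q (z^3)
     - coeff1 * theta_ratio q z - coeff2 * theta_ratio (q^3) (z^3)"

lemma cube_annulus:
  assumes "z \<in> region"
  shows "norm (q^3) < norm (z^3)" "norm (z^3) * norm (q^3) < 1"
proof -
  note a = region_cubed[OF assms]
  then show "norm (q^3) < norm (z^3)" by (simp add: norm_power)
  have "norm q ^ 3 \<le> norm q" using q_less_1 q_pos by (metis less_imp_le one_le_numeral power_decreasing power_one_right)
  then have "norm z ^ 3 * norm q ^ 3 \<le> norm z ^ 3 * norm q" by (intro mult_left_mono) auto
  then show "norm (z^3) * norm (q^3) < 1" using a by (simp add: norm_power)
qed

lemma holomorphic_on_defect: "defect holomorphic_on region - poles"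
proof -
  have "(\<lambda>z. theta_ratio (q^3) (z^3)) holomorphic_on region - poles"
  proof -
    have "(\<lambda>z. z^3) ` (region - poles) \<subseteq> {z. norm (q^3) < norm z \<and> norm z * norm (q^3) < 1} - {1}"
      using cube_annulus by (auto simp: poles_def)
    from holomorphic_on_compose_gen[OF _ holomorphic_on_theta_ratio[OF q3] this]
    show ?thesis by (simp add: o_def holomorphic_on_power)
  qed
  moreover have "theta_ratio q holomorphic_on region - poles"
    by (rule holomorphic_on_subset[OF holomorphic_on_theta_ratio[OF q_pos q_less_1]])
       (use region_q in \<open>auto simp: poles_def\<close>)
  moreover have "appell_section holomorphic_on region - poles" unfolding appell_section_def [abs_def]
    by (intro holomorphic_intros w_c_nome region_not_pole) (auto dest: region_nonzero)
  moreover have "(\<lambda>z. appell (q^3) (z^3)) holomorphic_on region - poles"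
    by (intro holomorphic_intros q3 region_not_pole) (auto dest: region_nonzero)
  moreover have "(\<lambda>z. theta_quot q (z^3)) holomorphic_on region - poles"
    by (intro holomorphic_intros q_less_1) (auto dest: region_nonzero)
  ultimately show ?thesis unfolding defect_def [abs_def]
    by (intro holomorphic_on_mult holomorphic_on_diff holomorphic_on_const)
qed

text \<open>The multiplier \<open>- (q^3 * z^6)\<close> of the Appell difference meets
  \<open>1 / (q^3 * z^6)\<close> from \<open>theta_quot\<close>, leaving -1 as for the two theta
  ratios. Poles are avoided because \<open>z ^ 3\<close> is larger than 1 in norm and
  \<open>(q * z) ^ 3\<close> smaller than \<open>q ^ 2\<close>.\<close>

lemma defect_mult:
  assumes "1 < norm z" "norm z < 1 / norm c"
  shows "q * z \<in> region - poles" "z \<in> region - poles" "defect (q * z) = - defect z"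
proof -
  have zc: "norm z * norm c < 1" using assms c_pos by (simp add: field_simps)
  have z3: "norm z ^ 3 > 1" using assms by (simp add: one_less_power)
  have "(norm z * norm c) ^ 3 < 1" using zc by (simp add: power_less_one_iff)
  then have z3q: "norm z ^ 3 * norm q < 1" by (simp add: power_mult_distrib norm_c_cubed)
  show zB: "z \<in> region - poles"
  proof -
    have "z \<in> region" using assms q_less_1 by (auto simp: region_def)
    moreover have "\<not> norm (z^3) \<le> 1" using z3 by (simp add: norm_power)
    moreover have "norm x \<le> 1" if "x = 1 \<or> x = q \<or> x = q^2" for x
      using that q_less_1 by (auto simp: norm_power power_le_one)
    ultimately show ?thesis by (auto simp: poles_def)
  qed
  have z0: "z \<noteq> 0" using assms by auto
  show "q * z \<in> region - poles"
  proof -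
    have "norm q * norm z < 1 / norm c"
    proof -
      have "norm q * norm z < 1" using region_q[of z] zB by (simp add: mult.commute)
      also have "1 < 1 / norm c" using c_pos c_less_1 by simp
      finally show ?thesis .
    qed
    then have "q * z \<in> region" using assms q_pos by (simp add: region_def norm_mult)
    moreover have "norm ((q * z)^3) < norm (q^2)"
      using mult_strict_left_mono[OF z3q, of "norm q ^ 2"] q_pos
      by (simp add: norm_power norm_mult power_mult_distrib power2_eq_square power3_eq_cube mult_ac)
    moreover have "norm (q^2) \<le> norm x" if "x = 1 \<or> x = q \<or> x = q^2" for x
      using that q_less_1 by (auto simp: norm_mult power2_eq_square mult_left_le mult_le_one)
    ultimately show ?thesis by (force simp: poles_def)
  qed
  have m: "norm (z^3) * norm (q^3) < 1" "1 < norm (z^3)" using cube_annulus[of z] zB z3 by (auto simp: norm_power)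
  have a: "appell_section (q * z) - appell (q^3) ((q * z)^3) = - (q^3 * z^6) * (appell_section z - appell (q^3) (z^3))"
    unfolding appell_section_mult[OF z0 region_not_pole(1)[OF zB]] appell_cube_mult[OF z0 region_not_pole(2)[OF zB]]
    by (simp add: algebra_simps)
  have b: "theta_quot q ((q * z)^3) = theta_quot q (z^3) / (q^3 * z^6)"
    using theta_quot_mult[OF q_less_1 q_nonzero m(2,1)] by (simp add: power_mult_distrib flip: power_mult)
  have d: "theta_ratio (q^3) ((q * z)^3) = - theta_ratio (q^3) (z^3)"
    using theta_ratio_mult[OF q3(2), of "z^3"] q_nonzero z0 by (simp add: power_mult_distrib)
  show "defect (q * z) = - defect z"
    unfolding defect_def a b d theta_ratio_mult[OF q_less_1 q_nonzero z0] using z0 q_nonzero by simp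
qed

lemma appell_section_pole: "p \<noteq> 0 \<Longrightarrow> \<exists>l. ((\<lambda>z. (z - p) * appell_section z) \<longlongrightarrow> l) (at p)"
proof -
  assume p: "p \<noteq> 0"
  have "\<exists>l. ((\<lambda>z. (z - p) * lambert_sum UNIV (w ^ j * c) z) \<longlongrightarrow> l) (at p)" for j
    by (rule lambert_sum_simple_poles[OF w_c_nome p])
  then obtain l where l: "\<And>j. ((\<lambda>z. (z - p) * lambert_sum UNIV (w ^ j * c) z) \<longlongrightarrow> l j) (at p)" by metis
  have "((\<lambda>z. (\<Sum>j<3. (z - p) + 2 * z * ((z - p) * lambert_sum UNIV (w ^ j * c) z) / alt_theta (w ^ j * c)) / 3) \<longlongrightarrow>
      (\<Sum>j<3. (p - p) + 2 * p * l j / alt_theta (w ^ j * c)) / 3) (at p)"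
    by (intro tendsto_intros l alt_theta_product(2) w_c_nome) auto
  moreover have "(\<Sum>j<3. (z - p) + 2 * z * ((z - p) * lambert_sum UNIV (w ^ j * c) z) / alt_theta (w ^ j * c)) / 3
     = (z - p) * appell_section z" for z
    by (simp add: appell_section_def appell_def sum_distrib_left distrib_left mult_ac)
  ultimately show ?thesis by auto
qed

lemma section_not_pole:
  assumes "norm p = 1" "p \<noteq> 1"
  shows "p * (w ^ j * c) powi n \<noteq> 1"
  using annulus_not_power[OF w_c_nome, of j p n] assms c_less_1 norm_w_c by (cases "n = 0") auto

lemma isCont_appell_section:
  assumes "norm p = 1" "p \<noteq> 1"
  shows "isCont appell_section p"
proof -
  have "isCont (appell (w ^ j * c)) p" for j
  proof (rule isCont_of_holomorphic)
    show "open (lambert_domain UNIV (w ^ j * c))"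
      by (rule open_lambert_domain[OF w_c_nome])
    show "appell (w ^ j * c) holomorphic_on (lambert_domain UNIV (w ^ j * c))"
      by (intro holomorphic_on_appell[where f = "\<lambda>z. z"] w_c_nome) (auto intro: holomorphic_on_ident)
    show "p \<in> (lambert_domain UNIV (w ^ j * c))"
      using section_not_pole[OF assms] assms by auto
  qed
  then show ?thesis unfolding appell_section_def [abs_def] by (intro continuous_intros) auto
qed

lemma isCont_theta_ratio:
  assumes "norm q < norm p" "norm p * norm q < 1" "p \<noteq> 1"
  shows "isCont (theta_ratio q) p"
proof (rule isCont_of_holomorphic[OF holomorphic_on_theta_ratio[OF q_pos q_less_1]])
  show "open ({z. norm q < norm z \<and> norm z * norm q < 1} - {1})"
    by (intro open_Diff open_Collect_conj open_Collect_less continuous_intros closed_singleton)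
qed (use assms in auto)

lemma isCont_theta_quot_cube: "p \<noteq> 0 \<Longrightarrow> isCont (\<lambda>z. theta_quot q (z ^ 3)) p"
  by (rule isCont_of_holomorphic[of _ "- {0}"]) (intro holomorphic_intros q_less_1, auto)

lemma defect_split:
  "(z - p) * defect z = ((z - p) * appell_section z - (z - p) * appell (q^3) (z^3)) * theta_quot q (z^3)
     - coeff1 * ((z - p) * theta_ratio q z) - coeff2 * ((z - p) * theta_ratio (q^3) (z^3))"
  by (simp add: defect_def algebra_simps)

lemma defect_removable_root:
  assumes p: "p ^ 3 = 1"
  shows "((\<lambda>z. (z - p) * defect z) \<longlongrightarrow> 0) (at p)"
proof -
  have np: "norm p = 1" using power_eq_1_iff[OF p] by simp
  have p0: "p \<noteq> 0" using p by auto
  \<comment> \<open>Of the three cube roots of unity only 1 is a pole of the average and of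
    \<open>theta_ratio q\<close>; at the other two both are continuous and the limits are 0.\<close>
  define \<alpha> where "\<alpha> = (if p = 1 then - 2 * rank_section 1 else 0)"
  define \<beta> where "\<beta> = (if p = 1 then - (theta_j (- 1) q / theta_cof 1 q) else 0)"
  have T: "((\<lambda>z. (z - p) * appell_section z) \<longlongrightarrow> \<alpha>) (at p)"
  proof (cases "p = 1")
    case True
    have "((\<lambda>z. - ((\<Sum>j<3. (1 - z) * appell (w ^ j * c) z) / 3)) \<longlongrightarrow>
        - ((\<Sum>j<3. 2 * rank_series (w ^ j * c) 1) / 3)) (at 1)"
      by (intro tendsto_intros appell_residue_1 w_c_nome) auto
    moreover have "- ((\<Sum>j<3. (1 - z) * appell (w ^ j * c) z) / 3) = (z - 1) * appell_section z" for z
      unfolding sum_distrib_left [symmetric] by (simp add: appell_section_def field_simps)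
    ultimately show ?thesis using True by (simp add: \<alpha>_def rank_section_def sum_distrib_left [symmetric])
  next
    case False
    have "((\<lambda>z. (z - p) * appell_section z) \<longlongrightarrow> (p - p) * appell_section p) (at p)"
      using isCont_appell_section[OF np False] by (intro tendsto_intros) (simp add: isCont_def)
    then show ?thesis using False by (simp add: \<alpha>_def)
  qed
  have L: "((\<lambda>z. (z - p) * theta_ratio q z) \<longlongrightarrow> \<beta>) (at p)"
  proof (cases "p = 1")
    case True
    have "((\<lambda>z. - ((1 - z) * theta_ratio q z)) \<longlongrightarrow> - (theta_j (- 1) q / theta_cof 1 q)) (at 1)"
      by (intro tendsto_intros theta_ratio_residue_1 q_pos q_less_1)
    then show ?thesis using True by (simp add: \<beta>_def algebra_simps)
  next
    case False
    have "((\<lambda>z. (z - p) * theta_ratio q z) \<longlongrightarrow> (p - p) * theta_ratio q p) (at p)"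
      using isCont_theta_ratio[of p] np False q_less_1 by (intro tendsto_intros) (simp add: isCont_def)
    then show ?thesis using False by (simp add: \<beta>_def)
  qed
  have ne: "eventually (\<lambda>z. z ^ 3 \<noteq> 1) (at p)" by (rule tendsto_cube_quot(2)[OF p])
  \<comment> \<open>Transports a residue at \<open>y = 1\<close> to \<open>p\<close> along
    \<open>y = z ^ 3\<close>, at the cost of the factor \<open>- p / 3\<close>.\<close>
  have cube: "((\<lambda>z. (z - p) * f (z ^ 3)) \<longlongrightarrow> - p / 3 * l) (at p)"
    if "((\<lambda>y. (1 - y) * f y) \<longlongrightarrow> l) (at 1)" for f l
  proof -
    have "((\<lambda>z. (z - p) / (1 - z ^ 3) * ((1 - z ^ 3) * f (z ^ 3))) \<longlongrightarrow> - p / 3 * l) (at p)"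
      by (intro tendsto_mult tendsto_cube_quot(1)[OF p] tendsto_compose_cube[OF that p])
    moreover have "eventually (\<lambda>z. (z - p) / (1 - z ^ 3) * ((1 - z ^ 3) * f (z ^ 3)) = (z - p) * f (z ^ 3)) (at p)"
      using ne by eventually_elim simp
    ultimately show ?thesis by (rule Lim_transform_eventually)
  qed
  define \<mu> where "\<mu> = theta_j (- 1) (q^3) / theta_cof 1 (q^3)"
  have g: "((\<lambda>z. theta_quot q (z ^ 3)) \<longlongrightarrow> theta_quot q 1) (at p)"
    using isCont_theta_quot_cube[OF p0] p by (simp add: isCont_def)
  have "((\<lambda>z. ((z - p) * appell_section z - (z - p) * appell (q^3) (z^3)) * theta_quot q (z^3)
     - coeff1 * ((z - p) * theta_ratio q z) - coeff2 * ((z - p) * theta_ratio (q^3) (z^3))) \<longlongrightarrow>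
     (\<alpha> - (- p / 3 * (2 * rank_series (q^3) 1))) * theta_quot q 1 - coeff1 * \<beta> - coeff2 * (- p / 3 * \<mu>)) (at p)"
    unfolding \<mu>_def by (intro tendsto_intros T L g cube appell_residue_1 theta_ratio_residue_1 q3)
  moreover note defect_split[of _ p]
  moreover have "(\<alpha> - (- p / 3 * (2 * rank_series (q^3) 1))) * theta_quot q 1 - coeff1 * \<beta> - coeff2 * (- p / 3 * \<mu>) = 0"
  proof -
    have nz: "theta_cof 1 q \<noteq> 0" "theta_cof 1 (q^3) \<noteq> 0"
      using q3 q_pos q_less_1 by (simp_all add: theta_cof_1 qpoch_inf_nonzero)
    have e1: "coeff2 * \<mu> = - 2 * theta_quot q 1 * rank_series (q^3) 1"
      using nz theta_j_minus_1_nonzero[OF q3] by (simp add: coeff2_def \<mu>_def)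
    have e2: "coeff1 * \<beta> = \<alpha> * theta_quot q 1"
      using nz theta_j_minus_1_nonzero[OF q_pos q_less_1] by (simp add: coeff1_def \<alpha>_def \<beta>_def)
    have e3: "(\<alpha> - (- p / 3 * (2 * R))) * g - coeff1 * \<beta> - coeff2 * (- p / 3 * \<mu>) =
        \<alpha> * g - coeff1 * \<beta> + p / 3 * (coeff2 * \<mu> + 2 * g * R)" for R g
      by (simp add: algebra_simps)
    show ?thesis unfolding e3 unfolding e1 e2 by simp
  qed
  ultimately show ?thesis by (simp only:)
qed

text \<open>Only the average can be singular here, with a pole that is at most simple, and
  \<open>theta_quot\<close> vanishes at \<open>q\<close> and \<open>q ^ 2\<close>. All other terms
  are continuous at \<open>p\<close>.\<close>

lemma defect_removable_nonroot:
  assumes pB: "p \<in> region" and p: "p ^ 3 = q \<or> p ^ 3 = q ^ 2"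
  shows "((\<lambda>z. (z - p) * defect z) \<longlongrightarrow> 0) (at p)"
proof -
  have p0: "p \<noteq> 0" using region_nonzero[OF pB] .
  have p31: "p ^ 3 \<noteq> 1"
  proof
    assume "p ^ 3 = 1"
    then have "q = 1 \<or> q ^ 2 = 1" using p by auto
    then have "norm q = 1" using power_eq_1_iff[of q 2] by auto
    then show False using q_less_1 by simp
  qed
  then have p1: "p \<noteq> 1" by auto
  obtain l where l: "((\<lambda>z. (z - p) * appell_section z) \<longlongrightarrow> l) (at p)" using appell_section_pole[OF p0] by blast
  have g: "((\<lambda>z. theta_quot q (z ^ 3)) \<longlongrightarrow> 0) (at p)"
    using isCont_theta_quot_cube[OF p0] theta_quot_zero[OF q_less_1 q_nonzero p] by (simp add: isCont_def)
  have L: "(theta_ratio q \<longlongrightarrow> theta_ratio q p) (at p)"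
    using isCont_theta_ratio[of p] region_q[OF pB] p1 by (simp add: isCont_def)
  have np: "p ^ 3 * (q ^ 3) powi n \<noteq> 1" for n
    using annulus_not_power[OF q3 cube_annulus[OF pB], of n] p31 by (cases "n = 0") auto
  have A: "((\<lambda>z. appell (q^3) (z^3)) \<longlongrightarrow> appell (q^3) (p^3)) (at p)"
  proof -
    let ?D = "(lambert_domain UNIV (q^3))"
    have "appell (q^3) holomorphic_on ?D"
      by (intro holomorphic_on_appell[where f = "\<lambda>z. z"] q3) (auto intro: holomorphic_on_ident)
    then have "isCont (appell (q^3)) (p^3)"
      by (rule isCont_of_holomorphic) (use open_lambert_domain[OF q3, of UNIV] p0 np in auto)
    then show ?thesis by (rule isCont_tendsto_compose) (intro tendsto_intros)
  qed
  have M: "((\<lambda>z. theta_ratio (q^3) (z^3)) \<longlongrightarrow> theta_ratio (q^3) (p^3)) (at p)"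
  proof -
    have "open ({z. norm (q^3) < norm z \<and> norm z * norm (q^3) < 1} - {1})"
      by (intro open_Diff open_Collect_conj open_Collect_less continuous_intros closed_singleton)
    then have "isCont (theta_ratio (q^3)) (p^3)"
      by (rule isCont_of_holomorphic[OF holomorphic_on_theta_ratio[OF q3]]) (use cube_annulus[OF pB] p31 in auto)
    then show ?thesis by (rule isCont_tendsto_compose) (intro tendsto_intros)
  qed
  have "((\<lambda>z. ((z - p) * appell_section z - (z - p) * appell (q^3) (z^3)) * theta_quot q (z^3)
     - coeff1 * ((z - p) * theta_ratio q z) - coeff2 * ((z - p) * theta_ratio (q^3) (z^3))) \<longlongrightarrow>
     (l - (p - p) * appell (q^3) (p^3)) * 0 - coeff1 * ((p - p) * theta_ratio q p) - coeff2 * ((p - p) * theta_ratio (q^3) (p^3))) (at p)"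
    by (intro tendsto_intros l L g A M)
  moreover note defect_split[of _ p]
  ultimately show ?thesis by simp
qed

lemma defect_zero:
  assumes "z \<in> region - poles"
  shows "defect z = 0"
proof -
  have fin: "finite (poles \<inter> region)" using finite_poles by blast
  have BP: "region - poles \<inter> region = region - poles" by blast
  have "\<exists>g. g holomorphic_on region \<and> (\<forall>z\<in>region - poles \<inter> region. g z = defect z)"
  proof (rule holomorphic_extend_finite[OF fin _ open_region])
    show "poles \<inter> region \<subseteq> region" by blast
    show "defect holomorphic_on region - poles \<inter> region" unfolding BP by (rule holomorphic_on_defect)
    fix p assume "p \<in> poles \<inter> region"
    then show "((\<lambda>z. (z - p) * defect z) \<longlongrightarrow> 0) (at p)"
      using defect_removable_root defect_removable_nonroot by (auto simp: poles_def)
  qed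
  then obtain g where g: "g holomorphic_on region" "\<And>z. z \<in> region - poles \<Longrightarrow> g z = defect z" unfolding BP by blast
  have r: "1 < 1 / norm c" using c_pos c_less_1 by simp
  have m: "g (q * z) = - 1 * g z" if "1 < norm z" "norm z < 1 / norm c" for z
    using defect_mult[OF that] g(2) by simp
  have "g constant_on {z. norm q < norm z \<and> norm z < 1 / norm c}"
    by (rule annulus_multiplier_constant[where K = g and q = q and c = "-1"])
      (use g(1) q_pos q_less_1 r m in \<open>simp_all add: region_def\<close>)
  then obtain k where k: "\<And>z. z \<in> region \<Longrightarrow> g z = k" by (auto simp: constant_on_def region_def)
  \<comment> \<open>A point of the overlap, where the constant value \<open>k\<close> must equal its
    own negative.\<close>
  obtain x where x: "1 < x" "x < 1 / norm c" using dense[OF r] by blast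
  then have "1 < norm (of_real x :: complex)" "norm (of_real x :: complex) < 1 / norm c" by auto
  from defect_mult[OF this] m[OF this] have "k = - k" using k by auto
  then have "k = 0" by simp
  then show ?thesis using g(2)[OF assms] k assms by auto
qed

end

section \<open>Values at sixth roots of unity\<close>

lemma qpoch_inf_uminus:
  assumes "norm q < 1"
  shows "qpoch_inf (- q) q = qpoch_inf (q^2) (q^2) / qpoch_inf q q"
  using qpoch_inf_minus_mult[OF assms, of q] qpoch_inf_nonzero[OF assms assms]
  by (simp add: field_simps)

lemma J_nonzero: "norm q < 1 \<Longrightarrow> m > 0 \<Longrightarrow> J m q \<noteq> 0"
  unfolding J_def by (intro qpoch_inf_nonzero) (simp_all add: norm_power power_less_one_iff)

lemma J_power: "J m (q ^ k) = J (k * m) q"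
  by (simp add: J_def power_mult)

lemma J_cube: "J 1 (q^3) = J 3 q" "J 2 (q^3) = J 6 q"
  by (simp_all add: J_power)

lemma prod_lessThan_3: "(\<Prod>j<3. f j) = f 0 * f 1 * f (2::nat)"
  by (simp add: numeral_3_eq_3 numeral_2_eq_2)

lemma sum_lessThan_3: "(\<Sum>j<3. f j) = f 0 + f 1 + (f (2::nat) :: complex)"
  by (simp add: numeral_3_eq_3 numeral_2_eq_2)

lemma unit_annulus:
  assumes "norm z = 1" "0 < norm r" "norm r < 1"
  shows "norm r < norm z" "norm z < 1 / norm r"
  using assms by auto

lemma alt_theta_J:
  assumes "0 < norm q" "norm q < 1"
  shows "alt_theta q = J 1 q ^ 2 / J 2 q"
  using alt_theta_product(1)[OF assms] by (simp add: qpoch_inf_uminus[OF assms(2)] J_def power2_eq_square)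

lemma theta_cof_1_J: "theta_cof 1 q = J 1 q ^ 3"
  by (simp add: theta_cof_1 J_def)

lemma theta_cof_minus_1_J:
  assumes "norm q < 1"
  shows "theta_cof (- 1) q = J 2 q ^ 2 / J 1 q"
  using qpoch_inf_nonzero[OF assms assms] unfolding theta_cof_def
  by (simp add: qpoch_inf_uminus[OF assms] J_def power2_eq_square)

text \<open>Since 1 / w = w^2, the two products involving \<open>w\<close> are the missing
  conjugates of the product at \<open>q\<close> (respectively at \<open>- q\<close>), and the three
  together collapse to nome \<open>q^3\<close>.\<close>

lemma theta_cof_cube_root_J:
  assumes q: "norm q < 1" and w: "1 + w + w^2 = 0"
  shows "theta_cof w q = J 3 q" "theta_cof (- w) q = J 6 q * J 1 q ^ 2 / (J 3 q * J 2 q)"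
proof -
  have w3: "w ^ 3 = 1" using w by algebra
  then have "w \<noteq> 0" by auto
  then have inv: "1 / w = w^2" using w3 by (simp add: field_simps power2_eq_square power3_eq_cube)
  have e: "w * q = w * q" "q / w = w^2 * q" "(- w) * q = w * (- q)" "q / (- w) = w^2 * (- q)"
    using inv \<open>w \<noteq> 0\<close> by (simp_all add: eq_divide_eq divide_eq_eq)
  have J1: "J 1 q \<noteq> 0" "J 3 q \<noteq> 0" "J 2 q \<noteq> 0" using J_nonzero[OF q] by auto
  have a: "J 1 q * qpoch_inf (w * q) q * qpoch_inf (w^2 * q) q = J 3 q"
    using qpoch_inf_cube[OF q w, of q] by (simp add: J_def)
  show "theta_cof w q = J 3 q"
    unfolding theta_cof_def e(2) using a by (simp add: J_def mult_ac)
  have m: "qpoch_inf (- q) q = J 2 q / J 1 q" using qpoch_inf_uminus[OF q] by (simp add: J_def)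
  have m3: "qpoch_inf ((- q)^3) (q^3) = J 6 q / J 3 q"
    using qpoch_inf_uminus[OF norm_power3_less_1[OF q]] by (simp add: J_def flip: power_mult)
  have b: "qpoch_inf (- q) q * qpoch_inf (w * (- q)) q * qpoch_inf (w^2 * (- q)) q = J 6 q / J 3 q"
    using qpoch_inf_cube[OF q w, of "- q"] m3 by simp
  have "qpoch_inf (w * (- q)) q * qpoch_inf (w^2 * (- q)) q = J 6 q / J 3 q / (J 2 q / J 1 q)"
    using b J1 unfolding m by (simp add: field_simps)
  then have "theta_cof (- w) q = J 6 q / J 3 q / (J 2 q / J 1 q) * J 1 q"
    unfolding theta_cof_def e(3,4) by (simp add: J_def)
  then show "theta_cof (- w) q = J 6 q * J 1 q ^ 2 / (J 3 q * J 2 q)"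
    using J1 by (simp add: field_simps power2_eq_square)
qed

lemma theta_quot_J:
  assumes "0 < norm q" "norm q < 1"
  shows "theta_quot q 1 = J 1 q ^ 3 / J 3 q ^ 3"
    "theta_quot q (- 1) = J 2 q ^ 2 * J 3 q / (J 1 q * J 6 q ^ 2)"
proof -
  note q3 = norm_power3_less_1[OF assms(2)]
  have nz: "J 3 q \<noteq> 0" "J 6 q \<noteq> 0" using J_nonzero[OF assms(2)] by auto
  show "theta_quot q 1 = J 1 q ^ 3 / J 3 q ^ 3"
    using theta_cof_quot[OF assms(2), of 1] nz by (simp add: theta_cof_1_J J_power)
  show "theta_quot q (- 1) = J 2 q ^ 2 * J 3 q / (J 1 q * J 6 q ^ 2)"
    using theta_cof_quot[OF assms(2), of "-1"] nz
      J_nonzero[OF assms(2), of 1]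
    by (simp add: theta_cof_minus_1_J[OF assms(2)] theta_cof_minus_1_J[OF q3] J_power field_simps)
qed

text \<open>All products are written through the residue classes \<open>F k\<close> of exponents
  modulo 6; the left side is F 1 * F 5 * F 6.\<close>

lemma JJ_1_6:
  assumes "norm q < 1"
  shows "JJ 1 6 q = J 1 q * J 6 q ^ 2 / (J 2 q * J 3 q)"
proof -
  define F where "F = (\<lambda>k. qpoch_inf (q ^ k) (q ^ 6))"
  have nz: "J 3 q \<noteq> 0" "J 2 q \<noteq> 0" using J_nonzero[OF assms] by auto
  have "norm (q^2) < 1" "norm (q^3) < 1" using assms by (simp_all add: norm_power power_less_one_iff)
  then have s: "J 1 q = F 1 * F 2 * F 3 * F 4 * F 5 * F 6" "J 2 q = F 2 * F 4 * F 6" "J 3 q = F 3 * F 6" "J 6 q = F 6"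
    using qpoch_inf_split[OF assms, of 6 q] qpoch_inf_split[of "q^2" 3 "q^2"] qpoch_inf_split[of "q^3" 2 "q^3"]
    by (simp_all add: J_def F_def eval_nat_numeral lessThan_Suc mult_ac)
  have "JJ 1 6 q = F 1 * F 5 * F 6"
  proof (cases "q = 0")
    case True
    then show ?thesis by (simp add: JJ_def theta_j_def F_def)
  next
    case False
    then have "q ^ 6 / q ^ 1 = q ^ 5" by (simp add: field_simps eval_nat_numeral)
    then show ?thesis by (simp add: JJ_def theta_j_def F_def)
  qed
  then show ?thesis using nz unfolding s by (simp add: field_simps power2_eq_square)
qed

lemma JJ_3_6:
  assumes "norm q < 1" "q \<noteq> 0"
  shows "JJ 3 6 q = J 3 q ^ 2 / J 6 q"
proof -
  have n3: "norm (q^3) < 1" using assms by (simp_all add: norm_power power_less_one_iff)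
  have nz: "J 6 q \<noteq> 0" using J_nonzero[OF assms(1)] by auto
  have "J 3 q = qpoch_inf (q^3) (q^6) * J 6 q"
    using qpoch_inf_split[OF n3, of 2 "q^3"] by (simp add: J_def eval_nat_numeral lessThan_Suc mult_ac)
  moreover have "q ^ 6 / q ^ 3 = q ^ 3" using assms by (simp add: field_simps eval_nat_numeral)
  then have "JJ 3 6 q = qpoch_inf (q^3) (q^6) ^ 2 * J 6 q" by (simp add: JJ_def theta_j_def J_def power2_eq_square)
  ultimately show ?thesis using nz by (simp add: field_simps power2_eq_square)
qed

section \<open>The section identity at sixth roots of unity\<close>

context cubic_section
begin

lemma norm_1_in_region: "norm z = 1 \<Longrightarrow> z ^ 3 \<noteq> 1 \<Longrightarrow> z \<in> region - poles"
proof -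
  assume z: "norm z = 1" "z ^ 3 \<noteq> 1"
  have "1 < 1 / norm c" using c_pos c_less_1 by simp
  then have "z \<in> region" using z q_less_1 by (simp add: region_def)
  moreover have "norm (z ^ 3) = 1" using z by (simp add: norm_power)
  moreover have "norm (q ^ 2) < 1" using q_less_1 by (simp add: norm_power power_less_one_iff)
  ultimately have "z ^ 3 \<noteq> q" "z ^ 3 \<noteq> q ^ 2" "z \<in> region" using q_less_1 by auto
  then show ?thesis using z by (auto simp: poles_def)
qed

lemma section_identity:
  assumes "z \<in> region - poles"
  shows "(appell_section z - appell (q^3) (z^3)) * theta_quot q (z^3) =
    coeff1 * theta_ratio q z + coeff2 * theta_ratio (q^3) (z^3)"
proof -
  have "A - coeff1 * x - coeff2 * y = 0 \<Longrightarrow> A = coeff1 * x + coeff2 * y" for A x y by (simp add: algebra_simps)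
  then show ?thesis using defect_zero[OF assms] unfolding defect_def by blast
qed

lemma rank_section_appell:
  assumes "norm c < norm z" "norm z < 1 / norm c" "z \<noteq> 1"
  shows "(1 + z) * rank_section z = (1 - z) * appell_section z"
proof -
  have "(1 + z) * rank_series (w ^ j * c) z = (1 - z) * appell (w ^ j * c) z" for j
    by (intro rank_series_appell w_c_nome) (simp_all only: norm_w_c assms not_False_eq_True)
  then have "(\<Sum>j<3. (1 + z) * rank_series (w ^ j * c) z) = (\<Sum>j<3. (1 - z) * appell (w ^ j * c) z)" by simp
  then show ?thesis by (simp add: rank_section_def appell_section_def flip: sum_distrib_left)
qed

lemma coeff_J:
  "coeff1 = rank_section 1 * (J 1 q ^ 7 / (J 3 q ^ 3 * J 2 q ^ 2))"
  "coeff2 = - (J 1 q ^ 3 / (J 3 q * J 6 q))"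
proof -
  define j1 j2 j3 j6 where d: "j1 = J 1 q" "j2 = J 2 q" "j3 = J 3 q" "j6 = J 6 q"
  have nz: "j1 \<noteq> 0" "j2 \<noteq> 0" "j3 \<noteq> 0" "j6 \<noteq> 0" using J_nonzero[OF q_less_1] by (auto simp: d)
  note J_atoms = J_cube d[symmetric]
  have e: "theta_j (- 1) q = 2 * (J 2 q ^ 2 / J 1 q)" "theta_j (- 1) (q^3) = 2 * (J 6 q ^ 2 / J 3 q)"
    by (simp_all add: theta_j_conv_cof[OF q_less_1] theta_cof_minus_1_J[OF q_less_1]
        theta_j_conv_cof[OF q3(2)] theta_cof_minus_1_J[OF q3(2)] J_power)
  show "coeff1 = rank_section 1 * (J 1 q ^ 7 / (J 3 q ^ 3 * J 2 q ^ 2))"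
    unfolding coeff1_def e theta_cof_1_J theta_quot_J[OF q_pos q_less_1] J_atoms using nz
    by (simp add: field_simps eval_nat_numeral)
  have r: "rank_series (q^3) 1 = J 6 q / J 3 q ^ 2"
    using alt_theta_product(3)[OF q3] alt_theta_J[OF q3] by (simp add: J_power)
  show "coeff2 = - (J 1 q ^ 3 / (J 3 q * J 6 q))"
    unfolding coeff2_def e r theta_cof_1_J theta_quot_J[OF q_pos q_less_1] J_atoms using nz
    by (simp add: field_simps eval_nat_numeral)
qed

text \<open>With \<open>x ^ 3 = q\<close>, sorting exponents modulo 3 gives (x; x) = (x; q) (x^2; q)
  (q; q). Over the three cube roots, the first two factors multiply to (q; q^3) and (q^2; q^3),
  which together are \<open>J 1 q / J 3 q\<close>.\<close>

lemma prod_qpoch_inf_cube_roots: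
  "(\<Prod>j<3. qpoch_inf (w ^ j * c) (w ^ j * c)) = J 1 q ^ 4 / J 3 q"
proof -
  have s: "qpoch_inf (w ^ j * c) (w ^ j * c) = qpoch_inf (w ^ j * c) q * qpoch_inf ((w ^ j * c)^2) q * qpoch_inf q q" for j
    using qpoch_inf_split3[OF w_c_nome(2)[of j], of "w ^ j * c"] w_c_cubed[of j]
    by (simp add: power2_eq_square power3_eq_cube mult_ac)
  have "(\<Prod>j<3. qpoch_inf (w ^ j * c) q) = qpoch_inf q (q^3)"
    using qpoch_inf_cube[OF q_less_1 w_root, of c] by (simp add: prod_lessThan_3 c_cubed)
  moreover have "(\<Prod>j<3. qpoch_inf ((w ^ j * c)^2) q) = qpoch_inf (q^2) (q^3)"
  proof -
    have "(\<Prod>j<3. qpoch_inf ((w ^ j * c)^2) q) = qpoch_inf (c^2) q * qpoch_inf (w^2 * c^2) q * qpoch_inf (w^4 * c^2) q"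
      by (simp add: prod_lessThan_3 power_mult_distrib flip: power_mult)
    moreover have "w^4 = w" using w_cubed by (simp add: eval_nat_numeral)
    moreover have "(c^2)^3 = q^2" by (simp flip: power_mult c_cubed)
    ultimately show ?thesis using qpoch_inf_cube[OF q_less_1 w_root, of "c^2"] by (simp add: mult_ac)
  qed
  moreover have "J 1 q = qpoch_inf q (q^3) * qpoch_inf (q^2) (q^3) * J 3 q"
    using qpoch_inf_split3[OF q_less_1, of q] by (simp add: J_def power2_eq_square power3_eq_cube mult.assoc)
  ultimately have "(\<Prod>j<3. qpoch_inf (w ^ j * c) (w ^ j * c)) * J 3 q = J 1 q * J 1 q ^ 3"
    unfolding s prod.distrib by (simp add: J_def)
  then show ?thesis using J_nonzero[OF q_less_1, of 3] by (simp add: field_simps eval_nat_numeral)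
qed

text \<open>A square is 0 or 1 modulo 3. Multiples of 3 give the theta series in nome
  \<open>q^3\<close>; all other indices give one power of the nome times a function of
  \<open>q\<close>, up to whole powers of \<open>q\<close>, so the choice of cube root enters only
  through \<open>w ^ j\<close>.\<close>

lemma alt_theta_dissection:
  "\<exists>b. \<forall>j. alt_theta (w ^ j * c) = alt_theta (q^3) + w ^ j * b"
proof -
  define s where "s = (\<lambda>n::int. (-1::complex) powi n)"
  have c0: "c \<noteq> 0" using c_pos by auto
  have s3: "s (3 * m) = s m" "s (3 * m + 1) = - s m" "s (3 * m + 2) = s m" for m
    by (simp_all add: s_def power_int_minus_left)
  define b where "b = (\<Sum>\<^sub>\<infinity>m::int. - s m * c * q powi (3 * m^2 + 2 * m)) + (\<Sum>\<^sub>\<infinity>m::int. s m * c^4 * q powi (3 * m^2 + 4 * m))"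
  have "alt_theta (w ^ j * c) = alt_theta (q^3) + w ^ j * b" for j
  proof -
    define x where "x = w ^ j * c"
    have x0: "x \<noteq> 0" using c0 w_nonzero by (simp add: x_def)
    have xq: "x powi (3 * k) = q powi k" for k
      using w_c_cubed[of j] by (simp add: x_def power_int_mult)
    define f where "f = (\<lambda>n::int. s n * x powi n^2)"
    have f: "f summable_on A" for A
      using summable_on_int_quadratic_weighted[OF w_c_nome[of j], where c = s and C = 1 and b = 0 and A = A] by (simp add: f_def s_def x_def)
    have U: "(UNIV :: int set) = (range (\<lambda>m. 3 * m) \<union> range (\<lambda>m. 3 * m + 1)) \<union> range (\<lambda>m. 3 * m + 2)"
    proof -
      have "n \<in> (range (\<lambda>m. 3 * m) \<union> range (\<lambda>m. 3 * m + 1)) \<union> range (\<lambda>m. 3 * m + 2)" for n :: int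
      proof -
        have "\<exists>k. n = 3 * k \<or> n = 3 * k + 1 \<or> n = 3 * k + 2" by presburger
        then obtain k where "n = 3 * k \<or> n = 3 * k + 1 \<or> n = 3 * k + 2" ..
        then show ?thesis by auto
      qed
      then show ?thesis by (rule UNIV_eq_I)
    qed
    have "infsum f UNIV = infsum f (range (\<lambda>m. 3 * m)) + infsum f (range (\<lambda>m. 3 * m + 1)) + infsum f (range (\<lambda>m. 3 * m + 2))"
    proof -
      have "range (\<lambda>m::int. 3 * m) \<inter> range (\<lambda>m. 3 * m + 1) = {}"
        "(range (\<lambda>m::int. 3 * m) \<union> range (\<lambda>m. 3 * m + 1)) \<inter> range (\<lambda>m. 3 * m + 2) = {}" by (auto, presburger+)
      then show ?thesis by (simp add: arg_cong[OF U, of "infsum f"] infsum_Un_disjoint f)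
    qed
    also have "infsum f (range (\<lambda>m. 3 * m)) = alt_theta (q^3)"
    proof -
      have "infsum f (range (\<lambda>m. 3 * m)) = infsum (f \<circ> (\<lambda>m. 3 * m)) UNIV"
        by (rule infsum_reindex) (simp add: inj_on_def)
      also have "\<dots> = alt_theta (q^3)"
        unfolding alt_theta_def
      proof (rule infsum_cong)
        fix m :: int
        have "(3 * m)^2 = 3 * (3 * m^2)" by (simp add: power2_eq_square)
        then have "x powi (3 * m)^2 = q powi (3 * m^2)" by (simp only: xq)
        also have "\<dots> = (q^3) powi m^2" by (simp add: power_int_mult)
        finally show "(f \<circ> (\<lambda>m. 3 * m)) m = (-1) powi m * (q^3) powi m^2"
          by (simp add: f_def s3) (simp add: s_def)
      qed
      finally show ?thesis .
    qed
    also have "infsum f (range (\<lambda>m. 3 * m + 1)) = w ^ j * (\<Sum>\<^sub>\<infinity>m::int. - s m * c * q powi (3 * m^2 + 2 * m))"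
    proof -
      have "infsum f (range (\<lambda>m. 3 * m + 1)) = infsum (f \<circ> (\<lambda>m. 3 * m + 1)) UNIV"
        by (rule infsum_reindex) (simp add: inj_on_def)
      also have "\<dots> = (\<Sum>\<^sub>\<infinity>m::int. w ^ j * (- s m * c * q powi (3 * m^2 + 2 * m)))"
      proof (rule infsum_cong)
        fix m :: int
        have "(3 * m + 1)^2 = 3 * (3 * m^2 + 2 * m) + 1" by (simp add: power2_eq_square algebra_simps)
        then have "x powi (3 * m + 1)^2 = x powi (3 * (3 * m^2 + 2 * m)) * x"
          using x0 by (metis power_int_add_1)
        then have e: "x powi (3 * m + 1)^2 = q powi (3 * m^2 + 2 * m) * (w ^ j * c)"
          unfolding xq by (simp only: x_def)
        show "(f \<circ> (\<lambda>m. 3 * m + 1)) m = w ^ j * (- s m * c * q powi (3 * m^2 + 2 * m))"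
          unfolding o_def f_def s3 e by simp
      qed
      finally show ?thesis by (simp only: infsum_cmult_right')
    qed
    also have "infsum f (range (\<lambda>m. 3 * m + 2)) = w ^ j * (\<Sum>\<^sub>\<infinity>m::int. s m * c^4 * q powi (3 * m^2 + 4 * m))"
    proof -
      have "infsum f (range (\<lambda>m. 3 * m + 2)) = infsum (f \<circ> (\<lambda>m. 3 * m + 2)) UNIV"
        by (rule infsum_reindex) (simp add: inj_on_def)
      also have "\<dots> = (\<Sum>\<^sub>\<infinity>m::int. w ^ j * (s m * c^4 * q powi (3 * m^2 + 4 * m)))"
      proof (rule infsum_cong)
        fix m :: int
        have "(3 * m + 2)^2 = 3 * (3 * m^2 + 4 * m) + 4" by (simp add: power2_eq_square algebra_simps)
        then have e: "x powi (3 * m + 2)^2 = q powi (3 * m^2 + 4 * m) * x ^ 4"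
          using x0 power_int_add[of x "3 * (3 * m^2 + 4 * m)" 4] by (simp only: xq simp_thms) simp
        have "x ^ 4 = (w ^ 4) ^ j * c ^ 4" by (simp add: x_def power_mult_distrib power_mult [symmetric] mult.commute[of j])
        moreover have "w ^ 4 = w" using w_cubed by (simp add: eval_nat_numeral)
        ultimately show "(f \<circ> (\<lambda>m. 3 * m + 2)) m = w ^ j * (s m * c^4 * q powi (3 * m^2 + 4 * m))"
          unfolding o_def f_def s3 e by simp
      qed
      finally show ?thesis by (simp only: infsum_cmult_right')
    qed
    finally have "infsum f UNIV = alt_theta (q^3) + w ^ j * b" by (simp add: b_def distrib_left)
    then show ?thesis by (simp add: alt_theta_def f_def s_def x_def)
  qed
  then show ?thesis by blast
qed

text \<open>At 1 this is the mean of the reciprocals of a + w^j b. Their pairwise products sum to 3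
  a^2, the mixed terms cancelling because 1 + w + w^2 = 0, so the mean is a^2 divided by the product
  of the three values.\<close>

lemma rank_section_1: "rank_section 1 = J 2 q ^ 4 * J 3 q ^ 6 / (J 1 q ^ 8 * J 6 q ^ 3)"
proof -
  define j1 j2 j3 j6 where d: "j1 = J 1 q" "j2 = J 2 q" "j3 = J 3 q" "j6 = J 6 q"
  have nz: "j1 \<noteq> 0" "j2 \<noteq> 0" "j3 \<noteq> 0" "j6 \<noteq> 0" using J_nonzero[OF q_less_1] by (auto simp: d)
  note J_atoms = J_cube d[symmetric]
  obtain b where b: "\<And>j. alt_theta (w ^ j * c) = alt_theta (q^3) + w ^ j * b"
    using alt_theta_dissection by blast
  define a where "a = alt_theta (q^3)"
  define x where "x = (\<lambda>j. alt_theta (w ^ j * c))"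
  have x0: "x j \<noteq> 0" for j unfolding x_def by (rule alt_theta_product(2)[OF w_c_nome])
  have e: "x 0 = a + b" "x 1 = a + w * b" "x 2 = a + w^2 * b" using b by (simp_all add: x_def a_def)
  have "x 1 * x 2 + x 0 * x 2 + x 0 * x 1 = 3 * a^2" unfolding e using w_root by algebra
  then have s: "(1 / x 0 + 1 / x 1 + 1 / x 2) / 3 = a^2 / (x 0 * x 1 * x 2)"
    using x0[of 0] x0[of 1] x0[of 2] by (simp add: field_simps)
  have "rank_section 1 = (1 / x 0 + 1 / x 1 + 1 / x 2) / 3"
    unfolding rank_section_def sum_lessThan_3 alt_theta_product(3)[OF w_c_nome] x_def ..
  also note s
  also have "x 0 * x 1 * x 2 = (\<Prod>j<3. x j)" by (simp only: prod_lessThan_3)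
  also have "\<dots> = (\<Prod>j<3. qpoch_inf (w ^ j * c) (w ^ j * c)) ^ 2 / (\<Prod>j<3. qpoch_inf ((w ^ j * c)^2) ((w ^ j * c)^2))"
  proof -
    have "x j = qpoch_inf (w ^ j * c) (w ^ j * c) ^ 2 / qpoch_inf ((w ^ j * c)^2) ((w ^ j * c)^2)" for j
      unfolding x_def alt_theta_J[OF w_c_nome] J_def by simp
    then show ?thesis by (simp add: prod_dividef prod_power_distrib)
  qed
  also have "(\<Prod>j<3. qpoch_inf ((w ^ j * c)^2) ((w ^ j * c)^2)) = J 2 q ^ 4 / J 6 q"
  proof -
    \<comment> \<open>The denominators involve the squared nomes, which are the three cube roots of
      \<open>q^2\<close>.\<close>
    interpret sq: cubic_section "q^2" "c^2" "w^2"
    proof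
      show "1 + w^2 + (w^2)^2 = 0" using w_root by algebra
      show "(c^2)^3 = q^2" by (simp flip: power_mult c_cubed)
    qed (use q_pos q_less_1 in \<open>simp_all add: norm_power power_less_one_iff\<close>)
    have "(w ^ j * c)^2 = (w^2) ^ j * c^2" for j by (simp add: power_mult_distrib mult.commute flip: power_mult)
    then show ?thesis using sq.prod_qpoch_inf_cube_roots by (simp add: J_power)
  qed
  also note prod_qpoch_inf_cube_roots
  also have "a = J 3 q ^ 2 / J 6 q" unfolding a_def alt_theta_J[OF q3] by (simp add: J_power)
  finally show ?thesis unfolding J_atoms using nz by (simp add: field_simps eval_nat_numeral)
qed

lemma one_plus_w: "1 + w \<noteq> 0" "1 - w \<noteq> 0"
  using w_root w_nonzero w_neq_1 by (auto simp: power2_eq_square)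

text \<open>The cube of \<open>- w\<close> is -1, where both functions in nome \<open>q^3\<close>
  vanish; only the \<open>coeff1\<close> term survives.\<close>

lemma rank_section_minus_root: "rank_section (- w) = J 2 q * J 3 q ^ 4 / (J 1 q ^ 2 * J 6 q ^ 2)"
proof -
  define j1 j2 j3 j6 where d: "j1 = J 1 q" "j2 = J 2 q" "j3 = J 3 q" "j6 = J 6 q"
  have nz: "j1 \<noteq> 0" "j2 \<noteq> 0" "j3 \<noteq> 0" "j6 \<noteq> 0" using J_nonzero[OF q_less_1] by (auto simp: d)
  note J_atoms = J_cube d[symmetric]
  have w3: "(- w) ^ 3 = - 1" using w_cubed by simp
  have nw: "norm (- w) = 1" using norm_w by simp
  have "- w \<in> region - poles" using nw w3 by (intro norm_1_in_region) auto
  note id = section_identity[OF this, unfolded w3]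
  have "appell (q^3) (- 1) = 0"
    using rank_series_appell[OF q3 unit_annulus[OF _ q3], of "-1"] by simp
  moreover have "theta_ratio (q^3) (- 1) = 0"
    by (simp add: theta_ratio_conv_cof[OF q3(2)])
  ultimately have A: "appell_section (- w) * theta_quot q (- 1) = coeff1 * theta_ratio q (- w)" using id by simp
  have m1: "- w \<noteq> 1" using w3 by (metis one_neq_neg_one power_one)
  have "(1 - w) * rank_section (- w) = (1 + w) * appell_section (- w)"
    using rank_section_appell[OF unit_annulus[OF nw c_pos c_less_1] m1] by simp
  then have "(1 - w) * (rank_section (- w) * theta_quot q (- 1)) = (1 + w) * (appell_section (- w) * theta_quot q (- 1))"
    by (metis mult.assoc)
  also have "\<dots> = (1 - w) * (coeff1 * theta_cof w q / theta_cof (- w) q)"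
    unfolding A theta_ratio_conv_cof[OF q_less_1] using one_plus_w by simp
  finally have "rank_section (- w) * theta_quot q (- 1) = coeff1 * theta_cof w q / theta_cof (- w) q"
    by (simp only: mult_left_cancel[OF one_plus_w(2)])
  then show ?thesis
    unfolding theta_quot_J[OF q_pos q_less_1] theta_cof_cube_root_J[OF q_less_1 w_root] coeff_J rank_section_1 J_atoms
    using nz by (simp add: field_simps eval_nat_numeral)
qed

text \<open>Near \<open>w\<close>, the function \<open>M\<close> below depends on \<open>z ^ 3\<close> only, and it is odd under
  \<open>z \<mapsto> 1 / z\<close>; since \<open>1 / w = w * w\<close>, it vanishes at \<open>w\<close>.\<close>
lemma rank_section_root: "rank_section w = J 2 q * J 3 q ^ 4 / (J 1 q ^ 2 * J 6 q ^ 2)"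
proof -
  define j1 j2 j3 j6 where d: "j1 = J 1 q" "j2 = J 2 q" "j3 = J 3 q" "j6 = J 6 q"
  have nz: "j1 \<noteq> 0" "j2 \<noteq> 0" "j3 \<noteq> 0" "j6 \<noteq> 0" using J_nonzero[OF q_less_1] by (auto simp: d)
  note J_atoms = J_cube d[symmetric]
  define M where "M = (\<lambda>z. appell_section z * theta_quot q (z^3) - coeff1 * theta_ratio q z)"
  have M: "M z = appell (q^3) (z^3) * theta_quot q (z^3) + coeff2 * theta_ratio (q^3) (z^3)" if "z \<in> region - poles" for z
  proof -
    have "T * g - coeff1 * x = a * g + coeff2 * y" if "(T - a) * g = coeff1 * x + coeff2 * y" for T g x a y
      using that by (simp add: algebra_simps)
    from this[OF section_identity[OF that]] show ?thesis by (simp add: M_def)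
  qed
  have Mw: "M (w * z) = M z" if "z \<in> region - poles" for z
  proof -
    have wz: "(w * z) ^ 3 = z ^ 3" by (simp add: power_mult_distrib w_cubed)
    have "w * z \<in> region - poles" using that norm_w by (simp add: region_def poles_def wz norm_mult)
    then show ?thesis using M[OF that] M[of "w * z"] wz by simp
  qed
  have w2: "norm (w * w) = 1" "w * w \<noteq> 1" "(w * w)^3 = 1"
    using norm_w w_cubed w_neq_1 by (auto simp: norm_mult power3_eq_cube power_mult_distrib) 
      (metis mult.assoc mult_1 mult.right_neutral)
  have contM: "isCont M z" if "norm z = 1" "z \<noteq> 1" "z \<noteq> 0" for z
    unfolding M_def using that q_less_1
    by (intro continuous_intros isCont_appell_section isCont_theta_ratio isCont_theta_quot_cube) auto
  \<comment> \<open>The invariance of \<open>M\<close> is known only off \<open>poles\<close>, and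
    \<open>w\<close> is one of them. \<open>M\<close> itself is continuous at \<open>w\<close> and
    at \<open>w * w\<close>, so the equality passes to the limit.\<close>
  have "M (w * w) = M w"
  proof -
    have "((\<lambda>z. M (w * z)) \<longlongrightarrow> M (w * w)) (at w)"
      by (rule isCont_tendsto_compose[OF contM]) (use w2 w_nonzero in \<open>auto intro!: tendsto_intros\<close>)
    moreover have "(M \<longlongrightarrow> M w) (at w)" using contM[of w] norm_w w_neq_1 w_nonzero by (simp add: isCont_def)
    moreover have "eventually (\<lambda>z. M (w * z) = M z) (at w)"
    proof -
      have "w \<in> region - (poles - {w})" using norm_w q_less_1 c_pos c_less_1 by (simp add: region_def)
      moreover have "open (region - (poles - {w}))" using finite_poles open_region by (simp add: finite_imp_closed open_Diff)
      ultimately have "eventually (\<lambda>z. z \<in> (region - (poles - {w})) - {w}) (at w)" by (intro eventually_at_in_open)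
      then show ?thesis by eventually_elim (use Mw in auto)
    qed
    ultimately show ?thesis using tendsto_unique[OF trivial_limit_at] Lim_transform_eventually by metis
  qed
  moreover have "M (1 / w) = - M w"
  proof -
    have "appell (w ^ j * c) (1 / w) = - appell (w ^ j * c) w" for j
      by (intro appell_inverse w_c_nome w_nonzero section_not_pole norm_w w_neq_1)
    then have "appell_section (1 / w) = - appell_section w" by (simp add: appell_section_def sum_negf)
    moreover have "theta_quot q ((1 / w) ^ 3) = theta_quot q (w ^ 3)"
      using w_cubed by (simp add: power_divide)
    ultimately show ?thesis by (simp add: M_def theta_ratio_inverse[OF q_less_1 w_nonzero])
  qed
  moreover have "1 / w = w * w" using w_cubed w_nonzero by (simp add: field_simps power3_eq_cube)
  ultimately have "M w = 0" by simp
  then have A: "appell_section w * theta_quot q 1 = coeff1 * theta_ratio q w" using w_cubed by (simp add: M_def)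
  have "(1 + w) * rank_section w = (1 - w) * appell_section w"
    by (rule rank_section_appell[OF unit_annulus[OF norm_w c_pos c_less_1] w_neq_1])
  then have "(1 + w) * (rank_section w * theta_quot q 1) = (1 - w) * (appell_section w * theta_quot q 1)"
    by (metis mult.assoc)
  also have "\<dots> = (1 + w) * (coeff1 * theta_cof (- w) q / theta_cof w q)"
    unfolding A theta_ratio_conv_cof[OF q_less_1] using one_plus_w by simp
  finally have "rank_section w * theta_quot q 1 = coeff1 * theta_cof (- w) q / theta_cof w q"
    by (simp only: mult_left_cancel[OF one_plus_w(1)])
  then show ?thesis
    unfolding theta_quot_J[OF q_pos q_less_1] theta_cof_cube_root_J[OF q_less_1 w_root] coeff_J rank_section_1 J_atoms
    using nz by (simp add: field_simps eval_nat_numeral)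
qed

text \<open>Every term of the section identity vanishes at -1, so it carries no information there
  directly. It is rewritten in terms of rank series, which exposes a common factor
  \<open>1 + z\<close>; after cancelling it, both sides are continuous at -1.\<close>

lemma rank_section_minus_1:
  "rank_section (- 1) = 3 * rank_series (q^3) (- 1) - 2 * J 1 q ^ 4 * J 3 q ^ 2 / (J 2 q ^ 2 * J 6 q)"
proof -
  define j1 j2 j3 j6 where d: "j1 = J 1 q" "j2 = J 2 q" "j3 = J 3 q" "j6 = J 6 q"
  have nz: "j1 \<noteq> 0" "j2 \<noteq> 0" "j3 \<noteq> 0" "j6 \<noteq> 0" using J_nonzero[OF q_less_1] by (auto simp: d)
  note J_atoms = J_cube d[symmetric]
  \<comment> \<open>The ratio of (1 + z^3) / (1 - z^3) to (1 + z) / (1 - z), the prefactors in nome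
    \<open>q^3\<close> and in the average. Its value 3 at -1 is the coefficient of
    \<open>rank_series (q^3) (- 1)\<close>.\<close>
  define \<rho> where "\<rho> = (\<lambda>z::complex. (1 - z + z^2) / (1 + z + z^2))"
  define g where "g = (\<lambda>z. theta_quot q (z^3))"
  define lhs where "lhs = (\<lambda>z. rank_section z * g z)"
  define rhs where "rhs = (\<lambda>z. \<rho> z * rank_series (q^3) (z^3) * g z + coeff1 * (theta_cof (- z) q / theta_cof z q)
      + coeff2 * (\<rho> z * (theta_cof (- (z^3)) (q^3) / theta_cof (z^3) (q^3))))"
  define S where "S = {z. norm c < norm z \<and> norm z < 1 / norm c} \<inter> (region - poles)"
  have key: "lhs z = rhs z" if z: "z \<in> S - {-1}" for z
  proof -
    have zB: "z \<in> region - poles" using z by (simp add: S_def)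
    have z3: "z ^ 3 \<noteq> 1" using zB by (auto simp: poles_def)
    then have z1: "z \<noteq> 1" by auto
    have nz3: "1 + z \<noteq> 0" using z by (auto simp: add_eq_0_iff)
    have f3: "1 - z^3 = (1 - z) * (1 + z + z^2)" "1 + z^3 = (1 + z) * (1 - z + z^2)"
      by (simp_all add: algebra_simps power2_eq_square power3_eq_cube)
    have d: "1 + z + z^2 \<noteq> 0" "1 - z \<noteq> 0" using f3 z3 by auto
    have R: "(1 + z) * rank_section z = (1 - z) * appell_section z"
      using z by (intro rank_section_appell z1) (auto simp: S_def)
    have "norm (z^3) < 1 / norm (q^3)" using cube_annulus[of z] zB q3(1) by (simp add: pos_less_divide_eq)
    then have R3: "(1 + z^3) * rank_series (q^3) (z^3) = (1 - z^3) * appell (q^3) (z^3)"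
      using cube_annulus[of z] zB by (intro rank_series_appell q3 z3) auto
    have a3: "(1 - z) * appell (q^3) (z^3) = (1 + z) * (\<rho> z * rank_series (q^3) (z^3))"
      using R3 d unfolding f3 \<rho>_def by (simp add: field_simps)
    have t1: "(1 - z) * theta_ratio q z = (1 + z) * (theta_cof (- z) q / theta_cof z q)"
      unfolding theta_ratio_conv_cof[OF q_less_1] using d by simp
    have t3: "(1 - z) * theta_ratio (q^3) (z^3) = (1 + z) * (\<rho> z * (theta_cof (- (z^3)) (q^3) / theta_cof (z^3) (q^3)))"
      unfolding theta_ratio_conv_cof[OF q3(2)] f3 \<rho>_def using d by simp
    have "(1 + z) * lhs z = (1 - z) * (appell_section z * g z)" using R by (simp add: lhs_def mult.assoc[symmetric])
    also have "appell_section z * g z = appell (q^3) (z^3) * g z + coeff1 * theta_ratio q z + coeff2 * theta_ratio (q^3) (z^3)"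
      using section_identity[OF zB] unfolding g_def by (simp add: algebra_simps)
    also have "(1 - z) * \<dots> = ((1 - z) * appell (q^3) (z^3)) * g z + coeff1 * ((1 - z) * theta_ratio q z) + coeff2 * ((1 - z) * theta_ratio (q^3) (z^3))"
      by (simp add: algebra_simps)
    also have "\<dots> = (1 + z) * rhs z"
      unfolding a3 t1 t3 rhs_def by (simp add: algebra_simps)
    finally show ?thesis using nz3 by simp
  qed
  have m1: "- 1 \<in> S"
    unfolding S_def using norm_1_in_region[of "-1"] unit_annulus[of "-1" c] c_pos c_less_1 by auto
  have oS: "open S" unfolding S_def using finite_poles open_region
    by (intro open_Int open_annulus open_Diff finite_imp_closed)
  have cg: "isCont g (-1)" unfolding g_def by (rule isCont_theta_quot_cube) simp
  have "isCont rank_section (-1)"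
    unfolding rank_section_def [abs_def] by (intro continuous_intros isCont_rank_series w_c_nome) auto
  then have cl: "isCont lhs (-1)" unfolding lhs_def by (intro continuous_intros cg)
  have ccof: "isCont (\<lambda>z. theta_cof (f z) r) (-1)" if "isCont f (-1)" "norm r < 1" "f (-1) \<noteq> 0" for f r
    using isCont_o2[OF that(1) isCont_theta_cof[OF that(2,3)]] .
  have cnz: "theta_cof (-1) q \<noteq> 0" "theta_cof (- 1) (q^3) \<noteq> 0"
    using nz q3 by (simp_all add: theta_cof_minus_1_J q_less_1 J_power d)
  have cr: "isCont (\<lambda>z. rank_series (q^3) (z^3)) (-1)"
    by (rule isCont_o2[where g = "rank_series (q^3)"]) (auto intro!: continuous_intros isCont_rank_series q3)
  have "isCont rhs (-1)"
    unfolding rhs_def \<rho>_def by (intro continuous_intros cr cg ccof) (use cnz q_less_1 q3 in auto)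
  then have "(rhs \<longlongrightarrow> rhs (-1)) (at (-1))" by (simp add: isCont_def)
  moreover have "eventually (\<lambda>z. rhs z = lhs z) (at (-1))"
    using eventually_at_in_open[OF oS m1] by eventually_elim (use key in auto)
  ultimately have "(lhs \<longlongrightarrow> rhs (-1)) (at (-1))" by (rule Lim_transform_eventually)
  moreover have "(lhs \<longlongrightarrow> lhs (-1)) (at (-1))" using cl by (simp add: isCont_def)
  ultimately have "lhs (-1) = rhs (-1)" using tendsto_unique[OF trivial_limit_at] by blast
  then have rhs_eq: "rank_section (- 1) * theta_quot q (- 1) = 3 * rank_series (q^3) (- 1) * theta_quot q (- 1)
      + coeff1 * (theta_cof 1 q / theta_cof (- 1) q) + 3 * coeff2 * (theta_cof 1 (q^3) / theta_cof (- 1) (q^3))"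
    by (simp add: lhs_def rhs_def g_def \<rho>_def)
  have tq: "theta_quot q (- 1) \<noteq> 0"
    using nz by (simp add: theta_quot_J[OF q_pos q_less_1] d)
  from rhs_eq have "(rank_section (- 1) - 3 * rank_series (q^3) (- 1)) * theta_quot q (- 1) =
     coeff1 * (theta_cof 1 q / theta_cof (- 1) q) + 3 * coeff2 * (theta_cof 1 (q^3) / theta_cof (- 1) (q^3))"
    by (simp add: algebra_simps)
  also have "\<dots> = (- 2 * J 1 q ^ 4 * J 3 q ^ 2 / (J 2 q ^ 2 * J 6 q)) * theta_quot q (- 1)"
    unfolding theta_quot_J[OF q_pos q_less_1] theta_cof_1_J theta_cof_minus_1_J[OF q_less_1]
      theta_cof_minus_1_J[OF q3(2)] coeff_J rank_section_1 J_atoms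
    using nz by (simp add: field_simps eval_nat_numeral)
  finally have "rank_section (- 1) - 3 * rank_series (q^3) (- 1) = - 2 * J 1 q ^ 4 * J 3 q ^ 2 / (J 2 q ^ 2 * J 6 q)"
    by (simp only: mult_right_cancel[OF tq])
  then show ?thesis by (simp add: diff_eq_eq)
qed

end

section \<open>Counting overpartitions by rank\<close>

lemma has_sum_times_product:
  fixes f :: "'a \<Rightarrow> complex" and g :: "'b \<Rightarrow> complex"
  assumes f: "(f has_sum a) A" "(\<lambda>x. norm (f x)) summable_on A"
    and g: "(g has_sum b) B" "(\<lambda>x. norm (g x)) summable_on B"
  shows "((\<lambda>(x, y). f x * g y) has_sum a * b) (A \<times> B)"
    and "(\<lambda>p. norm (case p of (x, y) \<Rightarrow> f x * g y)) summable_on A \<times> B"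
proof -
  define gb where "gb = infsum (\<lambda>y. norm (g y)) B"
  have gn: "((\<lambda>y. norm (g y)) has_sum gb) B" using g(2) by (simp add: gb_def)
  show s: "(\<lambda>p. norm (case p of (x, y) \<Rightarrow> f x * g y)) summable_on A \<times> B"
  proof (rule summable_on_SigmaI)
    fix x
    show "((\<lambda>y. norm (case (x, y) of (x, y) \<Rightarrow> f x * g y)) has_sum norm (f x) * gb) B"
      using has_sum_cmult_right[OF gn, of "norm (f x)"] by (simp add: norm_mult)
  next
    show "(\<lambda>x. norm (f x) * gb) summable_on A" by (intro summable_on_cmult_left f)
  qed auto
  show "((\<lambda>(x, y). f x * g y) has_sum a * b) (A \<times> B)"
  proof (rule has_sum_SigmaI)
    fix x
    show "((\<lambda>y. case (x, y) of (x, y) \<Rightarrow> f x * g y) has_sum f x * b) B"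
      using has_sum_cmult_right[OF g(1), of "f x"] by simp
  next
    show "((\<lambda>x. f x * b) has_sum a * b) A" by (intro has_sum_cmult_left f)
    show "(\<lambda>(x, y). f x * g y) summable_on A \<times> B" using s by (rule abs_summable_summable)
  qed
qed

section \<open>Overpartitions with bounded largest part\<close>

definition overpartitions_upto :: "nat \<Rightarrow> (nat multiset \<times> nat set) set" where
  "overpartitions_upto m = {(P, S). set_mset P \<subseteq> {1..m} \<and> S \<subseteq> set_mset P}"

definition overpartitions_max :: "nat \<Rightarrow> (nat multiset \<times> nat set) set" where
  "overpartitions_max m = {(P, S) \<in> overpartitions_upto m. m \<in># P}"

definition op_weight :: "complex \<Rightarrow> complex \<Rightarrow> nat multiset \<times> nat set \<Rightarrow> complex" where
  "op_weight w c \<pi> = w ^ size (fst \<pi>) * c ^ sum_mset (fst \<pi>)"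

text \<open>The new part occurs \<open>Suc n\<close> times, hence at least once, and the boolean
  decides whether its first occurrence is overlined.\<close>

definition add_largest :: "nat \<Rightarrow> (nat multiset \<times> nat set) \<times> (nat \<times> bool) \<Rightarrow> nat multiset \<times> nat set" where
  "add_largest k = (\<lambda>((P, S), (n, b)). (P + replicate_mset (Suc n) k, if b then insert k S else S))"

lemma bij_betw_add_largest:
  "bij_betw (add_largest (Suc m)) (overpartitions_upto m \<times> UNIV) (overpartitions_max (Suc m))"
proof -
  let ?f = "\<lambda>(P, S). ((filter_mset (\<lambda>x. x \<noteq> Suc m) P, S - {Suc m}), (count P (Suc m) - 1, Suc m \<in> S))"
  show ?thesis
  proof (rule bij_betw_byWitness[where f' = ?f])
    have notin: "Suc m \<notin># P" "Suc m \<notin> S" if "(P, S) \<in> overpartitions_upto m" for P S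
      using that by (auto simp: overpartitions_upto_def)
    have flt: "filter_mset (\<lambda>x. x \<noteq> Suc m) (P + replicate_mset k (Suc m)) = P" if "Suc m \<notin># P" for P k
      using that by (auto simp: multiset_eq_iff not_in_iff)
    show "\<forall>a\<in>overpartitions_upto m \<times> UNIV.
         ?f (add_largest (Suc m) a) = a"
    proof (clarify, goal_cases)
      case (1 P S n b)
      note h = notin[OF 1(1)]
      have "count P (Suc m) = 0" using h(1) by (simp add: not_in_iff)
      moreover have "(if b then insert (Suc m) S else S) - {Suc m} = S" "Suc m \<in> (if b then insert (Suc m) S else S) \<longleftrightarrow> b"
        using h(2) by auto
      ultimately show ?case by (simp add: add_largest_def flt[OF h(1)] del: replicate_mset_Suc filter_union_mset)
    qed
    have cnt: "filter_mset (\<lambda>x. x \<noteq> k) P + replicate_mset (Suc (count P k - 1)) k = P" if "k \<in># P" for P and k :: nat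
    proof -
      have "0 < count P k" using that by simp
      then have "Suc (count P k - 1) = count P k" by linarith
      then have "count (filter_mset (\<lambda>x. x \<noteq> k) P + replicate_mset (Suc (count P k - 1)) k) x = count P x" for x
        by (cases "x = k") (simp_all del: replicate_mset_Suc)
      then show ?thesis by (rule multiset_eqI)
    qed
    show "\<forall>a'\<in>overpartitions_max (Suc m). add_largest (Suc m)
         (?f a') = a'"
    proof (clarify, goal_cases)
      case (1 P S)
      then have "Suc m \<in># P" by (simp add: overpartitions_max_def)
      moreover have "(if Suc m \<in> S then insert (Suc m) (S - {Suc m}) else S - {Suc m}) = S" by auto
      ultimately show ?case unfolding add_largest_def prod.case by (simp only: cnt)
    qed
    show "add_largest (Suc m) ` (overpartitions_upto m \<times> UNIV) \<subseteq> overpartitions_max (Suc m)"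
    proof (clarify, goal_cases)
      case (1 P S P' S' n b)
      then have "P = P' + replicate_mset (Suc n) (Suc m)" "S = (if b then insert (Suc m) S' else S')"
        by (auto simp: add_largest_def simp del: replicate_mset_Suc)
      moreover have "set_mset P' \<subseteq> {1..m}" "S' \<subseteq> set_mset P'" using 1 by (auto simp: overpartitions_upto_def)
      ultimately show ?case by (auto simp: overpartitions_max_def overpartitions_upto_def subset_iff)
    qed
    show "?f `
         overpartitions_max (Suc m) \<subseteq> overpartitions_upto m \<times> UNIV"
    proof (rule image_subsetI)
      fix \<pi> assume h: "\<pi> \<in> overpartitions_max (Suc m)"
      obtain P S where \<pi>: "\<pi> = (P, S)" by (cases \<pi>)
      have "set_mset P \<subseteq> {1..Suc m}" "S \<subseteq> set_mset P"
        using h by (auto simp: \<pi> overpartitions_max_def overpartitions_upto_def)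
      then show "(case \<pi> of (P, S) \<Rightarrow> ((filter_mset (\<lambda>x. x \<noteq> Suc m) P, S - {Suc m}), (count P (Suc m) - 1, Suc m \<in> S)))
          \<in> overpartitions_upto m \<times> UNIV"
        by (auto simp: \<pi> overpartitions_upto_def subset_iff le_Suc_eq)
    qed
  qed
qed

lemma op_weight_add_largest:
  "op_weight w c (add_largest k (\<pi>, (n, b))) = op_weight w c \<pi> * (w * c ^ k) ^ Suc n"
proof -
  obtain P S where \<pi>: "\<pi> = (P, S)" by (cases \<pi>)
  have "size (P + replicate_mset (Suc n) k) = size P + Suc n" by simp
  moreover have "sum_mset (P + replicate_mset (Suc n) k) = sum_mset P + k * Suc n"
    by (simp add: mult.commute)
  ultimately show ?thesis unfolding \<pi> op_weight_def add_largest_def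
    by (simp only: prod.case fst_conv power_add power_mult_distrib power_mult mult_ac)
qed

lemma has_sum_geometric_bool:
  fixes x :: complex
  assumes "norm x < 1"
  shows "((\<lambda>(n, b). x ^ Suc n) has_sum 2 * x / (1 - x)) (UNIV :: (nat \<times> bool) set)"
    and "(\<lambda>p. norm (case p of (n, b) \<Rightarrow> x ^ Suc n)) summable_on (UNIV :: (nat \<times> bool) set)"
proof -
  have s: "summable (\<lambda>n. norm (x ^ Suc n))"
    using assms by (simp add: norm_power norm_mult summable_geometric summable_mult)
  have "(\<lambda>n. x * x ^ n) sums (x * (1 / (1 - x)))" by (intro sums_mult geometric_sums assms)
  then have a: "((\<lambda>n. x ^ Suc n) has_sum x / (1 - x)) UNIV"
    using s by (intro norm_summable_imp_has_sum) auto
  have n: "(\<lambda>n. norm (x ^ Suc n)) summable_on UNIV"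
    using s by (intro norm_summable_imp_summable_on) simp
  have b: "((\<lambda>_. 1 :: complex) has_sum 2) (UNIV :: bool set)" "(\<lambda>_. norm (1 :: complex)) summable_on (UNIV :: bool set)"
    by (auto intro!: has_sum_finiteI)
  show "((\<lambda>(n, b). x ^ Suc n) has_sum 2 * x / (1 - x)) (UNIV :: (nat \<times> bool) set)"
    using has_sum_times_product(1)[OF a n b] by (simp add: mult.commute)
  show "(\<lambda>p. norm (case p of (n, b) \<Rightarrow> x ^ Suc n)) summable_on (UNIV :: (nat \<times> bool) set)"
    using has_sum_times_product(2)[OF a n b] by simp
qed

text \<open>Through the bijection \<open>add_largest\<close> the sum factors: the copies of the new
  part form a geometric series starting at the first power, doubled by the overlining
  choice.\<close>

lemma overpartition_gf_max:
  assumes x: "norm (w * c ^ Suc m) < 1"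
    and h: "(op_weight w c has_sum F) (overpartitions_upto m)"
      "(\<lambda>\<pi>. norm (op_weight w c \<pi>)) summable_on overpartitions_upto m"
  shows "(op_weight w c has_sum F * (2 * (w * c ^ Suc m) / (1 - w * c ^ Suc m))) (overpartitions_max (Suc m))"
    and "(\<lambda>\<pi>. norm (op_weight w c \<pi>)) summable_on overpartitions_max (Suc m)"
proof -
  have e: "(\<lambda>p. op_weight w c (add_largest (Suc m) p)) =
     (\<lambda>(\<pi>, y). op_weight w c \<pi> * (case y of (n, b) \<Rightarrow> (w * c ^ Suc m) ^ Suc n))"
    using op_weight_add_largest by (auto simp: fun_eq_iff)
  note pr = has_sum_times_product[OF h has_sum_geometric_bool[OF x], folded e]
  show "(op_weight w c has_sum F * (2 * (w * c ^ Suc m) / (1 - w * c ^ Suc m))) (overpartitions_max (Suc m))"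
    using pr(1) has_sum_reindex_bij_betw[OF bij_betw_add_largest] by blast
  have "(\<lambda>p. norm (op_weight w c (add_largest (Suc m) p))) summable_on overpartitions_upto m \<times> UNIV"
    using pr(2) by (simp add: fun_cong[OF e] split_def)
  then show "(\<lambda>\<pi>. norm (op_weight w c \<pi>)) summable_on overpartitions_max (Suc m)"
    using summable_on_reindex_bij_betw[OF bij_betw_add_largest] by blast
qed

text \<open>Either \<open>Suc m\<close> is absent or it is the largest part, and 1 + 2 x / (1 - x) =
  (1 + x) / (1 - x). Absolute summability is carried through the induction because the product
  formula at each step requires it.\<close>

lemma overpartition_gf_upto:
  assumes "\<And>i. norm (w * c ^ Suc i) < 1"
  shows "(op_weight w c has_sum (\<Prod>i<m. (1 + w * c ^ Suc i) / (1 - w * c ^ Suc i))) (overpartitions_upto m)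
    \<and> (\<lambda>\<pi>. norm (op_weight w c \<pi>)) summable_on overpartitions_upto m"
proof (induction m)
  case 0
  have "overpartitions_upto 0 = {({#}, {})}" by (auto simp: overpartitions_upto_def)
  moreover have "op_weight w c ({#}, {}) = 1" by (simp add: op_weight_def)
  ultimately show ?case using has_sum_finite[of "{({#}, {})}" "op_weight w c"] by simp
next
  case (Suc m)
  define F where "F = (\<Prod>i<m. (1 + w * c ^ Suc i) / (1 - w * c ^ Suc i))"
  define x where "x = w * c ^ Suc m"
  have x: "norm x < 1" using assms by (simp add: x_def)
  then have x1: "1 - x \<noteq> 0" by auto
  have U: "overpartitions_upto (Suc m) = overpartitions_upto m \<union> overpartitions_max (Suc m)"
  proof -
    have "set_mset P \<subseteq> {1..Suc m} \<longleftrightarrow> set_mset P \<subseteq> {1..m} \<or> set_mset P \<subseteq> {1..Suc m} \<and> Suc m \<in># P" for P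
      by (auto simp: subset_iff le_Suc_eq)
    then show ?thesis unfolding overpartitions_upto_def overpartitions_max_def by blast
  qed
  have D: "overpartitions_upto m \<inter> overpartitions_max (Suc m) = {}"
    by (auto simp: overpartitions_upto_def overpartitions_max_def)
  note IH = Suc.IH[THEN conjunct1, folded F_def] Suc.IH[THEN conjunct2]
  note mx = overpartition_gf_max[OF x[unfolded x_def] IH]
  have "(op_weight w c has_sum F + F * (2 * x / (1 - x))) (overpartitions_upto (Suc m))"
    unfolding U x_def by (rule has_sum_Un_disjoint[OF IH(1) mx(1) D])
  moreover have "F + F * (2 * x / (1 - x)) = F * ((1 + x) / (1 - x))" using x1 by (simp add: field_simps)
  moreover have "(\<lambda>\<pi>. norm (op_weight w c \<pi>)) summable_on overpartitions_upto (Suc m)"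
    unfolding U by (rule summable_on_Un_disjoint[OF IH(2) mx(2) D])
  ultimately show ?case by (simp add: F_def x_def)
qed

section \<open>Summing the rank weights\<close>

definition all_overpartitions :: "(nat multiset \<times> nat set) set" where
  "all_overpartitions = (\<Union>n. overpartitions n)"

lemma overpartitions_max_Max:
  assumes "\<pi> \<in> overpartitions_max (Suc k)"
  shows "Max (set_mset (fst \<pi>)) = Suc k" "fst \<pi> \<noteq> {#}"
  using assms by (auto simp: overpartitions_max_def overpartitions_upto_def intro!: Max_eqI)

lemma all_overpartitions_eq:
  "all_overpartitions = insert ({#}, {}) (\<Union>k. overpartitions_max (Suc k))"
proof (intro equalityI subsetI)
  fix \<pi> assume "\<pi> \<in> all_overpartitions"
  then obtain P S where \<pi>: "\<pi> = (P, S)" "0 \<notin># P" "S \<subseteq> set_mset P"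
    by (auto simp: all_overpartitions_def overpartitions_def)
  show "\<pi> \<in> insert ({#}, {}) (\<Union>k. overpartitions_max (Suc k))"
  proof (cases "P = {#}")
    case True
    then show ?thesis using \<pi> by simp
  next
    case False
    then have M: "Max (set_mset P) \<in># P" by simp
    then obtain k where k: "Max (set_mset P) = Suc k" using \<pi>(2) by (metis not0_implies_Suc)
    have "x \<in> {1..Suc k}" if "x \<in># P" for x
    proof -
      have "x \<le> Max (set_mset P)" using that by simp
      moreover have "x \<noteq> 0" using that \<pi>(2) by metis
      ultimately show ?thesis using k by simp
    qed
    then have "\<pi> \<in> overpartitions_max (Suc k)"
      using \<pi> M k by (auto simp: overpartitions_max_def overpartitions_upto_def)
    then show ?thesis by blast
  qed
next
  fix \<pi> assume "\<pi> \<in> insert ({#}, {}) (\<Union>k. overpartitions_max (Suc k))"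
  then show "\<pi> \<in> all_overpartitions"
    by (fastforce simp: all_overpartitions_def overpartitions_def overpartitions_max_def overpartitions_upto_def)
qed

definition rank_weight :: "complex \<Rightarrow> complex \<Rightarrow> nat multiset \<times> nat set \<Rightarrow> complex" where
  "rank_weight z c \<pi> = z powi overpartition_rank \<pi> * c ^ sum_mset (fst \<pi>)"

lemma rank_weight_max:
  assumes "\<pi> \<in> overpartitions_max (Suc k)" "z \<noteq> 0"
  shows "rank_weight z c \<pi> = z ^ Suc k * op_weight (1 / z) c \<pi>"
  using overpartitions_max_Max[OF assms(1)] assms(2)
  by (simp add: rank_weight_def overpartition_rank_def op_weight_def power_int_diff power_one_over del: power_Suc)
     (simp add: power_int_add power_one_over field_simps)

text \<open>Grouping by largest part produces the rank series term by term. Summing over the union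
  of the groups needs absolute summability over all overpartitions, and that takes up most of the
  work.\<close>

lemma rank_weight_has_sum:
  assumes c: "0 < norm c" "norm c < 1" and z: "norm z = 1"
  shows "(rank_weight z c has_sum rank_series c (1 / z)) all_overpartitions"
proof -
  have z0: "z \<noteq> 0" using z by auto
  define w where "w = 1 / z"
  have nw: "norm w = 1" using z by (simp add: w_def norm_divide)
  have wc: "norm (w * c ^ Suc i) < 1" for i
    using c nw by (simp add: norm_mult norm_power power_less_one_iff del: power_Suc)
  define F where "F = (\<lambda>m. (\<Prod>i<m. (1 + w * c ^ Suc i) / (1 - w * c ^ Suc i)))"
  have up: "(op_weight w c has_sum F m) (overpartitions_upto m)"
    "(\<lambda>\<pi>. norm (op_weight w c \<pi>)) summable_on overpartitions_upto m" for m
    using overpartition_gf_upto[of w c m] wc by (auto simp: F_def)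
  have G: "(rank_weight z c has_sum 2 * c * (rank_coeff c w k * (c / w) ^ k)) (overpartitions_max (Suc k))" for k
  proof -
    have "((\<lambda>\<pi>. z ^ Suc k * op_weight w c \<pi>) has_sum z ^ Suc k * (F k * (2 * (w * c ^ Suc k) / (1 - w * c ^ Suc k))))
       (overpartitions_max (Suc k))"
      by (intro has_sum_cmult_right overpartition_gf_max(1)[OF wc up])
    then have "(rank_weight z c has_sum z ^ Suc k * (F k * (2 * (w * c ^ Suc k) / (1 - w * c ^ Suc k)))) (overpartitions_max (Suc k))"
      by (rule has_sum_cong[THEN iffD1, rotated]) (simp add: rank_weight_max[OF _ z0] w_def)
    moreover have "z ^ Suc k * (F k * (2 * (w * c ^ Suc k) / (1 - w * c ^ Suc k))) = 2 * c * (rank_coeff c w k * (c / w) ^ k)"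
    proof -
      have "rank_coeff c w k = F k / (1 - w * c ^ Suc k)"
        by (simp add: rank_coeff_def F_def prod_dividef del: power_Suc)
      moreover have "z ^ Suc k * (w * c ^ Suc k) = c * (c / w) ^ k"
        using z0 by (simp add: w_def power_mult_distrib mult_ac)
      moreover have "a * (f * (2 * b / d)) = 2 * (f / d) * (a * b)" for a b d f :: complex by simp
      ultimately have "z ^ Suc k * (F k * (2 * (w * c ^ Suc k) / (1 - w * c ^ Suc k))) = 2 * rank_coeff c w k * (c * (c / w) ^ k)"
        by (simp only:)
      then show ?thesis by simp
    qed
    ultimately show ?thesis by simp
  qed
  \<comment> \<open>Since \<open>norm z = 1\<close>, absolute values erase the rank: the absolute
    sum over one group is the value of the generating function at weight 1 and the real nome
    \<open>norm c\<close>.\<close>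
  define \<nu> where "\<nu> k = norm c ^ Suc k * (2 / (1 - norm c ^ Suc k) * (\<Prod>i<k. (1 + norm c ^ Suc i) / (1 - norm c ^ Suc i)))" for k
  have nsum: "((\<lambda>\<pi>. norm (rank_weight z c \<pi>)) has_sum \<nu> k) (overpartitions_max (Suc k))" for k
  proof -
    define d where "d = complex_of_real (norm c)"
    have dc: "norm (1 * d ^ Suc i) < 1" for i using c by (simp add: d_def norm_power power_less_one_iff del: power_Suc)
    define f where "f = (\<Prod>i<k. (1 + norm c ^ Suc i) / (1 - norm c ^ Suc i))"
    have f: "of_real f = (\<Prod>i<k. (1 + 1 * d ^ Suc i) / (1 - 1 * d ^ Suc i))" by (simp add: f_def d_def)
    have "(op_weight 1 d has_sum (of_real f * (2 * (1 * d ^ Suc k) / (1 - 1 * d ^ Suc k)))) (overpartitions_max (Suc k))"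
      unfolding f by (rule overpartition_gf_max(1)[OF dc]) (use overpartition_gf_upto[of 1 d k] dc in blast)+
    moreover have "of_real f * (2 * (1 * d ^ Suc k) / (1 - 1 * d ^ Suc k)) = complex_of_real (norm c ^ Suc k * (2 / (1 - norm c ^ Suc k) * f))"
      by (simp add: d_def)
    moreover have "op_weight 1 d = (\<lambda>\<pi>. of_real (norm (rank_weight z c \<pi>)))"
      by (rule ext) (simp add: op_weight_def rank_weight_def norm_mult norm_power norm_power_int z d_def)
    ultimately show ?thesis unfolding \<nu>_def f_def[symmetric] by (simp only: has_sum_of_real_iff)
  qed
  define Sg where "Sg = Sigma (UNIV :: nat set) (\<lambda>k. overpartitions_max (Suc k))"
  have inj: "inj_on snd Sg"
    unfolding Sg_def inj_on_def by (auto dest!: overpartitions_max_Max(1))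
  have im: "snd ` Sg = (\<Union>k. overpartitions_max (Suc k))" by (force simp: Sg_def)
  have "(\<lambda>p. norm (rank_weight z c (snd p))) summable_on Sg"
    unfolding Sg_def
  proof (rule summable_on_SigmaI)
    fix k
    show "((\<lambda>y. norm (rank_weight z c (snd (k, y)))) has_sum \<nu> k) (overpartitions_max (Suc k))"
      using nsum[of k] by simp
  next
    \<comment> \<open>The uniform bound on overlined factors with both parameters equal to
      \<open>norm c\<close>; it makes \<open>\<nu> k\<close> geometrically small.\<close>
    define C where "C = exp (norm c / (1 - norm c) * (1 + 1 / (1 - norm c)))"
    have "2 / (1 - norm c ^ Suc k) * (\<Prod>i<k. (1 + norm c ^ Suc i) / (1 - norm c ^ Suc i)) \<le> 2 * C" for k
    proof -
      have "(\<Prod>i<k. 1 + norm c * norm c ^ i) / (\<Prod>i<Suc k. 1 - norm c * norm c ^ i) \<le> C"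
        unfolding C_def by (rule overlined_factors_bound(1)) (use c in auto)
      moreover have "2 / (1 - norm c ^ Suc k) * (\<Prod>i<k. (1 + norm c ^ Suc i) / (1 - norm c ^ Suc i)) =
          2 * ((\<Prod>i<k. 1 + norm c * norm c ^ i) / (\<Prod>i<Suc k. 1 - norm c * norm c ^ i))"
        by (simp add: prod_dividef mult.commute)
      ultimately show ?thesis by simp
    qed
    then have le: "\<nu> k \<le> 2 * C * norm c ^ k" for k
    proof -
      have "\<nu> k \<le> norm c ^ Suc k * (2 * C)"
        unfolding \<nu>_def by (intro mult_left_mono) (use \<open>\<And>k. 2 / (1 - norm c ^ Suc k) * (\<Prod>i<k. (1 + norm c ^ Suc i) / (1 - norm c ^ Suc i)) \<le> 2 * C\<close> in auto)
      also have "\<dots> \<le> norm c ^ k * (2 * C)" using c by (intro mult_right_mono power_decreasing) (auto simp: C_def)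
      finally show ?thesis by (simp add: mult_ac)
    qed
    have "(\<lambda>k. 2 * C * norm c ^ k) summable_on UNIV"
      using c by (intro norm_summable_imp_summable_on) (simp add: norm_mult abs_mult power_abs summable_mult summable_geometric)
    then show "(\<lambda>k. \<nu> k) summable_on UNIV"
    proof (rule summable_on_comparison_test)
      fix k
      show "0 \<le> \<nu> k"
        using has_sum_nonneg[OF nsum[of k]] by simp
    qed (rule le)
  qed auto
  then have sm: "(\<lambda>p. rank_weight z c (snd p)) summable_on Sg" by (rule abs_summable_summable)
  have "((\<lambda>k. 2 * c * (rank_coeff c w k * (c / w) ^ k)) has_sum 2 * c * rank_aux c w (c / w)) UNIV"
  proof -
    have cw: "norm w * norm c < 1" "norm (c / w) < 1" using nw c by (auto simp: norm_divide)
    show ?thesis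
      by (intro has_sum_cmult_right norm_summable_imp_has_sum rank_aux_summable[OF c(2) cw] rank_aux_sums[OF c(2) cw])
  qed
  then have "((\<lambda>p. rank_weight z c (snd p)) has_sum 2 * c * rank_aux c w (c / w)) Sg"
    unfolding Sg_def by (intro has_sum_SigmaI[OF _ _ sm[unfolded Sg_def]]) (use G in simp_all)
  then have "(rank_weight z c has_sum 2 * c * rank_aux c w (c / w)) (\<Union>k. overpartitions_max (Suc k))"
    unfolding im[symmetric] by (subst has_sum_reindex[OF inj]) (simp add: o_def)
  \<comment> \<open>The empty overpartition belongs to no group; its weight, with rank 0 by
    convention, is the leading 1 of \<open>rank_series\<close>.\<close>
  moreover have "({#}, {}) \<notin> (\<Union>k. overpartitions_max (Suc k))" by (auto simp: overpartitions_max_def)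
  ultimately have "(rank_weight z c has_sum rank_weight z c ({#}, {}) + 2 * c * rank_aux c w (c / w)) all_overpartitions"
    unfolding all_overpartitions_eq by (intro has_sum_insert)
  then show ?thesis by (simp add: rank_weight_def overpartition_rank_def rank_series_def w_def)
qed

text \<open>The same absolutely convergent sum, grouped by the integer being partitioned; each group
  is finite.\<close>

lemma rank_generating_function:
  assumes c: "0 < norm c" "norm c < 1" and z: "norm z = 1"
  shows "(\<lambda>n. (\<Sum>\<pi>\<in>overpartitions n. z powi overpartition_rank \<pi>) * c ^ n) sums rank_series c (1 / z)"
proof -
  define Sg where "Sg = Sigma (UNIV :: nat set) overpartitions"
  have inj: "inj_on snd Sg" unfolding Sg_def inj_on_def by (auto simp: overpartitions_def)
  have im: "snd ` Sg = all_overpartitions" by (force simp: Sg_def all_overpartitions_def)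
  have "((\<lambda>p. rank_weight z c (snd p)) has_sum rank_series c (1 / z)) Sg"
    using rank_weight_has_sum[OF assms] unfolding im[symmetric] by (subst (asm) has_sum_reindex[OF inj]) (simp add: o_def)
  moreover have "((\<lambda>y. rank_weight z c (snd (n, y))) has_sum (\<Sum>\<pi>\<in>overpartitions n. z powi overpartition_rank \<pi>) * c ^ n) (overpartitions n)" for n
  proof (rule has_sum_finiteI[OF finite_overpartitions])
    show "(\<Sum>\<pi>\<in>overpartitions n. z powi overpartition_rank \<pi>) * c ^ n = (\<Sum>y\<in>overpartitions n. rank_weight z c (snd (n, y)))"
      unfolding sum_distrib_right by (intro sum.cong refl) (auto simp: rank_weight_def overpartitions_def)
  qed
  ultimately have "((\<lambda>n. (\<Sum>\<pi>\<in>overpartitions n. z powi overpartition_rank \<pi>) * c ^ n) has_sum rank_series c (1 / z)) UNIV"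
    unfolding Sg_def by (rule has_sum_SigmaD)
  then show ?thesis by (rule has_sum_imp_sums)
qed

section \<open>Root-of-unity filters modulo 3 and modulo 6\<close>

context cubic_section
begin

lemma sum_cube_root_powers: "(\<Sum>j<3. (w ^ j) ^ n) = (if 3 dvd n then 3 else 0)"
proof -
  have e: "(\<Sum>j<3. (w ^ j) ^ n) = 1 + w ^ n + (w ^ n) ^ 2"
    unfolding sum_lessThan_3 by (simp add: mult.commute flip: power_mult)
  have "n = 3 * (n div 3) + n mod 3" by simp
  then have wn: "w ^ n = w ^ (n mod 3)" by (metis power_add power_mult w_cubed power_one mult_1)
  have "n mod 3 = 0 \<or> n mod 3 = 1 \<or> n mod 3 = 2" by linarith
  moreover have "1 + w^2 + (w^2)^2 = 0" using w_root by algebra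
  ultimately show ?thesis unfolding e wn using w_root by (auto simp: dvd_eq_mod_eq_0)
qed

text \<open>Averaging over the nomes \<open>w ^ j * c\<close> keeps exactly the exponents divisible
  by 3, and \<open>c ^ (3 * n) = q ^ n\<close>. This connects the analytic average with the
  progression \<open>3 * n\<close>.\<close>

lemma rank_section_sums:
  assumes z: "norm z = 1"
  shows "(\<lambda>n. (\<Sum>\<pi>\<in>overpartitions (3 * n). z powi overpartition_rank \<pi>) * q ^ n) sums rank_section (1 / z)"
proof -
  define a where "a = (\<lambda>n. \<Sum>\<pi>\<in>overpartitions n. z powi overpartition_rank \<pi>)"
  define f where "f = (\<lambda>n. if 3 dvd n then a n * c ^ n else 0)"
  have "(\<lambda>n. (\<Sum>j<3. a n * (w ^ j * c) ^ n) / 3) sums ((\<Sum>j<3. rank_series (w ^ j * c) (1 / z)) / 3)"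
    unfolding a_def by (intro sums_divide sums_sum rank_generating_function w_c_nome z)
  moreover have "(\<Sum>j<3. a n * (w ^ j * c) ^ n) / 3 = f n" for n
  proof -
    have "(\<Sum>j<3. a n * (w ^ j * c) ^ n) = a n * c ^ n * (\<Sum>j<3. (w ^ j) ^ n)"
      by (simp add: power_mult_distrib sum_distrib_left mult_ac)
    then show ?thesis unfolding sum_cube_root_powers f_def by simp
  qed
  ultimately have "f sums rank_section (1 / z)" by (simp add: rank_section_def)
  moreover have "(\<lambda>n. f (3 * n)) sums rank_section (1 / z) \<longleftrightarrow> f sums rank_section (1 / z)"
  proof (rule sums_mono_reindex)
    show "strict_mono (\<lambda>n::nat. 3 * n)" by (simp add: strict_mono_def)
    fix n assume "n \<notin> range (\<lambda>n::nat. 3 * n)"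
    then show "f n = 0" by (auto simp: f_def dvd_def)
  qed
  ultimately show ?thesis by (simp add: f_def a_def power_mult c_cubed)
qed

text \<open>\<open>- w\<close> is a primitive sixth root of unity: the exponent is reduced modulo 6,
  and the nonzero residues are excluded through \<open>(- w) ^ 3 = - 1\<close> and
  \<open>w \<noteq> 1\<close>.\<close>

lemma minus_w_powi_eq_1_iff: "(- w) powi m = 1 \<longleftrightarrow> 6 dvd m"
proof -
  define u where "u = - w"
  have u0: "u \<noteq> 0" using w_nonzero by (simp add: u_def)
  have u3: "u ^ 3 = - 1" using w_cubed by (simp add: u_def)
  have u6: "u powi 6 = 1"
  proof -
    have "u ^ 6 = (u ^ 3) ^ 2" by (simp flip: power_mult)
    then show ?thesis using u3 by simp
  qed
  have "m = 6 * (m div 6) + m mod 6" by simp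
  then have "u powi m = u powi (6 * (m div 6)) * u powi (m mod 6)" using u0 by (metis power_int_add)
  also have "u powi (6 * (m div 6)) = 1" using u6 by (simp add: power_int_mult)
  finally have um: "u powi m = u powi (m mod 6)" by simp
  have n: "u \<noteq> 1" "u ^ 2 \<noteq> 1" "u ^ 4 \<noteq> 1" "u ^ 5 \<noteq> 1"
  proof -
    show "u \<noteq> 1" using u3 by auto
    show "u ^ 2 \<noteq> 1"
    proof
      assume "u ^ 2 = 1"
      then have "w ^ 2 = 1" by (simp add: u_def)
      then have "w = 1" using w_cubed by (simp add: power2_eq_square power3_eq_cube)
      then show False using w_neq_1 by blast
    qed
    show "u ^ 4 \<noteq> 1"
    proof
      assume "u ^ 4 = 1"
      then have "w ^ 4 = 1" by (simp add: u_def)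
      moreover have "w ^ 4 = w" using w_cubed by (simp add: eval_nat_numeral)
      ultimately show False using w_neq_1 by simp
    qed
    show "u ^ 5 \<noteq> 1"
    proof
      assume h: "u ^ 5 = 1"
      have "u * u ^ 5 = (u ^ 3) ^ 2" by (simp add: eval_nat_numeral)
      then show False using h u3 \<open>u \<noteq> 1\<close> by simp
    qed
  qed
  have "m mod 6 = 0 \<or> m mod 6 = 1 \<or> m mod 6 = 2 \<or> m mod 6 = 3 \<or> m mod 6 = 4 \<or> m mod 6 = 5" by presburger
  then show ?thesis
    unfolding u_def[symmetric] um using n u3 by (auto simp: dvd_eq_mod_eq_0)
qed

text \<open>Fourier inversion on the residues modulo 6: the powers of \<open>- w\<close> sum to 6
  when the rank is congruent to \<open>s\<close> and to 0 otherwise.\<close>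

lemma Nbar_eq:
  "of_nat (Nbar s 6 n) =
     (\<Sum>k<6. ((- w) ^ k) powi (- s) * (\<Sum>\<pi>\<in>overpartitions n. ((- w) ^ k) powi overpartition_rank \<pi>)) / 6"
proof -
  define u where "u = - w"
  have u0: "u \<noteq> 0" using w_nonzero by (simp add: u_def)
  have ind: "(\<Sum>k<6. (u powi m) ^ k) = (if 6 dvd m then 6 else 0)" for m :: int
  proof (cases "6 dvd m")
    case True
    then have "u powi m = 1" by (simp add: u_def minus_w_powi_eq_1_iff)
    then show ?thesis using True by simp
  next
    case False
    then have "u powi m \<noteq> 1" by (simp add: u_def minus_w_powi_eq_1_iff)
    moreover have "(u powi m) ^ 6 = 1"
    proof -
      have "(u powi m) ^ 6 = u powi (m * 6)" by (simp add: power_int_mult)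
      moreover have "u powi (m * 6) = 1" unfolding u_def minus_w_powi_eq_1_iff by simp
      ultimately show ?thesis by simp
    qed
    ultimately show ?thesis using False by (simp add: geometric_sum)
  qed
  have "(\<Sum>k<6. (u ^ k) powi (- s) * (\<Sum>\<pi>\<in>overpartitions n. (u ^ k) powi overpartition_rank \<pi>)) =
     (\<Sum>\<pi>\<in>overpartitions n. \<Sum>k<6. (u powi (overpartition_rank \<pi> - s)) ^ k)"
  proof -
    have "(u ^ k) powi (- s) * (u ^ k) powi r = (u powi (r - s)) ^ k" for k r
    proof -
      have "(u ^ k) powi (- s) * (u ^ k) powi r = (u ^ k) powi (r - s)"
        using u0 by (subst power_int_add[symmetric]) auto
      also have "\<dots> = (u powi (r - s)) ^ k"
        using power_int_mult[of u "int k" "r - s"] power_int_mult[of u "r - s" "int k"] by (simp add: mult.commute)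
      finally show ?thesis .
    qed
    then show ?thesis by (subst sum.swap) (simp add: sum_distrib_left)
  qed
  also have "\<dots> = (\<Sum>\<pi>\<in>overpartitions n. if 6 dvd (overpartition_rank \<pi> - s) then 6 else 0)"
    unfolding ind ..
  also have "\<dots> = 6 * of_nat (card {\<pi> \<in> overpartitions n. 6 dvd (overpartition_rank \<pi> - s)})"
    by (simp add: sum.If_cases finite_overpartitions Int_def)
  also have "card {\<pi> \<in> overpartitions n. 6 dvd (overpartition_rank \<pi> - s)} = Nbar s 6 n"
    by (simp add: Nbar_def cong_iff_dvd_diff)
  finally show ?thesis by (simp add: u_def)
qed

lemma rbar_eq: "rbar s 0 q = (\<Sum>k<6. ((- w) ^ k) powi (- s) * rank_section (1 / (- w) ^ k)) / 6"
proof -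
  have "(\<lambda>n. (\<Sum>k<6. ((- w) ^ k) powi (- s) *
      ((\<Sum>\<pi>\<in>overpartitions (3 * n). ((- w) ^ k) powi overpartition_rank \<pi>) * q ^ n)) / 6) sums
      ((\<Sum>k<6. ((- w) ^ k) powi (- s) * rank_section (1 / (- w) ^ k)) / 6)"
    by (intro sums_divide sums_sum sums_mult rank_section_sums) (simp add: norm_power norm_w)
  moreover have "(\<Sum>k<6. ((- w) ^ k) powi (- s) *
      ((\<Sum>\<pi>\<in>overpartitions (3 * n). ((- w) ^ k) powi overpartition_rank \<pi>) * q ^ n)) / 6 =
      of_nat (Nbar s 6 (3 * n)) * q ^ n" for n
    unfolding Nbar_eq by (simp add: sum_distrib_right mult.assoc)
  ultimately have "(\<lambda>n. of_nat (Nbar s 6 (3 * n)) * q ^ n) sums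
      ((\<Sum>k<6. ((- w) ^ k) powi (- s) * rank_section (1 / (- w) ^ k)) / 6)" by simp
  then show ?thesis unfolding rbar_def by (simp add: sums_iff)
qed

text \<open>Replacing \<open>w\<close> by \<open>w^2\<close> only permutes the three nomes, so the
  average is the same function, while the evaluations at \<open>w\<close> and \<open>- w\<close>
  hold for either primitive cube root.\<close>

lemma rank_section_conj_root:
  "rank_section (w^2) = rank_section w" "rank_section (- (w^2)) = rank_section (- w)"
proof -
  interpret conj: cubic_section q c "w^2"
  proof
    show "1 + w^2 + (w^2)^2 = 0" using w_root by algebra
  qed (rule q_pos q_less_1 c_cubed)+
  have w4: "(w^2)^2 = w" using w_cubed by algebra
  have "conj.rank_section z = rank_section z" for z
    unfolding conj.rank_section_def rank_section_def sum_lessThan_3 w4 by simp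
  then show "rank_section (w^2) = rank_section w" "rank_section (- (w^2)) = rank_section (- w)"
    using rank_section_root conj.rank_section_root rank_section_minus_root conj.rank_section_minus_root by simp_all
qed

lemma rbar_values:
  "rbar 0 0 q = (rank_section 1 + 2 * rank_section (- w) + 2 * rank_section w + rank_section (- 1)) / 6"
  "rbar 1 0 q = (rank_section 1 + rank_section (- w) - rank_section w - rank_section (- 1)) / 6"
  "rbar 2 0 q = (rank_section 1 - rank_section (- w) - rank_section w + rank_section (- 1)) / 6"
  "rbar 3 0 q = (rank_section 1 - 2 * rank_section (- w) + 2 * rank_section w - rank_section (- 1)) / 6"
proof -
  have inv: "1 / w = w^2" using w_cubed w_nonzero by (simp add: field_simps power2_eq_square power3_eq_cube)
  have pw: "w^4 = w" "w^5 = w^2" using w_cubed by (simp_all add: eval_nat_numeral)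
  have w2inv: "1 / w^2 = w" using w_cubed w_nonzero by (simp add: field_simps power2_eq_square power3_eq_cube)
  have u: "(- w) ^ 2 = w^2" "(- w) ^ 3 = - 1" "(- w) ^ 4 = w" "(- w) ^ 5 = - (w^2)"
    using w_cubed pw by simp_all
  have sum6: "(\<Sum>k<6. f k) = f 0 + f 1 + f 2 + f 3 + f 4 + f 5" for f :: "nat \<Rightarrow> complex"
    by (simp add: eval_nat_numeral lessThan_Suc)
  have R: "rank_section (1 / 1) = rank_section 1" "rank_section (1 / - w) = rank_section (- w)" "rank_section (1 / w^2) = rank_section w"
    "rank_section (1 / - 1) = rank_section (- 1)" "rank_section (1 / w) = rank_section w" "rank_section (1 / - (w^2)) = rank_section (- w)"
    using inv w2inv rank_section_conj_root by (simp_all add: divide_minus_right)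
  have all: "rbar s 0 q = (rank_section 1 + (- w) powi (- s) * rank_section (- w) + (w^2) powi (- s) * rank_section w
      + (- 1) powi (- s) * rank_section (- 1) + w powi (- s) * rank_section w + (- (w^2)) powi (- s) * rank_section (- w)) / 6" for s
    unfolding rbar_eq sum6 u power_0 power_one_right R by simp
  have wi: "inverse w = w^2" "inverse (w^2) = w" "w^2 * w^2 = w" "w * w = w^2"
    using inv w2inv pw by (simp_all add: inverse_eq_divide power2_eq_square eval_nat_numeral)
  \<comment> \<open>Conjugate roots have equal section values, so their coefficients add up; w + w^2
    = -1 makes these sums rational.\<close>
  have ww: "w^2 = - 1 - w" using w_root by (simp add: algebra_simps eq_neg_iff_add_eq_0)
  show "rbar 0 0 q = (rank_section 1 + 2 * rank_section (- w) + 2 * rank_section w + rank_section (- 1)) / 6"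
    unfolding all by simp
  have p1: "x powi (- 1) = inverse x" "x powi (- 2) = inverse x * inverse x" "x powi (- 3) = inverse x * inverse x * inverse x" for x :: complex
    by (simp_all add: power_int_minus power2_eq_square power3_eq_cube)
  have i: "inverse (- w) = - (w^2)" "inverse (- (w^2)) = - w" "inverse (- 1 :: complex) = - 1" using wi by simp_all
  show "rbar 1 0 q = (rank_section 1 + rank_section (- w) - rank_section w - rank_section (- 1)) / 6"
    unfolding all p1 unfolding wi(1,2) i unfolding ww by (simp add: field_simps)
  show "rbar 2 0 q = (rank_section 1 - rank_section (- w) - rank_section w + rank_section (- 1)) / 6"
    unfolding all p1 unfolding wi(1,2) i unfolding minus_mult_minus wi(3,4) unfolding ww by (simp add: field_simps)
  have c3: "w * w * w = 1" "w^2 * w^2 * w^2 = 1" using w_cubed by algebra+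
  show "rbar 3 0 q = (rank_section 1 - 2 * rank_section (- w) + 2 * rank_section w - rank_section (- 1)) / 6"
    unfolding all p1 unfolding wi(1,2) i unfolding mult_minus_left mult_minus_right minus_minus c3 by (simp add: field_simps)
qed

end

theorem theorem5p7:
  fixes q :: complex
  assumes "0 < norm q" and "norm q < 1"
  shows
    "rbar 0 0 q =
        J 6 q ^ 12 / (6 * JJ 1 6 q ^ 8 * J 2 q ^ 4 * JJ 3 6 q)
        + 2 * J 6 q ^ 3 * JJ 3 6 q / (3 * JJ 1 6 q ^ 2 * J 2 q)
        - JJ 1 6 q ^ 4 * J 2 q ^ 2 * JJ 3 6 q ^ 3 / (3 * J 6 q ^ 6)
        + 2 / JJ 3 6 q *
          (\<Sum>\<^sub>\<infinity>n\<in>(UNIV :: int set). (-1) powi n * q powi (3 * n^2 + 3 * n) / (1 + q powi (3 * n))^2) \<and>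
     rbar 1 0 q =
        J 6 q ^ 12 / (6 * JJ 1 6 q ^ 8 * J 2 q ^ 4 * JJ 3 6 q)
        + JJ 1 6 q ^ 4 * J 2 q ^ 2 * JJ 3 6 q ^ 3 / (3 * J 6 q ^ 6)
        - 2 / JJ 3 6 q *
          (\<Sum>\<^sub>\<infinity>n\<in>(UNIV :: int set). (-1) powi n * q powi (3 * n^2 + 3 * n) / (1 + q powi (3 * n))^2) \<and>
     rbar 2 0 q =
        J 6 q ^ 12 / (6 * JJ 1 6 q ^ 8 * J 2 q ^ 4 * JJ 3 6 q)
        - J 6 q ^ 3 * JJ 3 6 q / (3 * JJ 1 6 q ^ 2 * J 2 q)
        - JJ 1 6 q ^ 4 * J 2 q ^ 2 * JJ 3 6 q ^ 3 / (3 * J 6 q ^ 6)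
        + 2 / JJ 3 6 q *
          (\<Sum>\<^sub>\<infinity>n\<in>(UNIV :: int set). (-1) powi n * q powi (3 * n^2 + 3 * n) / (1 + q powi (3 * n))^2) \<and>
     rbar 3 0 q =
        J 6 q ^ 12 / (6 * JJ 1 6 q ^ 8 * J 2 q ^ 4 * JJ 3 6 q)
        + JJ 1 6 q ^ 4 * J 2 q ^ 2 * JJ 3 6 q ^ 3 / (3 * J 6 q ^ 6)
        - 2 / JJ 3 6 q *
          (\<Sum>\<^sub>\<infinity>n\<in>(UNIV :: int set). (-1) powi n * q powi (3 * n^2 + 3 * n) / (1 + q powi (3 * n))^2)"
proof -
  have q0: "q \<noteq> 0" using assms by auto
  \<comment> \<open>The primitive cube root of unity in the upper half plane; \<open>c\<close> below
    is the cube root of \<open>q\<close> given by the principal logarithm.\<close>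
  define w :: complex where "w = Complex (- 1 / 2) (sqrt 3 / 2)"
  define c where "c = exp (Ln q / 3)"
  interpret cubic_section q c w
  proof
    have "c ^ 3 = exp (3 * (Ln q / 3))" unfolding c_def by (simp flip: exp_of_nat_mult)
    then show "c ^ 3 = q" using q0 by simp
    show "1 + w + w^2 = 0" by (simp add: w_def complex_eq_iff power2_eq_square)
  qed (use assms in auto)
  define j1 j2 j3 j6 where d: "j1 = J 1 q" "j2 = J 2 q" "j3 = J 3 q" "j6 = J 6 q"
  have nz: "j1 \<noteq> 0" "j2 \<noteq> 0" "j3 \<noteq> 0" "j6 \<noteq> 0" using J_nonzero[OF q_less_1] by (auto simp: d)
  define \<Sigma> where "\<Sigma> = (\<Sum>\<^sub>\<infinity>n::int. (-1) powi n * q powi (3 * n^2 + 3 * n) / (1 + q powi (3 * n))^2)"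
  have "(\<Sum>\<^sub>\<infinity>n::int. (-1) powi n * (q^3) powi (n^2 + n) / (1 + (q^3) powi n)^2) = \<Sigma>"
    unfolding \<Sigma>_def
  proof (rule infsum_cong)
    fix n :: int
    have "(q^3) powi k = q powi (3 * k)" for k by (simp add: power_int_mult)
    then show "(-1) powi n * (q^3) powi (n^2 + n) / (1 + (q^3) powi n)^2 =
        (-1) powi n * q powi (3 * n^2 + 3 * n) / (1 + q powi (3 * n))^2"
      by (simp add: distrib_left)
  qed
  then have "rank_series (q^3) (- 1) = 4 / alt_theta (q^3) * \<Sigma>"
    using rank_series_minus_1[OF q3] by simp
  then have R: "rank_series (q^3) (- 1) = 4 * j6 / j3^2 * \<Sigma>"
    using alt_theta_J[OF q3] by (simp add: J_cube[unfolded One_nat_def] d)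
  have A: "rank_section 1 / 6 = j6 ^ 12 / (6 * JJ 1 6 q ^ 8 * j2 ^ 4 * JJ 3 6 q)"
    unfolding rank_section_1 JJ_1_6[OF q_less_1] JJ_3_6[OF q_less_1 q0] d[symmetric]
    using nz by (simp add: field_simps eval_nat_numeral)
  have X: "rank_section (- w) = j6 ^ 3 * JJ 3 6 q / (JJ 1 6 q ^ 2 * j2)" "rank_section w = rank_section (- w)"
    unfolding rank_section_root rank_section_minus_root JJ_1_6[OF q_less_1] JJ_3_6[OF q_less_1 q0] d[symmetric]
    using nz by (simp_all add: field_simps eval_nat_numeral)
  \<comment> \<open>The coefficient 2 is 3 * 4 / 6: the 3 comes from dividing out
    \<open>1 + z\<close>, the 4 from the rank series at -1.\<close>
  have C: "rank_section (- 1) / 6 = 2 / JJ 3 6 q * \<Sigma> - JJ 1 6 q ^ 4 * j2 ^ 2 * JJ 3 6 q ^ 3 / (3 * j6 ^ 6)"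
    unfolding rank_section_minus_1 R JJ_1_6[OF q_less_1] JJ_3_6[OF q_less_1 q0] d[symmetric]
    using nz by (simp add: field_simps eval_nat_numeral)
  \<comment> \<open>The section takes the same value at \<open>w\<close> and \<open>- w\<close>. In
    the odd classes these contributions cancel, which is why the formulas for ranks 1 and 3
    coincide; in classes 0 and 2 they add up to 4/6 and -2/6.\<close>
  have r: "rbar 0 0 q = rank_section 1 / 6 + 2 / 3 * rank_section (- w) + rank_section (- 1) / 6"
    "rbar 1 0 q = rank_section 1 / 6 - rank_section (- 1) / 6"
    "rbar 2 0 q = rank_section 1 / 6 - 1 / 3 * rank_section (- w) + rank_section (- 1) / 6"
    "rbar 3 0 q = rank_section 1 / 6 - rank_section (- 1) / 6"
    unfolding rbar_values X(2) by (simp_all add: field_simps)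
  show ?thesis
    unfolding \<Sigma>_def[symmetric] d[symmetric] r A C unfolding X(1) by (simp add: algebra_simps)
qed

end
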